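(* Let $C$ be a 2-copula and, for $\theta\in[0,1]$, let $\tilde C_\theta=C+\theta(\Pi-C)$, $\hat C_\theta=C+\theta(M-C)$ and $C_{H_\theta}=(1-\theta)C+\theta C_1$, where $C_1(x,y)=C(x,y)+(x-C(x,y))(y-C(x,y))$; equivalently $C_{H_\theta}(x,y)=C(x,y)+\theta(x-C(x,y))(y-C(x,y))$. 1. Any perturbation of the form $\tilde C_\theta$ generates geometrically ergodic Markov chains. 2. Any perturbation of the form $\hat C_\theta$ generates absolutely regular Markov chains, if the original copula $C$ generates absolutely regular Markov chains. 3. Any perturbation of the form $C_{H_\theta}$ (using $C_1$) generates absolutely regular Markov chains when the original copula $C$ generates absolutely regular Markov chains.
   Context: A 2-copula is a distribution function on $[0,1]^2$ with uniform marginals; $M(u,v)=\min(u,v)$, $\Pi(u,v)=uv$. A copula $D$ generates the stationary Markov chain $(X_i)_{i\in\mathbb Z}$ with uniform $(0,1)$ marginals for which every pair $(X_i,X_{i+1})$ has joint distribution function $D$. For $\sigma$-fields $\mathscr A,\mathscr B$, $\beta(\mathscr A,\mathscr B)=\mathbb E\sup_{B\in\mathscr B}|P(B\mid\mathscr A)-P(B)|$, and $\beta_n=\beta(\sigma(X_i,i\le0),\sigma(X_i,i\ge n))$. The chain is absolutely regular ($\beta$-mixing) if $\beta_n\to0$, and geometrically ergodic if $\beta_n\to0$ exponentially fast as $n\to\infty$.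
   Formalization: Item 1 is stated only for θ>0 and item 2 only for θ<1: at θ=0 item 1 fails for C=M, and at θ=1 the copula Ĉ_1 equals M, which is never absolutely regular; item 3 keeps all θ in [0,1]. *)

theory Defs
  imports "HOL-Probability.Probability"
begin

abbreviation unif01 :: "real measure" where
  "unif01 \<equiv> uniform_measure lborel {0<..<1}"

text \<open>Only the values of \<open>C\<close> on the unit square matter; a copula is represented by any total
  function on \<open>\<real> \<times> \<real>\<close> that has the right values there.\<close>

definition copula :: "(real \<Rightarrow> real \<Rightarrow> real) \<Rightarrow> bool" where
  "copula C \<longleftrightarrow> (\<exists>\<mu> :: (real \<times> real) measure.
     prob_space \<mu> \<and> sets \<mu> = sets borel \<and>
     distr \<mu> borel fst = unif01 \<and> distr \<mu> borel snd = unif01 \<and>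
     (\<forall>x\<in>{0..1}. \<forall>y\<in>{0..1}. C x y = measure \<mu> ({..x} \<times> {..y})))"

definition M_copula :: "real \<Rightarrow> real \<Rightarrow> real" where
  "M_copula u v = min u v"

definition Pi_copula :: "real \<Rightarrow> real \<Rightarrow> real" where
  "Pi_copula u v = u * v"

definition C_tilde :: "(real \<Rightarrow> real \<Rightarrow> real) \<Rightarrow> real \<Rightarrow> real \<Rightarrow> real \<Rightarrow> real" where
  "C_tilde C \<theta> x y = C x y + \<theta> * (Pi_copula x y - C x y)"

definition C_hat :: "(real \<Rightarrow> real \<Rightarrow> real) \<Rightarrow> real \<Rightarrow> real \<Rightarrow> real \<Rightarrow> real" where
  "C_hat C \<theta> x y = C x y + \<theta> * (M_copula x y - C x y)"

definition C_one :: "(real \<Rightarrow> real \<Rightarrow> real) \<Rightarrow> real \<Rightarrow> real \<Rightarrow> real" where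
  "C_one C x y = C x y + (x - C x y) * (y - C x y)"

definition C_H :: "(real \<Rightarrow> real \<Rightarrow> real) \<Rightarrow> real \<Rightarrow> real \<Rightarrow> real \<Rightarrow> real" where
  "C_H C \<theta> x y = (1 - \<theta>) * C x y + \<theta> * C_one C x y"

lemma C_H_alt: "C_H C \<theta> x y = C x y + \<theta> * ((x - C x y) * (y - C x y))"
  by (simp add: C_H_def C_one_def algebra_simps)

definition sigma_of :: "'a measure \<Rightarrow> (int \<Rightarrow> 'a \<Rightarrow> real) \<Rightarrow> int set \<Rightarrow> 'a measure" where
  "sigma_of M X I = sigma (space M) {X i -` A \<inter> space M | i A. i \<in> I \<and> A \<in> sets borel}"

definition cond_prob_given :: "'a measure \<Rightarrow> 'a measure \<Rightarrow> 'a set \<Rightarrow> 'a \<Rightarrow> real" where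
  "cond_prob_given M F B = real_cond_exp M F (indicator B)"

definition strictly_stationary :: "'a measure \<Rightarrow> (int \<Rightarrow> 'a \<Rightarrow> real) \<Rightarrow> bool" where
  "strictly_stationary M X \<longleftrightarrow> (\<forall>k.
     distr M (PiM UNIV (\<lambda>_. borel)) (\<lambda>\<omega> i. X (i + k) \<omega>) =
     distr M (PiM UNIV (\<lambda>_. borel)) (\<lambda>\<omega> i. X i \<omega>))"

definition markov_property :: "'a measure \<Rightarrow> (int \<Rightarrow> 'a \<Rightarrow> real) \<Rightarrow> bool" where
  "markov_property M X \<longleftrightarrow> (\<forall>n. \<forall>A\<in>sets borel. AE \<omega> in M.
     cond_prob_given M (sigma_of M X {..n}) (X (n + 1) -` A \<inter> space M) \<omega> =
     cond_prob_given M (sigma_of M X {n}) (X (n + 1) -` A \<inter> space M) \<omega>)"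

definition copula_markov_chain ::
  "(real \<Rightarrow> real \<Rightarrow> real) \<Rightarrow> 'a measure \<Rightarrow> (int \<Rightarrow> 'a \<Rightarrow> real) \<Rightarrow> bool" where
  "copula_markov_chain D M X \<longleftrightarrow>
     prob_space M \<and> (\<forall>i. X i \<in> borel_measurable M) \<and>
     strictly_stationary M X \<and> markov_property M X \<and>
     (\<forall>i. distr M borel (X i) = unif01) \<and>
     (\<forall>i. \<forall>x\<in>{0..1}. \<forall>y\<in>{0..1}.
        measure M {\<omega> \<in> space M. X i \<omega> \<le> x \<and> X (i + 1) \<omega> \<le> y} = D x y)"

text \<open>
  A conditional probability given a \<open>\<sigma>\<close>-field is determined only up to a null set depending on
  the event, so the supremum of \<open>\<bar>P(B | A) - P(B)\<bar>\<close> over an uncountable \<open>\<sigma>\<close>-field of events \<open>B\<close>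
  has to be read as an essential supremum, i.e. as the least measurable function (up to null sets)
  that almost everywhere dominates each member of the family. It exists for every bounded family
  on a probability space and is unique up to a null set, so the choice made in \<open>beta_coeff\<close>
  does not affect the expectation.
\<close>

definition is_ess_sup ::
  "'a measure \<Rightarrow> 'i set \<Rightarrow> ('i \<Rightarrow> 'a \<Rightarrow> real) \<Rightarrow> ('a \<Rightarrow> real) \<Rightarrow> bool" where
  "is_ess_sup M I f Z \<longleftrightarrow>
     Z \<in> borel_measurable M \<and> (\<forall>i\<in>I. AE \<omega> in M. f i \<omega> \<le> Z \<omega>) \<and>
     (\<forall>Z'\<in>borel_measurable M. (\<forall>i\<in>I. AE \<omega> in M. f i \<omega> \<le> Z' \<omega>) \<longrightarrow>
        (AE \<omega> in M. Z \<omega> \<le> Z' \<omega>))"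

definition beta_coeff :: "'a measure \<Rightarrow> 'a measure \<Rightarrow> 'a measure \<Rightarrow> real" where
  "beta_coeff M F G = (LINT \<omega>|M.
     (SOME Z. is_ess_sup M (sets G) (\<lambda>B \<omega>. \<bar>cond_prob_given M F B \<omega> - measure M B\<bar>) Z) \<omega>)"

definition beta_mix :: "'a measure \<Rightarrow> (int \<Rightarrow> 'a \<Rightarrow> real) \<Rightarrow> nat \<Rightarrow> real" where
  "beta_mix M X n = beta_coeff M (sigma_of M X {..0}) (sigma_of M X {int n..})"

definition absolutely_regular :: "'a measure \<Rightarrow> (int \<Rightarrow> 'a \<Rightarrow> real) \<Rightarrow> bool" where
  "absolutely_regular M X \<longleftrightarrow> beta_mix M X \<longlonglongrightarrow> 0"

definition geometrically_ergodic :: "'a measure \<Rightarrow> (int \<Rightarrow> 'a \<Rightarrow> real) \<Rightarrow> bool" where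
  "geometrically_ergodic M X \<longleftrightarrow>
     (\<exists>K r. 0 < r \<and> r < 1 \<and> (\<forall>n. beta_mix M X n \<le> K * r ^ n))"

end

(*  The coefficient beta_n of a stationary Markov chain with kernel K and invariant law L is controlled
    from both sides by total variation distances of the laws K^n(x, .).  A perturbed copula has a
    mixture of kernels as its kernel.

    For the perturbation by Pi the kernel (1 - theta) P + theta L contracts total variation by the
    factor 1 - theta.

    For the other two perturbations consider d_n(x, y) = TV(K^n(x, .), K^n(y, .)), which decreases to
    a limit d that is invariant under the product chain.  The perturbed copula charges every
    rectangle charged by C; as the product chain of C is mixing, its level sets can only be trivial,
    so d is almost everywhere a constant c.  A coupling argument gives c <= d_n c, so c > 0 would
    make K^n(x, .) and K^n(y, .) mutually singular for all n, which is excluded by comparison with C,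
    or, for C_one itself, by an absolutely continuous part of its law.  *)
theory Submission
  imports Defs
begin

section \<open>Disintegration of a law on the plane\<close>

text \<open>Regularity of \<open>C\<close> gives convergence in total variation only in the mean
  over the starting point, and all laws may be singular, so no uniform minorization is at hand; this
  is why invariant functions of the product chain are used. The inequality K >= (1 - \<theta>) P
  between kernels loses a factor (1 - \<theta>) ^ n after n steps, so it cannot yield convergence;
  it is used at one fixed n, to exclude singularity. For \<theta> = 1 the law of
  \<open>C_one C\<close> need not dominate that of \<open>C\<close> on general sets, only on
  rectangles: the coordinatewise maximum of two independent points of A x B stays in A x B.
  Rectangles suffice for product chains: the event that a pair enters S from outside, seen as a set
  of two transitions (x, y) and (x', y'), has rectangular sections once one transition is fixed, so
  K can be exchanged for P one coordinate at a time. Conditional probabilities are fixed only up to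
  null sets depending on the event; testing total variation on a countable family of open sets keeps
  it measurable and lets these null sets be collected.\<close>

lemma AE_le_if_set_nn_integral_le:
  assumes [measurable]: "f \<in> borel_measurable M" "g \<in> borel_measurable M"
    and fin: "(\<integral>\<^sup>+x. f x \<partial>M) \<noteq> \<infinity>"
    and le: "\<And>A. A \<in> sets M \<Longrightarrow> (\<integral>\<^sup>+x\<in>A. f x \<partial>M) \<le> (\<integral>\<^sup>+x\<in>A. g x \<partial>M)"
  shows "AE x in M. f x \<le> g x"
proof (rule ccontr)
  assume neg: "\<not> ?thesis"
  define A where "A = {x \<in> space M. g x < f x}"
  have [measurable]: "A \<in> sets M" by (simp add: A_def)
  have "(\<integral>\<^sup>+x\<in>A. g x \<partial>M) \<le> (\<integral>\<^sup>+x. f x \<partial>M)"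
    by (intro nn_integral_mono) (auto simp: A_def indicator_def)
  then have fin': "(\<integral>\<^sup>+x\<in>A. g x \<partial>M) \<noteq> \<infinity>"
    using fin by (auto simp: top_unique)
  have "\<not> (AE x in M. f x * indicator A x \<le> g x * indicator A x)"
  proof
    assume "AE x in M. f x * indicator A x \<le> g x * indicator A x"
    with AE_space have "AE x in M. f x \<le> g x"
    proof eventually_elim
      case (elim x)
      then show ?case by (cases "g x < f x") (auto simp: A_def)
    qed
    with neg show False by simp
  qed
  then have "(\<integral>\<^sup>+x\<in>A. g x \<partial>M) < (\<integral>\<^sup>+x\<in>A. f x \<partial>M)"
    using fin' by (intro nn_integral_less) (auto simp: A_def indicator_def)
  with le[of A] show False by simp
qed

text \<open>The Radon-Nikodym densities \<open>F q\<close> of the measures A |-> \<mu> (A x {..q})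
  behave, off a null set, like a distribution function in rational q. Its right-continuous
  regularization is the distribution function of \<open>K x\<close>, and monotone limits carry the
  integral identity over to it.\<close>

lemma real_disintegration:
  fixes \<mu> :: "(real \<times> real) measure"
  assumes "prob_space \<mu>" and sets_mu [measurable_cong]: "sets \<mu> = sets (borel \<Otimes>\<^sub>M borel)"
    and L: "L = distr \<mu> borel fst"
  shows "\<exists>K \<in> borel \<rightarrow>\<^sub>M prob_algebra borel. \<forall>A\<in>sets borel. \<forall>B\<in>sets borel.
    emeasure \<mu> (A \<times> B) = (\<integral>\<^sup>+x\<in>A. emeasure (K x) B \<partial>L)"
proof -
  interpret mu: prob_space \<mu> by fact
  have sp [simp]: "space \<mu> = UNIV"
    using sets_eq_imp_space_eq[OF sets_mu] by (simp add: space_pair_measure)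
  interpret L: prob_space L unfolding L by (rule mu.prob_space_distr) simp
  have sL [measurable_cong]: "sets L = sets borel" by (simp add: L)
  have spL [simp]: "space L = UNIV" by (simp add: L)
  have L_emeasure: "emeasure L A = emeasure \<mu> (A \<times> UNIV)" if "A \<in> sets borel" for A
    using that by (simp add: L emeasure_distr) (metis Sigma_cong UNIV_Times_UNIV fst_vimage_eq_Times vimage_fst)
  have "\<exists>f\<in>borel_measurable borel. \<forall>A\<in>sets borel. emeasure \<mu> (A \<times> {..q}) = (\<integral>\<^sup>+x\<in>A. f x \<partial>L)" for q :: real
  proof -
    define \<nu> where "\<nu> = distr (density \<mu> (indicator (UNIV \<times> {..q}))) borel fst"
    have \<nu>: "emeasure \<nu> A = emeasure \<mu> (A \<times> {..q})" if [measurable]: "A \<in> sets borel" for A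
    proof -
      have "fst -` A \<inter> space \<mu> = A \<times> (UNIV :: real set)" by auto
      then have "emeasure \<nu> A = emeasure (density \<mu> (indicator (UNIV \<times> {..q}))) (A \<times> UNIV)"
        by (simp add: \<nu>_def emeasure_distr)
      also have "\<dots> = (\<integral>\<^sup>+z. indicator (A \<times> {..q}) z \<partial>\<mu>)"
        by (subst emeasure_density) (auto intro!: nn_integral_cong split: split_indicator simp del: nn_integral_indicator)
      finally show ?thesis by simp
    qed
    have sn: "sets \<nu> = sets L" by (simp add: \<nu>_def sL)
    have "absolutely_continuous L \<nu>"
      unfolding absolutely_continuous_def
    proof
      fix A assume A: "A \<in> null_sets L"
      then have [measurable]: "A \<in> sets borel" using sL by auto
      have "emeasure \<nu> A \<le> emeasure L A"
        by (simp add: \<nu> L_emeasure) (intro emeasure_mono, auto)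
      with A show "A \<in> null_sets \<nu>" by (simp add: null_sets_def sn)
    qed
    from L.Radon_Nikodym[OF this sn] obtain f where f: "f \<in> borel_measurable L" "density L f = \<nu>" by blast
    have [measurable]: "f \<in> borel_measurable borel" using f(1) measurable_cong_sets[OF sL refl] by blast
    show ?thesis
    proof (intro bexI ballI)
      fix A :: "real set" assume [measurable]: "A \<in> sets borel"
      show "emeasure \<mu> (A \<times> {..q}) = (\<integral>\<^sup>+x\<in>A. f x \<partial>L)"
        by (simp add: \<nu>[symmetric] f(2)[symmetric] emeasure_density)
    qed fact
  qed
  then obtain F where F [measurable]: "\<And>q. F q \<in> borel_measurable borel"
    and F_eq: "\<And>q A. A \<in> sets borel \<Longrightarrow> emeasure \<mu> (A \<times> {..q}) = (\<integral>\<^sup>+x\<in>A. F q x \<partial>L)"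
    by metis
  have F_int: "(\<integral>\<^sup>+x. F q x \<partial>L) = emeasure \<mu> (UNIV \<times> {..q})" for q
    using F_eq[of UNIV q] by simp
  have F_mono: "AE x in L. F q x \<le> F r x" if "q \<le> r" for q r
  proof (rule AE_le_if_set_nn_integral_le)
    show "(\<integral>\<^sup>+x. F q x \<partial>L) \<noteq> \<infinity>" by (simp add: F_int)
    fix A assume "A \<in> sets L"
    then have [measurable]: "A \<in> sets borel" using sL by simp
    show "(\<integral>\<^sup>+x\<in>A. F q x \<partial>L) \<le> (\<integral>\<^sup>+x\<in>A. F r x \<partial>L)"
      using that by (simp add: F_eq[symmetric]) (intro emeasure_mono, auto)
  qed measurable
  have F_le1: "AE x in L. F q x \<le> 1" for q
  proof (rule AE_le_if_set_nn_integral_le)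
    show "(\<integral>\<^sup>+x. F q x \<partial>L) \<noteq> \<infinity>" by (simp add: F_int)
    fix A assume "A \<in> sets L"
    then have [measurable]: "A \<in> sets borel" using sL by simp
    show "(\<integral>\<^sup>+x\<in>A. F q x \<partial>L) \<le> (\<integral>\<^sup>+x\<in>A. 1 \<partial>L)"
      by (simp add: F_eq[symmetric] sL L_emeasure) (intro emeasure_mono, auto)
  qed measurable
  have F_bot: "AE x in L. (INF n. F (- real n) x) = 0"
  proof -
    have "(\<integral>\<^sup>+x. (INF n. F (- real n) x) \<partial>L) = (INF n. \<integral>\<^sup>+x. F (- real n) x \<partial>L)"
      by (rule nn_integral_monotone_convergence_INF_AE') (auto intro!: F_mono simp: F_int less_top[symmetric])
    also have "\<dots> = (INF n. emeasure \<mu> (UNIV \<times> {..- real n}))" by (simp add: F_int)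
    also have "\<dots> = emeasure \<mu> (\<Inter>n. UNIV \<times> {..- real n})"
      by (rule INF_emeasure_decseq) (auto simp: decseq_def)
    also have "(\<Inter>n. (UNIV :: real set) \<times> {..- real n}) = {}"
      using reals_Archimedean2 by (auto, metis leD le_minus_iff reals_Archimedean2)
    finally have "(\<integral>\<^sup>+x. (INF n. F (- real n) x) \<partial>L) = 0" by simp
    then show ?thesis by (subst (asm) nn_integral_0_iff_AE) auto
  qed
  have F_top: "AE x in L. (SUP n. F (real n) x) = 1"
  proof -
    have mono: "AE x in L. \<forall>n. F (real n) x \<le> F (real (Suc n)) x"
      unfolding AE_all_countable by (intro allI F_mono) simp
    have "(\<integral>\<^sup>+x. (SUP n. F (real n) x) \<partial>L) = (SUP n. \<integral>\<^sup>+x. F (real n) x \<partial>L)"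
      using mono by (intro nn_integral_monotone_convergence_SUP_AE) (auto intro!: F_mono)
    also have "\<dots> = (SUP n. emeasure \<mu> (UNIV \<times> {..real n}))" by (simp add: F_int)
    also have "\<dots> = emeasure \<mu> (\<Union>n. UNIV \<times> {..real n})"
      by (rule SUP_emeasure_incseq) (auto simp: incseq_def)
    also have "(\<Union>n. (UNIV :: real set) \<times> {..real n}) = space \<mu>"
      using real_arch_simple by auto
    finally have int: "(\<integral>\<^sup>+x. (SUP n. F (real n) x) \<partial>L) = 1" using mu.emeasure_space_1 by simp
    have le: "AE x in L. (SUP n. F (real n) x) \<le> 1"
    proof -
      have "AE x in L. \<forall>n. F (real n) x \<le> 1" unfolding AE_all_countable by (intro allI F_le1)
      then show ?thesis by eventually_elim (auto intro: SUP_least)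
    qed
    have "AE x in L. 1 \<le> (SUP n. F (real n) x)"
    proof (rule ccontr)
      assume "\<not> ?thesis"
      from nn_integral_less[OF _ _ _ le this] show False
        using L.emeasure_space_1 by (simp add: int)
    qed
    with le show ?thesis by eventually_elim auto
  qed
  \<comment> \<open>Each property of \<open>F\<close> holds only almost everywhere, so it is asked
    at countably many arguments: rationals for monotonicity, integers for the limits. This leaves a
    measurable set of full measure.\<close>
  define good where "good x \<longleftrightarrow> (\<forall>q\<in>\<rat>. \<forall>r\<in>\<rat>. q \<le> r \<longrightarrow> F q x \<le> F r x) \<and> (\<forall>q\<in>\<rat>. F q x \<le> 1) \<and>
    (INF n. F (- real n) x) = 0 \<and> (SUP n. F (real n) x) = 1" for x
  have good_meas [measurable]: "Measurable.pred borel good"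
  proof -
    have good_iff: "good x \<longleftrightarrow> (\<forall>q r :: rat. q \<le> r \<longrightarrow> F (of_rat q) x \<le> F (of_rat r) x) \<and> (\<forall>q :: rat. F (of_rat q) x \<le> 1) \<and>
      (INF n. F (- real n) x) = 0 \<and> (SUP n. F (real n) x) = 1" for x
      unfolding good_def Rats_def by (simp add: of_rat_less_eq)
    show ?thesis unfolding good_iff by measurable
  qed
  have good_AE: "AE x in L. good x"
  proof -
    have "AE x in L. \<forall>q\<in>\<rat>. \<forall>r\<in>\<rat>. q \<le> r \<longrightarrow> F q x \<le> F r x"
      by (intro AE_ball_countable[THEN iffD2] countable_rat ballI) (auto simp: F_mono)
    moreover have "AE x in L. \<forall>q\<in>\<rat>. F q x \<le> 1"
      by (intro AE_ball_countable[THEN iffD2] countable_rat ballI F_le1)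
    ultimately show ?thesis using F_bot F_top by eventually_elim (auto simp: good_def)
  qed
  \<comment> \<open>The infimum runs over rationals strictly above y, which makes right-continuity
    automatic whatever versions of the densities were chosen.\<close>
  define H where "H x y = (INF q\<in>{q\<in>\<rat>. y < q}. F q x)" for x y
  have ctb: "countable {q\<in>\<rat>. y < q}" for y :: real by (rule countable_subset[OF _ countable_rat]) auto
  have [measurable]: "(\<lambda>x. H x y) \<in> borel_measurable borel" for y
    unfolding H_def using ctb by (intro borel_measurable_INF) auto
  have H_le1: "H x y \<le> 1" if "good x" for x y
  proof -
    obtain q where "q \<in> \<rat>" "y < q" using Rats_dense_in_real[of y "y + 1"] by auto
    then show ?thesis unfolding H_def using that by (intro INF_lower2[of q]) (auto simp: good_def)
  qed
  have H_mono: "H x y \<le> H x z" if "y \<le> z" for x y z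
    unfolding H_def using that by (intro INF_superset_mono) auto
  have H_le: "H x y \<le> F q x" if "q \<in> \<rat>" "y < q" for x y q
    unfolding H_def using that by (intro INF_lower) auto
  have H_ge: "F q x \<le> H x y" if "good x" "q \<in> \<rat>" "q \<le> y" for x y q
    unfolding H_def using that by (intro INF_greatest) (auto simp: good_def)
  define h where "h x y = enn2real (H x y)" for x y
  have h_nonneg: "0 \<le> h x y" for x y by (simp add: h_def)
  have H_fin: "H x y < top" if "good x" for x y
    using H_le1[OF that, of y] by (rule le_less_trans) simp
  have h_eq: "ennreal (h x y) = H x y" if "good x" for x y
    unfolding h_def by (rule ennreal_enn2real[OF H_fin[OF that]])
  have h_mono: "h x y \<le> h x z" if "good x" "y \<le> z" for x y z
    unfolding h_def by (rule enn2real_mono[OF H_mono[OF that(2)] H_fin[OF that(1)]])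
  have h_less: "h x y < c \<longleftrightarrow> H x y < ennreal c" if "good x" "0 < c" for x y c
    using h_eq[OF that(1), of y] that(2) by (metis ennreal_less_iff h_nonneg)
  have h_gt: "c < h x y \<longleftrightarrow> ennreal c < H x y" if "good x" "0 \<le> c" for x y c
    using h_eq[OF that(1), of y] that(2) by (metis ennreal_less_iff)
  have h_le1: "h x y \<le> 1" if "good x" for x y
    using H_le1[OF that, of y] h_eq[OF that, of y] by (metis ennreal_le_1)
  have h_right: "continuous (at_right a) (h x)" if "good x" for x a
    unfolding continuous_within
  proof (rule order_tendstoI)
    fix c assume "c < h x a"
    then show "\<forall>\<^sub>F y in at_right a. c < h x y"
      using h_mono[OF that] unfolding eventually_at_right_field
      by (intro exI[of _ "a + 1"]) (auto intro: less_le_trans)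
  next
    fix c assume c: "h x a < c"
    then have "0 < c" using h_nonneg[of x a] by simp
    with c have "H x a < ennreal c" using h_less[OF that] by simp
    then obtain q where q: "q \<in> \<rat>" "a < q" "F q x < ennreal c"
      unfolding H_def by (auto simp: INF_less_iff)
    show "\<forall>\<^sub>F y in at_right a. h x y < c"
      unfolding eventually_at_right_field
    proof (intro exI[of _ q] conjI allI impI q)
      fix y assume "a < y" "y < q"
      then show "h x y < c"
        using H_le[OF q(1), of y x] q(3) h_less[OF that \<open>0 < c\<close>] by (auto intro: le_less_trans)
    qed
  qed
  have h_bot: "(h x \<longlongrightarrow> 0) at_bot" if "good x" for x
  proof (rule order_tendstoI)
    fix c :: real assume "c < 0"
    then show "\<forall>\<^sub>F y in at_bot. c < h x y" using h_nonneg by (intro always_eventually) (auto intro: less_le_trans)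
  next
    fix c :: real assume "0 < c"
    then have "(INF n. F (- real n) x) < ennreal c" using that by (simp add: good_def)
    then obtain n where n: "F (- real n) x < ennreal c" by (auto simp: INF_less_iff)
    have "h x y < c" if "y \<le> - real n - 1" for y
    proof -
      have "H x y \<le> F (- real n) x" using that by (intro H_le) auto
      with n show ?thesis using h_less[OF \<open>good x\<close> \<open>0 < c\<close>] by (auto intro: le_less_trans)
    qed
    then show "\<forall>\<^sub>F y in at_bot. h x y < c" unfolding eventually_at_bot_linorder by blast
  qed
  have h_top: "(h x \<longlongrightarrow> 1) at_top" if "good x" for x
  proof (rule order_tendstoI)
    fix c :: real assume "1 < c"
    then show "\<forall>\<^sub>F y in at_top. h x y < c" using h_le1[OF that] by (intro always_eventually) (auto intro: le_less_trans)
  next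
    fix c :: real assume c: "c < 1"
    show "\<forall>\<^sub>F y in at_top. c < h x y"
    proof (cases "0 \<le> c")
      case True
      then have "ennreal c < (SUP n. F (real n) x)" using that c by (simp add: good_def ennreal_less_iff)
      then obtain n where n: "ennreal c < F (real n) x" by (auto simp: less_SUP_iff)
      have "c < h x y" if "y \<ge> real n" for y
        using n H_ge[OF \<open>good x\<close>, of "real n" y] that h_gt[OF \<open>good x\<close> True] by (auto intro: less_le_trans)
      then show ?thesis unfolding eventually_at_top_linorder by blast
    next
      case False
      then show ?thesis using h_nonneg by (intro always_eventually) (smt (verit))
    qed
  qed
  \<comment> \<open>On the exceptional null set any fixed probability serves; it keeps
    \<open>K\<close> a kernel at every point.\<close>
  define K where "K x = (if good x then interval_measure (h x) else return borel 0)" for x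
  have rd: "real_distribution (interval_measure (h x))" if "good x" for x
    using h_mono[OF that] h_right[OF that] h_bot[OF that] h_top[OF that]
    by (rule real_distribution_interval_measure)
  have K_prob: "prob_space (K x)" for x
    using rd[of x] by (auto simp: K_def real_distribution_def intro!: prob_space_return)
  have K_sets: "sets (K x) = sets borel" for x by (simp add: K_def)
  have K_atMost: "emeasure (K x) {..y} = H x y" if "good x" for x y
  proof -
    interpret real_distribution "interval_measure (h x)" by (rule rd[OF that])
    have "cdf (interval_measure (h x)) y = h x y"
      using cdf_interval_measure[of "h x"] h_mono[OF that] h_right[OF that] h_bot[OF that] h_top[OF that] by simp
    then show ?thesis using that by (simp add: K_def h_eq[symmetric] cdf_def2 emeasure_eq_measure)
  qed
  have K_meas [measurable]: "K \<in> borel \<rightarrow>\<^sub>M prob_algebra borel"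
  proof (rule measurable_prob_algebra_generated)
    show "sets (borel :: real measure) = sigma_sets UNIV (range (\<lambda>a. {..a}))"
      by (subst borel_eq_atMost) simp
    show "Int_stable (range (\<lambda>a::real. {..a}))" by (auto simp: Int_stable_def)
    fix A assume "A \<in> range (\<lambda>a::real. {..a})"
    then obtain y where A: "A = {..y}" by auto
    have "emeasure (K x) A = (if good x then H x y else indicator {..y} 0)" for x
      using K_atMost by (simp add: K_def A)
    then show "(\<lambda>x. emeasure (K x) A) \<in> borel_measurable borel" by simp
  qed (auto simp: K_prob K_sets)
  note [measurable] = measurable_prob_algebraD[OF K_meas]
  have main: "emeasure \<mu> (A \<times> {..y}) = (\<integral>\<^sup>+x\<in>A. emeasure (K x) {..y} \<partial>L)" if [measurable]: "A \<in> sets borel" for A y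
  proof -
    obtain q where q: "\<And>n. q n \<in> \<rat>" "\<And>n. y < q n" "decseq q" "q \<longlonglongrightarrow> y"
    proof -
      have "\<exists>r\<in>\<rat>. y < r \<and> r < y + 1 / real (Suc n)" for n by (rule Rats_dense_in_real) simp
      then obtain r where r: "\<And>n. r n \<in> \<rat>" "\<And>n. y < r n" "\<And>n. r n < y + 1 / real (Suc n)" by metis
      \<comment> \<open>Running minima turn the approximating rationals into a decreasing sequence,
        as monotone convergence requires.\<close>
      define q where "q n = Min (r ` {..n})" for n
      have q_le: "q n \<le> r n" for n by (simp add: q_def)
      have "q n \<in> r ` {..n}" for n unfolding q_def by (rule Min_in) auto
      then have q: "q n \<in> \<rat>" "y < q n" for n using r(1,2) by (metis imageE)+
      have "(\<lambda>n. y + 1 / real (Suc n)) \<longlonglongrightarrow> y + 0"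
        by (intro tendsto_intros LIMSEQ_Suc[OF lim_1_over_n])
      then have "q \<longlonglongrightarrow> y"
        using q(2) order_trans[OF q_le less_imp_le[OF r(3)]]
        by (intro tendsto_sandwich[of "\<lambda>_. y" q _ "\<lambda>n. y + 1 / real (Suc n)"]) (auto simp: less_imp_le)
      moreover have "decseq q" unfolding q_def by (intro decseq_SucI Min_antimono) auto
      ultimately show ?thesis using q by (intro that[of q])
    qed
    have Inter: "(\<Inter>n. A \<times> {..q n}) = A \<times> {..y}"
    proof -
      have "z \<le> y" if "\<And>n. z \<le> q n" for z
        using that q(4) by (intro LIMSEQ_le_const[of q y z]) auto
      then show ?thesis using q(2) by (auto dest: less_imp_le intro: order_trans[OF _ less_imp_le[OF q(2)]])
    qed
    have INF_eq: "(INF n. F (q n) x * indicator A x) = H x y * indicator A x" if "good x" for x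
    proof (cases "x \<in> A")
      case True
      have "H x y = (INF n. F (q n) x)"
      proof (rule antisym)
        show "H x y \<le> (INF n. F (q n) x)" using q by (intro INF_greatest H_le) auto
        show "(INF n. F (q n) x) \<le> H x y"
          unfolding H_def
        proof (rule INF_greatest)
          fix r assume r: "r \<in> {q \<in> \<rat>. y < q}"
          then obtain n where "q n < r" using order_tendstoD(2)[OF q(4), of r] eventually_sequentially by auto
          then show "(INF n. F (q n) x) \<le> F r x"
            using r q \<open>good x\<close> by (intro INF_lower2[of n]) (auto simp: good_def)
        qed
      qed
      with True show ?thesis by simp
    qed simp
    have "emeasure \<mu> (A \<times> {..y}) = (INF n. emeasure \<mu> (A \<times> {..q n}))"
      unfolding Inter[symmetric] using q(3) by (intro INF_emeasure_decseq[symmetric]) (auto simp: decseq_def intro: order_trans)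
    also have "\<dots> = (INF n. \<integral>\<^sup>+x. F (q n) x * indicator A x \<partial>L)" by (simp add: F_eq)
    also have "\<dots> = (\<integral>\<^sup>+x. (INF n. F (q n) x * indicator A x) \<partial>L)"
    proof (rule nn_integral_monotone_convergence_INF_AE'[symmetric])
      show "(\<integral>\<^sup>+x. F (q 0) x * indicator A x \<partial>L) < \<infinity>"
        by (simp add: F_eq[symmetric] less_top[symmetric])
      show "AE x in L. F (q (Suc n)) x * indicator A x \<le> F (q n) x * indicator A x" for n
        using F_mono[of "q (Suc n)" "q n"] q(3) by (auto simp: decseq_def indicator_def)
    qed measurable
    also have "\<dots> = (\<integral>\<^sup>+x\<in>A. emeasure (K x) {..y} \<partial>L)"
      proof (rule nn_integral_cong_AE)
      show "AE x in L. (INF n. F (q n) x * indicator A x) = emeasure (K x) {..y} * indicator A x"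
        using good_AE by eventually_elim (simp only: INF_eq K_atMost)
    qed
    finally show ?thesis .
  qed
  show ?thesis
  proof (intro bexI[OF _ K_meas] ballI)
    fix A B :: "real set" assume [measurable]: "A \<in> sets borel" "B \<in> sets borel"
    \<comment> \<open>For fixed A both sides are finite measures in B, so the agreement on
      half-lines in \<open>main\<close> extends to all Borel sets.\<close>
    define \<mu>A where "\<mu>A = distr (density \<mu> (indicator (A \<times> UNIV))) borel snd"
    define \<nu>A where "\<nu>A = density L (indicator A) \<bind> K"
    have \<mu>A: "emeasure \<mu>A B = emeasure \<mu> (A \<times> B)" if [measurable]: "B \<in> sets borel" for B
    proof -
      have "snd -` B \<inter> space \<mu> = (UNIV :: real set) \<times> B" by auto
      then have "emeasure \<mu>A B = emeasure (density \<mu> (indicator (A \<times> UNIV))) (UNIV \<times> B)"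
        by (simp add: \<mu>A_def emeasure_distr)
      also have "\<dots> = (\<integral>\<^sup>+z. indicator (A \<times> B) z \<partial>\<mu>)"
        by (subst emeasure_density) (auto intro!: nn_integral_cong split: split_indicator simp del: nn_integral_indicator)
      finally show ?thesis by simp
    qed
    have \<nu>A: "emeasure \<nu>A B = (\<integral>\<^sup>+x\<in>A. emeasure (K x) B \<partial>L)" if [measurable]: "B \<in> sets borel" for B
      unfolding \<nu>A_def
      by (subst emeasure_bind[where N=borel])
         (auto simp: nn_integral_density mult.commute)
    have "\<mu>A = \<nu>A"
    proof (rule measure_eqI_generator_eq)
      show "Int_stable (range (\<lambda>a::real. {..a}))" by (auto simp: Int_stable_def)
      show "sets \<mu>A = sigma_sets UNIV (range (\<lambda>a::real. {..a}))"
        by (simp add: \<mu>A_def borel_eq_atMost)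
      show "sets \<nu>A = sigma_sets UNIV (range (\<lambda>a::real. {..a}))"
        unfolding \<nu>A_def
        by (subst sets_bind[where N=borel]) (auto simp: K_sets borel_eq_atMost)
      show "range (\<lambda>n. {..real n}) \<subseteq> range (\<lambda>a::real. {..a})" by auto
      show "(\<Union>n. {..real n}) = UNIV" using real_arch_simple by auto
      fix X assume "X \<in> range (\<lambda>a::real. {..a})"
      then show "emeasure \<mu>A X = emeasure \<nu>A X" using main by (auto simp: \<mu>A \<nu>A)
    next
      show "emeasure \<mu>A {..real n} \<noteq> \<infinity>" for n by (simp add: \<mu>A)
    qed auto
    then show "emeasure \<mu> (A \<times> B) = (\<integral>\<^sup>+x\<in>A. emeasure (K x) B \<partial>L)"
      by (simp add: \<mu>A[symmetric] \<nu>A[symmetric])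
  qed
qed

section \<open>Total variation distance\<close>

text \<open>Finite unions are taken so that every open set is an increasing union of members; a bare
  basis would not give this. Countability lets null sets be collected and suprema stay
  measurable.\<close>

definition basis_unions :: "'a::second_countable_topology set set" where
  "basis_unions = Union ` {F. finite F \<and> F \<subseteq> (SOME B. countable B \<and> topological_basis B)}"

lemma countable_basis_unions: "countable (basis_unions :: 'a::second_countable_topology set set)"
proof -
  have "\<exists>B :: 'a set set. countable B \<and> topological_basis B" by (rule ex_countable_basis)
  then have "countable (SOME B :: 'a set set. countable B \<and> topological_basis B)"
    by (rule someI2_ex) simp
  then show ?thesis
    unfolding basis_unions_def by (intro countable_image countable_Collect_finite_subset)
qed

lemma empty_basis_unions: "{} \<in> basis_unions"
  unfolding basis_unions_def by (rule image_eqI[of _ _ "{}"]) auto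

lemma open_basis_unions:
  fixes U :: "'a::second_countable_topology set"
  assumes "U \<in> basis_unions"
  shows "open U"
proof -
  have "\<exists>B :: 'a set set. countable B \<and> topological_basis B" by (rule ex_countable_basis)
  then have "topological_basis (SOME B :: 'a set set. countable B \<and> topological_basis B)"
    by (rule someI2_ex) simp
  with assms show ?thesis
    unfolding basis_unions_def by (auto intro!: open_Union topological_basis_open)
qed

lemma sets_basis_unions: "U \<in> basis_unions \<Longrightarrow> U \<in> sets borel"
  by (simp add: open_basis_unions)

lemma open_eq_incseq_basis_unions:
  assumes "open (U :: 'a::second_countable_topology set)"
  obtains V where "\<And>n. V n \<in> basis_unions" "incseq V" "(\<Union>n. V n) = U"
proof -
  define B where "B = (SOME B :: 'a set set. countable B \<and> topological_basis B)"
  have "\<exists>B :: 'a set set. countable B \<and> topological_basis B" by (rule ex_countable_basis)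
  then have "countable B \<and> topological_basis B" unfolding B_def by (rule someI_ex)
  then obtain C where C: "C \<subseteq> B" "\<Union>C = U" "countable C"
    using assms by (metis topological_basis_def countable_subset)
  show ?thesis
  proof (cases "C = {}")
    case True
    with C show ?thesis by (intro that[of "\<lambda>_. {}"]) (auto simp: empty_basis_unions incseq_def)
  next
    case False
    define V where "V n = \<Union>(from_nat_into C ` {..n})" for n
    show ?thesis
    proof (rule that[of V])
      show "V n \<in> basis_unions" for n
        unfolding V_def basis_unions_def B_def[symmetric]
        using C(1) from_nat_into[OF False] by (intro imageI) auto
      show "incseq V" by (force simp: incseq_def V_def)
      have "(\<Union>n. V n) = \<Union>(range (from_nat_into C))" by (auto simp: V_def)
      then show "(\<Union>n. V n) = U" using C(2) by (simp add: range_from_nat_into[OF False C(3)])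
    qed
  qed
qed

text \<open>Outer regularity supplies an open superset for each measure; the intersection of the two
  is good for both, and increasing members of \<open>basis_unions\<close> exhaust it. Differences of
  two measures need one and the same \<open>V\<close>.\<close>

lemma basis_unions_approx:
  fixes \<mu> \<nu> :: "'a::polish_space measure"
  assumes \<mu>: "\<mu> \<in> space (prob_algebra borel)" and \<nu>: "\<nu> \<in> space (prob_algebra borel)"
    and B [measurable]: "B \<in> sets borel" and "0 < e"
  obtains V where "V \<in> basis_unions" "\<bar>measure \<mu> V - measure \<mu> B\<bar> < e" "\<bar>measure \<nu> V - measure \<nu> B\<bar> < e"
proof -
  have outer: "\<exists>U. open U \<and> B \<subseteq> U \<and> measure M U < measure M B + e"
    if M: "M \<in> space (prob_algebra borel)" for M :: "'a measure"
  proof -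
    interpret prob_space M using M by (simp add: space_prob_algebra)
    have [measurable_cong]: "sets M = sets borel" using M by (simp add: space_prob_algebra)
    have "emeasure M B = (INF U \<in> {U. B \<subseteq> U \<and> open U}. emeasure M U)"
      using M B by (intro outer_regular) (auto simp: space_prob_algebra)
    moreover have "emeasure M B < ennreal (measure M B + e)"
      using \<open>0 < e\<close> by (simp add: emeasure_eq_measure ennreal_less_iff)
    ultimately obtain U where "B \<subseteq> U" "open U" "emeasure M U < ennreal (measure M B + e)"
      by (auto simp: INF_less_iff)
    then show ?thesis
      by (intro exI[of _ U]) (auto simp: emeasure_eq_measure ennreal_less_iff)
  qed
  interpret \<mu>: prob_space \<mu> using \<mu> by (simp add: space_prob_algebra)
  interpret \<nu>: prob_space \<nu> using \<nu> by (simp add: space_prob_algebra)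
  have [measurable_cong]: "sets \<mu> = sets borel" "sets \<nu> = sets borel"
    using \<mu> \<nu> by (simp_all add: space_prob_algebra)
  obtain U1 where U1: "open U1" "B \<subseteq> U1" "measure \<mu> U1 < measure \<mu> B + e" using outer[OF \<mu>] by auto
  obtain U2 where U2: "open U2" "B \<subseteq> U2" "measure \<nu> U2 < measure \<nu> B + e" using outer[OF \<nu>] by auto
  define U where "U = U1 \<inter> U2"
  have [measurable]: "U \<in> sets borel" "U1 \<in> sets borel" "U2 \<in> sets borel" using U1(1) U2(1) by (auto simp: U_def)
  have U: "open U" "measure \<mu> B \<le> measure \<mu> U" "measure \<nu> B \<le> measure \<nu> U"
    "measure \<mu> U < measure \<mu> B + e" "measure \<nu> U < measure \<nu> B + e"
  proof -
    show "open U" using U1 U2 by (auto simp: U_def)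
    show "measure \<mu> B \<le> measure \<mu> U" "measure \<nu> B \<le> measure \<nu> U"
      using U1 U2 by (auto simp: U_def intro!: \<mu>.finite_measure_mono \<nu>.finite_measure_mono)
    have "measure \<mu> U \<le> measure \<mu> U1" "measure \<nu> U \<le> measure \<nu> U2"
      by (auto simp: U_def intro!: \<mu>.finite_measure_mono \<nu>.finite_measure_mono)
    then show "measure \<mu> U < measure \<mu> B + e" "measure \<nu> U < measure \<nu> B + e" using U1 U2 by simp_all
  qed
  obtain V where V: "\<And>n. V n \<in> basis_unions" "incseq V" "(\<Union>n. V n) = U"
    using open_eq_incseq_basis_unions[OF U(1)] by metis
  have "(\<lambda>n. measure \<mu> (V n)) \<longlonglongrightarrow> measure \<mu> U"
    unfolding V(3)[symmetric] using V by (intro \<mu>.finite_Lim_measure_incseq) (auto simp: \<open>sets \<mu> = sets borel\<close> sets_basis_unions)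
  then have "\<forall>\<^sub>F n in sequentially. measure \<mu> (V n) > measure \<mu> B - e \<and> measure \<mu> (V n) < measure \<mu> B + e"
    using U \<open>0 < e\<close> by (intro eventually_conj order_tendstoD[where y="measure \<mu> U"]) auto
  moreover have "(\<lambda>n. measure \<nu> (V n)) \<longlonglongrightarrow> measure \<nu> U"
    unfolding V(3)[symmetric] using V by (intro \<nu>.finite_Lim_measure_incseq) (auto simp: \<open>sets \<nu> = sets borel\<close> sets_basis_unions)
  then have "\<forall>\<^sub>F n in sequentially. measure \<nu> (V n) > measure \<nu> B - e \<and> measure \<nu> (V n) < measure \<nu> B + e"
    using U \<open>0 < e\<close> by (intro eventually_conj order_tendstoD[where y="measure \<nu> U"]) auto
  ultimately have "\<forall>\<^sub>F n in sequentially. \<bar>measure \<mu> (V n) - measure \<mu> B\<bar> < e \<and> \<bar>measure \<nu> (V n) - measure \<nu> B\<bar> < e"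
    by eventually_elim (auto simp: abs_less_iff)
  then obtain n where "\<bar>measure \<mu> (V n) - measure \<mu> B\<bar> < e \<and> \<bar>measure \<nu> (V n) - measure \<nu> B\<bar> < e"
    by (auto simp: eventually_sequentially)
  with V(1)[of n] that show ?thesis by blast
qed

text \<open>The total variation distance, as a supremum over a countable family of open sets so that
  it depends measurably on the two measures.\<close>

definition tv :: "'a::second_countable_topology measure \<Rightarrow> 'a measure \<Rightarrow> real" where
  "tv \<mu> \<nu> = (SUP U\<in>basis_unions. \<bar>measure \<mu> U - measure \<nu> U\<bar>)"

lemma prob_diff_le_1:
  assumes "\<mu> \<in> space (prob_algebra N)" "\<nu> \<in> space (prob_algebra N)"
  shows "\<bar>measure \<mu> A - measure \<nu> A\<bar> \<le> 1"
proof -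
  have "measure \<mu> A \<le> 1" "measure \<nu> A \<le> 1"
    using assms by (auto simp: space_prob_algebra intro: prob_space.prob_le_1)
  then show ?thesis by (smt (verit) measure_nonneg)
qed

lemma bdd_above_tv:
  assumes "\<mu> \<in> space (prob_algebra borel)" "\<nu> \<in> space (prob_algebra borel)"
  shows "bdd_above ((\<lambda>U. \<bar>measure \<mu> U - measure \<nu> U\<bar>) ` X)"
  using prob_diff_le_1[OF assms] by (auto intro!: bdd_aboveI2)

lemma abs_measure_diff_le_tv:
  fixes \<mu> \<nu> :: "'a::polish_space measure"
  assumes \<mu>: "\<mu> \<in> space (prob_algebra borel)" and \<nu>: "\<nu> \<in> space (prob_algebra borel)"
    and B: "B \<in> sets borel"
  shows "\<bar>measure \<mu> B - measure \<nu> B\<bar> \<le> tv \<mu> \<nu>"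
proof (rule field_le_epsilon)
  fix e :: real assume "0 < e"
  then have "0 < e / 2" by simp
  from basis_unions_approx[OF \<mu> \<nu> B this] obtain V where V: "V \<in> basis_unions"
    "\<bar>measure \<mu> V - measure \<mu> B\<bar> < e / 2" "\<bar>measure \<nu> V - measure \<nu> B\<bar> < e / 2" by metis
  have "\<bar>measure \<mu> V - measure \<nu> V\<bar> \<le> tv \<mu> \<nu>"
    unfolding tv_def using V(1) by (intro cSUP_upper bdd_above_tv \<mu> \<nu>)
  with V(2,3) show "\<bar>measure \<mu> B - measure \<nu> B\<bar> \<le> tv \<mu> \<nu> + e" by (simp add: abs_if split: if_splits)
qed

lemma tv_least:
  assumes "\<And>U. U \<in> basis_unions \<Longrightarrow> \<bar>measure \<mu> U - measure \<nu> U\<bar> \<le> c"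
  shows "tv \<mu> \<nu> \<le> c"
  unfolding tv_def using assms empty_basis_unions by (intro cSUP_least) auto

lemma tv_nonneg:
  assumes "\<mu> \<in> space (prob_algebra borel)" "\<nu> \<in> space (prob_algebra borel)"
  shows "0 \<le> tv \<mu> \<nu>"
  unfolding tv_def
  by (rule cSUP_upper2[OF bdd_above_tv[OF assms] empty_basis_unions]) simp

lemma tv_le_1:
  assumes "\<mu> \<in> space (prob_algebra borel)" "\<nu> \<in> space (prob_algebra borel)"
  shows "tv \<mu> \<nu> \<le> 1"
  by (rule tv_least) (rule prob_diff_le_1[OF assms])

lemma tv_commute: "tv \<mu> \<nu> = tv \<nu> \<mu>"
  by (simp add: tv_def abs_minus_commute)

lemma tv_triangle:
  fixes \<mu> \<nu> \<rho> :: "'a::polish_space measure"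
  assumes "\<mu> \<in> space (prob_algebra borel)" "\<nu> \<in> space (prob_algebra borel)" "\<rho> \<in> space (prob_algebra borel)"
  shows "tv \<mu> \<nu> \<le> tv \<mu> \<rho> + tv \<rho> \<nu>"
proof (rule tv_least)
  fix U :: "'a set" assume "U \<in> basis_unions"
  then have "U \<in> sets borel" by (rule sets_basis_unions)
  from abs_measure_diff_le_tv[OF assms(1,3) this] abs_measure_diff_le_tv[OF assms(3,2) this]
  show "\<bar>measure \<mu> U - measure \<nu> U\<bar> \<le> tv \<mu> \<rho> + tv \<rho> \<nu>" by simp
qed

lemma borel_measurable_tv [measurable (raw)]:
  fixes f g :: "'b \<Rightarrow> 'a::polish_space measure"
  assumes [measurable]: "f \<in> M \<rightarrow>\<^sub>M prob_algebra borel" "g \<in> M \<rightarrow>\<^sub>M prob_algebra borel"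
  shows "(\<lambda>x. tv (f x) (g x)) \<in> borel_measurable M"
proof -
  have 1: "f x \<in> space (prob_algebra borel)" "g x \<in> space (prob_algebra borel)" if "x \<in> space M" for x
    using that by (auto intro: measurable_space assms)
  show ?thesis
    unfolding tv_def
  proof (rule borel_measurable_cSUP[OF countable_basis_unions])
    fix U :: "'a set" assume "U \<in> basis_unions"
    then have [measurable]: "U \<in> sets borel" by (rule sets_basis_unions)
    show "(\<lambda>x. \<bar>measure (f x) U - measure (g x) U\<bar>) \<in> borel_measurable M"
      by (intro borel_measurable_abs borel_measurable_diff
          measurable_compose[OF assms(1) measurable_measure_prob_algebra]
          measurable_compose[OF assms(2) measurable_measure_prob_algebra]) auto
  qed (auto intro!: bdd_above_tv 1)
qed

text \<open>On Y the difference of \<mu> and \<nu> is a nonnegative measure below \<mu>, and h is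
  its density: the indicator of Y minus the density of \<nu> restricted to Y. Only one side is
  treated, so that both halves of a Hahn decomposition can use it.\<close>

lemma density_of_dominated_part:
  assumes "prob_space \<mu>" "prob_space \<nu>" and sets [measurable_cong, simp]: "sets \<nu> = sets \<mu>"
    and Y [measurable]: "Y \<in> sets \<mu>"
    and le: "\<And>X. X \<in> sets \<mu> \<Longrightarrow> X \<subseteq> Y \<Longrightarrow> emeasure \<nu> X \<le> emeasure \<mu> X"
  obtains h :: "'a \<Rightarrow> real" where "h \<in> borel_measurable \<mu>" "\<And>x. 0 \<le> h x" "\<And>x. h x \<le> 1"
    "\<And>f c. f \<in> borel_measurable \<mu> \<Longrightarrow> (\<And>x. \<bar>f x\<bar> \<le> c) \<Longrightarrow>
      (\<integral>x. f x * indicator Y x \<partial>\<mu>) - (\<integral>x. f x * indicator Y x \<partial>\<nu>) = (\<integral>x. f x * h x \<partial>\<mu>)"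
proof -
  interpret \<mu>: prob_space \<mu> by fact
  interpret \<nu>: prob_space \<nu> by fact
  define N where "N = density \<nu> (indicator Y)"
  have N: "emeasure N A = emeasure \<nu> (A \<inter> Y)" if [measurable]: "A \<in> sets \<mu>" for A
    by (simp add: N_def emeasure_density mult.commute flip: indicator_inter_arith)
  have sN [simp, measurable_cong]: "sets N = sets \<mu>" by (simp add: N_def)
  have "absolutely_continuous \<mu> N"
    unfolding absolutely_continuous_def
  proof
    fix A assume A: "A \<in> null_sets \<mu>"
    then have [measurable]: "A \<in> sets \<mu>" by auto
    have "emeasure N A \<le> emeasure \<mu> (A \<inter> Y)" by (simp add: N) (intro le, auto)
    also have "\<dots> \<le> emeasure \<mu> A" by (intro emeasure_mono) auto
    finally show "A \<in> null_sets N" using A by (auto simp: null_sets_def)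
  qed
  from \<mu>.Radon_Nikodym[OF this sN] obtain g where g [measurable]: "g \<in> borel_measurable \<mu>" "density \<mu> g = N" by blast
  have int_g: "(\<integral>\<^sup>+x\<in>A. g x \<partial>\<mu>) = emeasure \<nu> (A \<inter> Y)" if "A \<in> sets \<mu>" for A
    using that by (simp add: N[symmetric] g(2)[symmetric] emeasure_density)
  have g_le: "AE x in \<mu>. g x \<le> indicator Y x"
  proof (rule AE_le_if_set_nn_integral_le)
    show "(\<integral>\<^sup>+x. g x \<partial>\<mu>) \<noteq> \<infinity>"
      using int_g[of "space \<mu>"] by (simp cong: nn_integral_cong)
    fix A assume [measurable]: "A \<in> sets \<mu>"
    show "(\<integral>\<^sup>+x\<in>A. g x \<partial>\<mu>) \<le> (\<integral>\<^sup>+x\<in>A. indicator Y x \<partial>\<mu>)"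
      by (simp add: int_g indicator_inter_arith[symmetric] Int_commute) (intro le, auto)
  qed measurable
  \<comment> \<open>Truncating the density puts h into [0, 1] at every point and not only almost
    everywhere.\<close>
  define g' where "g' x = min (enn2real (g x)) (indicator Y x)" for x
  have [measurable]: "g' \<in> borel_measurable \<mu>" unfolding g'_def by measurable
  have g'01: "0 \<le> g' x" "g' x \<le> indicator Y x" for x by (auto simp: g'_def)
  have g'_eq: "AE x in \<mu>. g x = ennreal (g' x)"
    using g_le
  proof eventually_elim
    case (elim x)
    then have "g x < top" by (rule le_less_trans) (simp add: indicator_def)
    then have "ennreal (enn2real (g x)) = g x" by (rule ennreal_enn2real)
    moreover have "enn2real (g x) \<le> indicator Y x"
      using elim enn2real_mono[of "g x" "indicator Y x"] by (auto simp: indicator_def split: if_splits)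
    ultimately show ?case by (simp add: g'_def)
  qed
  show ?thesis
  proof (rule that[of "\<lambda>x. indicator Y x - g' x"])
    fix f :: "'a \<Rightarrow> real" and c :: real
    assume [measurable]: "f \<in> borel_measurable \<mu>" and c: "\<And>x. \<bar>f x\<bar> \<le> c"
    have "(\<integral>x. f x * indicator Y x \<partial>\<nu>) = (\<integral>x. f x \<partial>N)"
      using integral_density[of f \<nu> "indicator Y"] unfolding N_def by (simp add: ennreal_indicator mult.commute)
    also have "N = density \<mu> (\<lambda>x. ennreal (g' x))"
      unfolding g(2)[symmetric] using g'_eq by (intro density_cong) auto
    also have "(\<integral>x. f x \<partial>density \<mu> (\<lambda>x. ennreal (g' x))) = (\<integral>x. f x * g' x \<partial>\<mu>)"
      by (subst integral_density) (auto simp: g'01 mult.commute)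
    finally have "(\<integral>x. f x * indicator Y x \<partial>\<mu>) - (\<integral>x. f x * indicator Y x \<partial>\<nu>) =
      (\<integral>x. f x * indicator Y x \<partial>\<mu>) - (\<integral>x. f x * g' x \<partial>\<mu>)" by simp
    also have "\<dots> = (\<integral>x. f x * indicator Y x - f x * g' x \<partial>\<mu>)"
    proof (rule Bochner_Integration.integral_diff[symmetric])
      have bnd: "\<bar>f x * k\<bar> \<le> c" if "0 \<le> k" "k \<le> 1" for k x
      proof -
        have "\<bar>f x\<bar> * \<bar>k\<bar> \<le> c * 1" using that c[of x] by (intro mult_mono) auto
        then show ?thesis by (simp add: abs_mult)
      qed
      have "g' x \<le> 1" for x using g'01(2)[of x] by (rule order_trans) (simp add: indicator_def)
      then show "integrable \<mu> (\<lambda>x. f x * g' x)"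
        by (intro \<mu>.integrable_const_bound[of _ c] AE_I2) (auto simp: g'01 bnd)
      show "integrable \<mu> (\<lambda>x. f x * indicator Y x)"
        by (intro \<mu>.integrable_const_bound[of _ c] AE_I2) (auto intro!: bnd)
    qed
    finally show "(\<integral>x. f x * indicator Y x \<partial>\<mu>) - (\<integral>x. f x * indicator Y x \<partial>\<nu>) = (\<integral>x. f x * (indicator Y x - g' x) \<partial>\<mu>)"
      by (simp add: right_diff_distrib)
  next
    fix x show "0 \<le> indicator Y x - g' x" using g'01[of x] by simp
    show "indicator Y x - g' x \<le> 1" using g'01[of x] by (simp add: indicator_def split: if_splits)
  qed measurable
qed

text \<open>The parts of \<open>\<mu>\<close> and \<open>\<nu>\<close> that do not cancel, each of mass \<open>tv \<mu> \<nu>\<close>, written as densities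
  with respect to \<open>\<mu>\<close> and \<open>\<nu>\<close>.\<close>

lemma tv_coupling:
  fixes \<mu> \<nu> :: "'a::polish_space measure"
  assumes \<mu>: "\<mu> \<in> space (prob_algebra borel)" and \<nu>: "\<nu> \<in> space (prob_algebra borel)"
  obtains h k :: "'a \<Rightarrow> real" where "h \<in> borel_measurable borel" "k \<in> borel_measurable borel"
    "\<And>x. 0 \<le> h x" "\<And>x. h x \<le> 1" "\<And>x. 0 \<le> k x" "\<And>x. k x \<le> 1"
    "(\<integral>x. h x \<partial>\<mu>) = tv \<mu> \<nu>" "(\<integral>x. k x \<partial>\<nu>) = tv \<mu> \<nu>"
    "\<And>f c. f \<in> borel_measurable borel \<Longrightarrow> (\<And>x. \<bar>f x\<bar> \<le> c) \<Longrightarrow>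
      (\<integral>x. f x \<partial>\<mu>) - (\<integral>x. f x \<partial>\<nu>) = (\<integral>x. f x * h x \<partial>\<mu>) - (\<integral>x. f x * k x \<partial>\<nu>)"
proof -
  interpret \<mu>: prob_space \<mu> using \<mu> by (simp add: space_prob_algebra)
  interpret \<nu>: prob_space \<nu> using \<nu> by (simp add: space_prob_algebra)
  have s [measurable_cong, simp]: "sets \<mu> = sets borel" "sets \<nu> = sets borel"
    using \<mu> \<nu> by (simp_all add: space_prob_algebra)
  have sp [simp]: "space \<mu> = UNIV" "space \<nu> = UNIV" using s[THEN sets_eq_imp_space_eq] by auto
  have "\<exists>Y\<in>sets \<mu>. Y \<subseteq> UNIV \<and> (\<forall>X\<in>sets \<mu>. X \<subseteq> Y \<longrightarrow> \<nu> X \<le> \<mu> X) \<and> (\<forall>X\<in>sets \<mu>. X \<subseteq> UNIV \<longrightarrow> X \<inter> Y = {} \<longrightarrow> \<mu> X \<le> \<nu> X)"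
    by (rule unsigned_Hahn_decomposition) auto
  then obtain Y where Y [measurable]: "Y \<in> sets borel"
    and Y1: "\<And>X. X \<in> sets borel \<Longrightarrow> X \<subseteq> Y \<Longrightarrow> emeasure \<nu> X \<le> emeasure \<mu> X"
    and Y2: "\<And>X. X \<in> sets borel \<Longrightarrow> X \<inter> Y = {} \<Longrightarrow> emeasure \<mu> X \<le> emeasure \<nu> X"
    by auto
  obtain h :: "'a \<Rightarrow> real" where h [measurable]: "h \<in> borel_measurable borel" and h01: "\<And>x. 0 \<le> h x" "\<And>x. h x \<le> 1"
    and h_int: "\<And>f c. f \<in> borel_measurable borel \<Longrightarrow> (\<And>x. \<bar>f x\<bar> \<le> c) \<Longrightarrow>
      (\<integral>x. f x * indicator Y x \<partial>\<mu>) - (\<integral>x. f x * indicator Y x \<partial>\<nu>) = (\<integral>x. f x * h x \<partial>\<mu>)"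
  proof (rule density_of_dominated_part[of \<mu> \<nu> Y])
    fix h :: "'a \<Rightarrow> real" assume "h \<in> borel_measurable \<mu>" "\<And>x. 0 \<le> h x" "\<And>x. h x \<le> 1"
      "\<And>f c. f \<in> borel_measurable \<mu> \<Longrightarrow> (\<And>x. \<bar>f x\<bar> \<le> c) \<Longrightarrow>
      (\<integral>x. f x * indicator Y x \<partial>\<mu>) - (\<integral>x. f x * indicator Y x \<partial>\<nu>) = (\<integral>x. f x * h x \<partial>\<mu>)"
    then show thesis by (intro that[of h], simp_all cong: measurable_cong_sets) blast
  qed (auto intro: Y1 \<mu>.prob_space_axioms \<nu>.prob_space_axioms)
  \<comment> \<open>The negative part: the same construction with the measures exchanged, on the
    complement of Y.\<close>
  obtain k :: "'a \<Rightarrow> real" where k [measurable]: "k \<in> borel_measurable borel" and k01: "\<And>x. 0 \<le> k x" "\<And>x. k x \<le> 1"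
    and k_int: "\<And>f c. f \<in> borel_measurable borel \<Longrightarrow> (\<And>x. \<bar>f x\<bar> \<le> c) \<Longrightarrow>
      (\<integral>x. f x * indicator (- Y) x \<partial>\<nu>) - (\<integral>x. f x * indicator (- Y) x \<partial>\<mu>) = (\<integral>x. f x * k x \<partial>\<nu>)"
  proof (rule density_of_dominated_part[of \<nu> \<mu> "- Y"])
    fix h :: "'a \<Rightarrow> real" assume "h \<in> borel_measurable \<nu>" "\<And>x. 0 \<le> h x" "\<And>x. h x \<le> 1"
      "\<And>f c. f \<in> borel_measurable \<nu> \<Longrightarrow> (\<And>x. \<bar>f x\<bar> \<le> c) \<Longrightarrow>
      (\<integral>x. f x * indicator (- Y) x \<partial>\<nu>) - (\<integral>x. f x * indicator (- Y) x \<partial>\<mu>) = (\<integral>x. f x * h x \<partial>\<nu>)"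
    then show thesis by (intro that[of h], simp_all cong: measurable_cong_sets) blast
  qed (auto intro!: Y2 \<mu>.prob_space_axioms \<nu>.prob_space_axioms)
  \<comment> \<open>The Hahn set attains the supremum: passing from B to Y adds
    \<open>Y - B\<close>, where \<mu> dominates, and removes \<open>B - Y\<close>, where \<nu> does.
    Differences of the other sign are compared with the complement of Y.\<close>
  have tv_Y: "tv \<mu> \<nu> = measure \<mu> Y - measure \<nu> Y"
  proof (rule antisym)
    show "measure \<mu> Y - measure \<nu> Y \<le> tv \<mu> \<nu>"
      using abs_measure_diff_le_tv[OF \<mu> \<nu> Y] by simp
    have "measure \<mu> B - measure \<nu> B \<le> measure \<mu> Y - measure \<nu> Y \<and> measure \<nu> B - measure \<mu> B \<le> measure \<mu> Y - measure \<nu> Y"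
      if [measurable]: "B \<in> sets borel" for B
    proof -
      have split: "measure M A = measure M (A \<inter> Z) + measure M (A - Z)"
        if "finite_measure M" "sets M = sets borel" "A \<in> sets borel" "Z \<in> sets borel" for M :: "'a measure" and A Z
        using that finite_measure.finite_measure_Union[of M "A \<inter> Z" "A - Z"] by (simp add: Int_Diff_Un Int_Diff_disjoint)
      note split = split[OF \<mu>.finite_measure_axioms s(1)] split[OF \<nu>.finite_measure_axioms s(2)]
      have a: "measure \<nu> X \<le> measure \<mu> X" if "X \<in> sets borel" "X \<subseteq> Y" for X
        using Y1[OF that] by (simp add: \<mu>.emeasure_eq_measure \<nu>.emeasure_eq_measure)
      have b: "measure \<mu> X \<le> measure \<nu> X" if "X \<in> sets borel" "X \<inter> Y = {}" for X
        using Y2[OF that] by (simp add: \<mu>.emeasure_eq_measure \<nu>.emeasure_eq_measure)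
      have c: "measure \<mu> (- X) = 1 - measure \<mu> X" "measure \<nu> (- X) = 1 - measure \<nu> X" if "X \<in> sets borel" for X
        using \<mu>.prob_compl[of X] \<nu>.prob_compl[of X] that by (simp_all add: Compl_eq_Diff_UNIV)
      have BY: "Y \<inter> B = B \<inter> Y" by auto
      have "measure \<nu> (Y - B) \<le> measure \<mu> (Y - B)" "measure \<mu> (B - Y) \<le> measure \<nu> (B - Y)"
        "measure \<nu> (B \<inter> Y) \<le> measure \<mu> (B \<inter> Y)" "measure \<mu> (- Y - B) \<le> measure \<nu> (- Y - B)"
        by (auto intro!: a b)
      moreover have "- Y \<inter> B = B - Y" by auto
      ultimately show ?thesis
        using split[of Y B] split[of B Y] split[of "- Y" B] c[of Y] BY by simp
    qed
    then show "tv \<mu> \<nu> \<le> measure \<mu> Y - measure \<nu> Y"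
      by (intro tv_least) (auto simp: abs_le_iff sets_basis_unions)
  qed
  show ?thesis
  proof (rule that[of h k])
    show "(\<integral>x. h x \<partial>\<mu>) = tv \<mu> \<nu>"
      using h_int[of "\<lambda>_. 1" 1] by (simp add: tv_Y)
    have "measure \<mu> (- Y) = 1 - measure \<mu> Y" "measure \<nu> (- Y) = 1 - measure \<nu> Y"
      using \<mu>.prob_compl[of Y] \<nu>.prob_compl[of Y] by (simp_all add: Compl_eq_Diff_UNIV)
    then show "(\<integral>x. k x \<partial>\<nu>) = tv \<mu> \<nu>"
      using k_int[of "\<lambda>_. 1" 1] by (simp add: tv_Y)
  next
    fix f :: "'a \<Rightarrow> real" and c :: real assume f [measurable]: "f \<in> borel_measurable borel" and c: "\<And>x. \<bar>f x\<bar> \<le> c"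
    have bnd: "\<bar>f x * indicator Z x\<bar> \<le> c" for x Z
      using c[of x] abs_ge_zero[of "f x"] by (auto simp: indicator_def simp del: abs_ge_zero)
    have split: "(\<integral>x. f x \<partial>M) = (\<integral>x. f x * indicator Y x \<partial>M) + (\<integral>x. f x * indicator (- Y) x \<partial>M)"
      if "prob_space M" "sets M = sets borel" for M
    proof -
      interpret M: prob_space M by fact
      note [measurable_cong] = that(2)
      have "(\<integral>x. f x \<partial>M) = (\<integral>x. f x * indicator Y x + f x * indicator (- Y) x \<partial>M)"
        by (intro Bochner_Integration.integral_cong) (auto simp: indicator_def)
      also have "\<dots> = (\<integral>x. f x * indicator Y x \<partial>M) + (\<integral>x. f x * indicator (- Y) x \<partial>M)"
        by (intro Bochner_Integration.integral_add M.integrable_const_bound[of _ c] AE_I2) (auto simp: bnd)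
      finally show ?thesis .
    qed
    show "(\<integral>x. f x \<partial>\<mu>) - (\<integral>x. f x \<partial>\<nu>) = (\<integral>x. f x * h x \<partial>\<mu>) - (\<integral>x. f x * k x \<partial>\<nu>)"
      unfolding h_int[OF f c, symmetric] k_int[OF f c, symmetric]
      by (simp add: split[OF \<mu>.prob_space_axioms s(1)] split[OF \<nu>.prob_space_axioms s(2)])
  qed (use h k h01 k01 in auto)
qed

text \<open>After cancellation f is integrated against a positive part of mass \<open>tv\<close>
  minus a negative part; dropping the latter and using f <= 1 bounds one sign, and exchanging the
  measures bounds the other.\<close>

lemma tv_integral_le:
  fixes \<mu> \<nu> :: "'a::polish_space measure"
  assumes \<mu>: "\<mu> \<in> space (prob_algebra borel)" and \<nu>: "\<nu> \<in> space (prob_algebra borel)"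
    and f [measurable]: "f \<in> borel_measurable borel" and f01: "\<And>x. 0 \<le> f x" "\<And>x. f x \<le> 1"
  shows "\<bar>(\<integral>x. f x \<partial>\<mu>) - (\<integral>x. f x \<partial>\<nu>)\<bar> \<le> tv \<mu> \<nu>"
proof -
  have *: "(\<integral>x. f x \<partial>\<mu>) - (\<integral>x. f x \<partial>\<nu>) \<le> tv \<mu> \<nu>"
    if \<mu>: "\<mu> \<in> space (prob_algebra borel)" and \<nu>: "\<nu> \<in> space (prob_algebra borel)" for \<mu> \<nu> :: "'a measure"
  proof -
    obtain h k :: "'a \<Rightarrow> real" where [measurable]: "h \<in> borel_measurable borel" "k \<in> borel_measurable borel"
      and 1: "\<And>x. 0 \<le> h x" "\<And>x. h x \<le> 1" "\<And>x. 0 \<le> k x" "\<And>x. k x \<le> 1" "(\<integral>x. h x \<partial>\<mu>) = tv \<mu> \<nu>"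
      and 2: "\<And>f c. f \<in> borel_measurable borel \<Longrightarrow> (\<And>x. \<bar>f x\<bar> \<le> c) \<Longrightarrow>
        (\<integral>x. f x \<partial>\<mu>) - (\<integral>x. f x \<partial>\<nu>) = (\<integral>x. f x * h x \<partial>\<mu>) - (\<integral>x. f x * k x \<partial>\<nu>)"
      by (rule tv_coupling[OF \<mu> \<nu>]) blast
    interpret \<mu>: prob_space \<mu> using \<mu> by (simp add: space_prob_algebra)
    have [measurable_cong]: "sets \<mu> = sets borel" using \<mu> by (simp_all add: space_prob_algebra)
    have "(\<integral>x. f x \<partial>\<mu>) - (\<integral>x. f x \<partial>\<nu>) = (\<integral>x. f x * h x \<partial>\<mu>) - (\<integral>x. f x * k x \<partial>\<nu>)"
      by (rule 2[of _ 1]) (auto simp: f01)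
    also have "\<dots> \<le> (\<integral>x. f x * h x \<partial>\<mu>)"
      by (simp add: Bochner_Integration.integral_nonneg f01 1)
    also have "\<dots> \<le> (\<integral>x. h x \<partial>\<mu>)"
    proof (rule integral_mono)
      show "integrable \<mu> (\<lambda>x. f x * h x)"
        by (intro \<mu>.integrable_const_bound[of _ 1] AE_I2) (auto simp: f01 1 mult_le_one)
      show "integrable \<mu> h"
        by (intro \<mu>.integrable_const_bound[of _ 1] AE_I2) (auto simp: f01 1)
      show "f x * h x \<le> h x" for x using f01[of x] 1(1)[of x] by (simp add: mult_left_le_one_le)
    qed
    finally show ?thesis by (simp add: 1)
  qed
  show ?thesis using *[OF \<mu> \<nu>] *[OF \<nu> \<mu>] by (auto simp: tv_commute[of \<nu>])
qed

section \<open>Markov kernels\<close>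

abbreviation prob_kernel :: "('a::topological_space \<Rightarrow> 'a measure) \<Rightarrow> bool" where
  "prob_kernel K \<equiv> K \<in> borel \<rightarrow>\<^sub>M prob_algebra borel"

lemma prob_algebraD:
  assumes "\<mu> \<in> space (prob_algebra N)"
  shows "prob_space \<mu>" "sets \<mu> = sets N" "space \<mu> = space N"
  using assms by (auto simp: space_prob_algebra dest: sets_eq_imp_space_eq)

lemma prob_kernelD:
  assumes "prob_kernel K"
  shows "K x \<in> space (prob_algebra borel)"
  using measurable_space[OF assms, of x] by simp

lemma integrable_bounded:
  fixes f :: "_ \<Rightarrow> real"
  assumes "prob_space M" "f \<in> borel_measurable M" "\<And>x. \<bar>f x\<bar> \<le> (c::real)"
  shows "integrable M f"
  using assms by (intro finite_measure.integrable_const_bound[of M f c] prob_space.finite_measure) auto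

lemma integral_prod_pair:
  fixes f :: "'a \<Rightarrow> real" and g :: "'b \<Rightarrow> real"
  assumes "prob_space M" "prob_space N"
    and [measurable]: "f \<in> borel_measurable M" "g \<in> borel_measurable N"
    and f: "\<And>x. \<bar>f x\<bar> \<le> 1" and g: "\<And>x. \<bar>g x\<bar> \<le> 1"
  shows "(\<integral>z. f (fst z) * g (snd z) \<partial>(M \<Otimes>\<^sub>M N)) = (\<integral>x. f x \<partial>M) * (\<integral>y. g y \<partial>N)"
proof -
  interpret M: prob_space M by fact
  interpret N: prob_space N by fact
  interpret pair_prob_space M N ..
  have "\<bar>f (fst z) * g (snd z)\<bar> \<le> 1" for z
    using f[of "fst z"] g[of "snd z"] by (simp add: abs_mult mult_le_one)
  then have "integrable (M \<Otimes>\<^sub>M N) (\<lambda>z. f (fst z) * g (snd z))"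
    by (intro integrable_bounded[of _ _ 1]) (auto intro: prob_space_axioms)
  from integral_fst'[OF this] show ?thesis by simp
qed

lemma measurable_pair_kernel:
  assumes "prob_kernel (K :: 'a::polish_space \<Rightarrow> 'a measure)"
  shows "(\<lambda>z. K (fst z) \<Otimes>\<^sub>M K (snd z)) \<in> (borel \<Otimes>\<^sub>M borel) \<rightarrow>\<^sub>M prob_algebra (borel \<Otimes>\<^sub>M borel)"
  using assms by measurable

lemma pair_in_prob_algebra:
  "\<mu> \<in> space (prob_algebra M) \<Longrightarrow> \<nu> \<in> space (prob_algebra N) \<Longrightarrow> \<mu> \<Otimes>\<^sub>M \<nu> \<in> space (prob_algebra (M \<Otimes>\<^sub>M N))"
  by (auto simp: space_prob_algebra intro!: prob_space_pair sets_pair_measure_cong)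

lemma bind_in_prob_algebra:
  "\<mu> \<in> space (prob_algebra M) \<Longrightarrow> K \<in> M \<rightarrow>\<^sub>M prob_algebra N \<Longrightarrow> \<mu> \<bind> K \<in> space (prob_algebra N)"
  by (auto simp: space_prob_algebra[of N] intro!: prob_space_bind' sets_bind')

lemma measurable_kernel_cong:
  assumes "\<mu> \<in> space (prob_algebra M)" "K \<in> M \<rightarrow>\<^sub>M prob_algebra N"
  shows "K \<in> \<mu> \<rightarrow>\<^sub>M subprob_algebra N"
  using measurable_prob_algebraD[OF assms(2)] measurable_cong_sets[OF prob_algebraD(2)[OF assms(1)] refl] by blast

lemma nn_integral_bind_prob:
  assumes "\<mu> \<in> space (prob_algebra M)" "K \<in> M \<rightarrow>\<^sub>M prob_algebra N" "f \<in> borel_measurable N"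
  shows "(\<integral>\<^sup>+x. f x \<partial>(\<mu> \<bind> K)) = (\<integral>\<^sup>+x. \<integral>\<^sup>+y. f y \<partial>K x \<partial>\<mu>)"
  using assms(3) measurable_kernel_cong[OF assms(1,2)] by (rule nn_integral_bind)

lemma integral_bind_prob:
  fixes f :: "_ \<Rightarrow> real"
  assumes \<mu>: "\<mu> \<in> space (prob_algebra M)" and K: "K \<in> M \<rightarrow>\<^sub>M prob_algebra N"
    and f: "f \<in> borel_measurable N" "\<And>x. \<bar>f x\<bar> \<le> c"
  shows "(\<integral>x. f x \<partial>(\<mu> \<bind> K)) = (\<integral>x. \<integral>y. f y \<partial>K x \<partial>\<mu>)"
proof (rule integral_bind[OF f(1) f(2) measurable_kernel_cong[OF \<mu> K]])
  show "finite_measure \<mu>" using prob_algebraD(1)[OF \<mu>] by (rule prob_space.finite_measure)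
  have "emeasure (K x) (space (K x)) = 1" if "x \<in> space \<mu>" for x
    using measurable_space[OF K, of x] that prob_algebraD(3)[OF \<mu>]
    by (auto simp: space_prob_algebra intro: prob_space.emeasure_space_1)
  then show "AE x in \<mu>. emeasure (K x) (space (K x)) \<le> ennreal 1" by (intro AE_I2) auto
qed

lemma measure_bind_prob:
  assumes \<mu>: "\<mu> \<in> space (prob_algebra M)" and K: "K \<in> M \<rightarrow>\<^sub>M prob_algebra N" and A: "A \<in> sets N"
  shows "measure (\<mu> \<bind> K) A = (\<integral>x. measure (K x) A \<partial>\<mu>)"
  using prob_algebraD(1)[OF \<mu>] A measurable_kernel_cong[OF \<mu> K]
  by (intro subprob_space.measure_bind[of _ _ N] prob_space_imp_subprob_space)

text \<open>Independent coordinates that move by their own kernels remain independent; on rectangles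
  Tonelli separates the factors. This makes powers of the product kernel products of powers.\<close>

lemma bind_pair_kernel:
  fixes f g :: "'a::polish_space \<Rightarrow> 'a measure"
  assumes \<mu>: "\<mu> \<in> space (prob_algebra borel)" and \<nu>: "\<nu> \<in> space (prob_algebra borel)"
    and f [measurable]: "prob_kernel f" and g [measurable]: "prob_kernel g"
  shows "(\<mu> \<bind> f) \<Otimes>\<^sub>M (\<nu> \<bind> g) = (\<mu> \<Otimes>\<^sub>M \<nu>) \<bind> (\<lambda>z. f (fst z) \<Otimes>\<^sub>M g (snd z))"
proof (rule pair_measure_eqI)
  have P: "\<mu> \<Otimes>\<^sub>M \<nu> \<in> space (prob_algebra (borel \<Otimes>\<^sub>M borel))" by (rule pair_in_prob_algebra[OF \<mu> \<nu>])
  have fg: "(\<lambda>z. f (fst z) \<Otimes>\<^sub>M g (snd z)) \<in> (borel \<Otimes>\<^sub>M borel) \<rightarrow>\<^sub>M prob_algebra (borel \<Otimes>\<^sub>M borel)"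
    by measurable
  note bf = bind_in_prob_algebra[OF \<mu> f] and bg = bind_in_prob_algebra[OF \<nu> g]
  interpret \<nu>: prob_space \<nu> by (rule prob_algebraD[OF \<nu>])
  have s [measurable_cong]: "sets \<mu> = sets borel" "sets \<nu> = sets borel" using \<mu> \<nu> by (simp_all add: prob_algebraD)
  show "sigma_finite_measure (\<mu> \<bind> f)" "sigma_finite_measure (\<nu> \<bind> g)"
    using bf bg by (auto dest!: prob_algebraD(1) intro: prob_space_imp_sigma_finite)
  show "sets ((\<mu> \<bind> f) \<Otimes>\<^sub>M (\<nu> \<bind> g)) = sets ((\<mu> \<Otimes>\<^sub>M \<nu>) \<bind> (\<lambda>z. f (fst z) \<Otimes>\<^sub>M g (snd z)))"
    using pair_in_prob_algebra[OF bf bg] bind_in_prob_algebra[OF P fg] by (simp add: space_prob_algebra)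
  fix A B :: "'a set" assume "A \<in> sets (\<mu> \<bind> f)" "B \<in> sets (\<nu> \<bind> g)"
  then have AB [measurable]: "A \<in> sets borel" "B \<in> sets borel"
    using prob_algebraD(2)[OF bf] prob_algebraD(2)[OF bg] by auto
  have [measurable]: "(\<lambda>x. emeasure (f x) A) \<in> borel_measurable borel" "(\<lambda>x. emeasure (g x) B) \<in> borel_measurable borel"
    using measurable_emeasure_kernel[OF measurable_prob_algebraD[OF f] AB(1)]
      measurable_emeasure_kernel[OF measurable_prob_algebraD[OF g] AB(2)] by auto
  have "emeasure ((\<mu> \<Otimes>\<^sub>M \<nu>) \<bind> (\<lambda>z. f (fst z) \<Otimes>\<^sub>M g (snd z))) (A \<times> B) =
    (\<integral>\<^sup>+z. emeasure (f (fst z) \<Otimes>\<^sub>M g (snd z)) (A \<times> B) \<partial>(\<mu> \<Otimes>\<^sub>M \<nu>))"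
    by (rule emeasure_bind_prob_algebra[OF P fg]) simp
  also have "\<dots> = (\<integral>\<^sup>+z. emeasure (f (fst z)) A * emeasure (g (snd z)) B \<partial>(\<mu> \<Otimes>\<^sub>M \<nu>))"
  proof (rule nn_integral_cong)
    fix z :: "'a \<times> 'a"
    have "sigma_finite_measure (g (snd z))"
      using prob_algebraD(1)[OF prob_kernelD[OF g]] by (rule prob_space_imp_sigma_finite)
    then show "emeasure (f (fst z) \<Otimes>\<^sub>M g (snd z)) (A \<times> B) = emeasure (f (fst z)) A * emeasure (g (snd z)) B"
      by (rule sigma_finite_measure.emeasure_pair_measure_Times)
        (use AB in \<open>simp_all add: prob_algebraD(2)[OF prob_kernelD[OF f]] prob_algebraD(2)[OF prob_kernelD[OF g]]\<close>)
  qed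
  also have "\<dots> = (\<integral>\<^sup>+x. \<integral>\<^sup>+y. emeasure (f x) A * emeasure (g y) B \<partial>\<nu> \<partial>\<mu>)"
    by (subst \<nu>.nn_integral_fst[symmetric]) auto
  also have "\<dots> = (\<integral>\<^sup>+x. emeasure (f x) A \<partial>\<mu>) * (\<integral>\<^sup>+y. emeasure (g y) B \<partial>\<nu>)"
    by (simp add: nn_integral_cmult nn_integral_multc)
  also have "\<dots> = emeasure (\<mu> \<bind> f) A * emeasure (\<nu> \<bind> g) B"
    by (simp add: emeasure_bind_prob_algebra[OF \<mu> f AB(1)] emeasure_bind_prob_algebra[OF \<nu> g AB(2)])
  finally show "emeasure (\<mu> \<bind> f) A * emeasure (\<nu> \<bind> g) B =
    emeasure ((\<mu> \<Otimes>\<^sub>M \<nu>) \<bind> (\<lambda>z. f (fst z) \<Otimes>\<^sub>M g (snd z))) (A \<times> B)" ..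
qed

section \<open>Powers of a kernel and their effect on total variation\<close>

primrec kpow :: "('a::topological_space \<Rightarrow> 'a measure) \<Rightarrow> nat \<Rightarrow> 'a \<Rightarrow> 'a measure" where
  "kpow K 0 = return borel"
| "kpow K (Suc n) = (\<lambda>x. K x \<bind> kpow K n)"

lemma prob_kernel_kpow [measurable (raw)]:
  assumes "prob_kernel K"
  shows "prob_kernel (kpow K n)"
  using assms by (induction n) (auto intro: measurable_bind_prob_space measurable_return_prob_space)

lemma kpow_add:
  assumes K: "prob_kernel K"
  shows "kpow K (m + n) x = kpow K m x \<bind> kpow K n"
proof (induction m arbitrary: x)
  case 0
  show ?case
    using measurable_prob_algebraD[OF prob_kernel_kpow[OF K, of n]] by (simp add: bind_return[where M=borel])
next
  case (Suc m)
  have "kpow K (Suc m + n) x = K x \<bind> (\<lambda>y. kpow K m y \<bind> kpow K n)"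
    using Suc by (simp cong: bind_cong)
  also have "\<dots> = (K x \<bind> kpow K m) \<bind> kpow K n"
    by (intro bind_assoc[symmetric, of _ _ borel _ borel] measurable_kernel_cong[OF prob_kernelD[OF K]]
        prob_kernel_kpow[OF K] measurable_prob_algebraD)
  finally show ?case by simp
qed

lemma bind_kpow_invariant:
  assumes L: "L \<in> space (prob_algebra borel)" and K: "prob_kernel K" and inv: "L \<bind> K = L"
  shows "L \<bind> kpow K n = L"
proof (induction n)
  case 0
  show ?case using prob_algebraD(2)[OF L] by (simp add: bind_return'')
next
  case (Suc n)
  have "L \<bind> (\<lambda>x. K x \<bind> kpow K n) = (L \<bind> K) \<bind> kpow K n"
    by (intro bind_assoc[symmetric, of _ _ borel _ borel] measurable_kernel_cong[OF L K]
        prob_kernel_kpow[OF K] measurable_prob_algebraD)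
  then show ?case using inv Suc by simp
qed

text \<open>The parts h and k left after cancellation both have mass d; moved by K from independent
  starting points they differ by at most the average one-step distance. Their product has mass d *
  d, which accounts for the extra factor d on the left and keeps the case d = 0 meaningful.\<close>

lemma tv_bind_coupling:
  fixes \<mu> \<nu> :: "'a::polish_space measure" and h k :: "'a \<Rightarrow> real"
  assumes \<mu>: "\<mu> \<in> space (prob_algebra borel)" and \<nu>: "\<nu> \<in> space (prob_algebra borel)"
    and K: "prob_kernel K"
    and hk [measurable]: "h \<in> borel_measurable borel" "k \<in> borel_measurable borel"
    and hk01: "\<And>x. 0 \<le> h x" "\<And>x. h x \<le> 1" "\<And>x. 0 \<le> k x" "\<And>x. k x \<le> 1"
    and mass: "(\<integral>x. h x \<partial>\<mu>) = d" "(\<integral>x. k x \<partial>\<nu>) = d"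
    and diff: "\<And>f c. f \<in> borel_measurable borel \<Longrightarrow> (\<And>x. \<bar>f x\<bar> \<le> c) \<Longrightarrow>
      (\<integral>x. f x \<partial>\<mu>) - (\<integral>x. f x \<partial>\<nu>) = (\<integral>x. f x * h x \<partial>\<mu>) - (\<integral>x. f x * k x \<partial>\<nu>)"
  shows "d * tv (\<mu> \<bind> K) (\<nu> \<bind> K) \<le>
    (\<integral>z. tv (K (fst z)) (K (snd z)) * (h (fst z) * k (snd z)) \<partial>(\<mu> \<Otimes>\<^sub>M \<nu>))" (is "_ \<le> ?I")
proof -
  interpret \<mu>: prob_space \<mu> by (rule prob_algebraD[OF \<mu>])
  interpret \<nu>: prob_space \<nu> by (rule prob_algebraD[OF \<nu>])
  interpret pair_prob_space \<mu> \<nu> ..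
  note [measurable] = K
  have s [measurable_cong]: "sets \<mu> = sets borel" "sets \<nu> = sets borel" using \<mu> \<nu> by (simp_all add: prob_algebraD)
  note Kx = prob_kernelD[OF K]
  have d0: "0 \<le> d" unfolding mass[symmetric] using hk01 by (intro Bochner_Integration.integral_nonneg) auto
  have hk_le: "0 \<le> h x * k y" "h x * k y \<le> 1" for x y using hk01 by (auto intro: mult_le_one)
  have int_tv: "integrable (\<mu> \<Otimes>\<^sub>M \<nu>) (\<lambda>z. tv (K (fst z)) (K (snd z)) * (h (fst z) * k (snd z)))"
  proof (rule integrable_bounded[of _ _ 1])
    fix z :: "'a \<times> 'a"
    show "\<bar>tv (K (fst z)) (K (snd z)) * (h (fst z) * k (snd z))\<bar> \<le> 1"
      using tv_le_1[OF Kx Kx, of "fst z" "snd z"] tv_nonneg[OF Kx Kx, of "fst z" "snd z"] hk_le[of "fst z" "snd z"]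
      by (simp add: abs_mult[of "tv _ _"] mult_le_one abs_of_nonneg)
  qed (auto intro: prob_space_axioms)
  have main: "d * \<bar>measure (\<mu> \<bind> K) U - measure (\<nu> \<bind> K) U\<bar> \<le> ?I" if [measurable]: "U \<in> sets borel" for U
  proof -
    define g where "g x = measure (K x) U" for x
    have [measurable]: "g \<in> borel_measurable borel"
      unfolding g_def by (rule measurable_compose[OF K measurable_measure_prob_algebra]) fact
    have g01: "0 \<le> g x" "g x \<le> 1" for x
      using prob_space.prob_le_1[OF prob_algebraD(1)[OF Kx]] by (auto simp: g_def)
    have gh01: "\<bar>g x * h x\<bar> \<le> 1" "\<bar>g x * k x\<bar> \<le> 1" for x
      using g01[of x] hk01[of x] by (auto simp: abs_mult intro!: mult_le_one)
    have 1: "(\<integral>z. (g (fst z) * h (fst z)) * k (snd z) \<partial>(\<mu> \<Otimes>\<^sub>M \<nu>)) = (\<integral>x. g x * h x \<partial>\<mu>) * d"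
      unfolding mass(2)[symmetric]
      by (rule integral_prod_pair) (auto simp: gh01 hk01 intro: \<mu>.prob_space_axioms \<nu>.prob_space_axioms)
    have 2: "(\<integral>z. h (fst z) * (g (snd z) * k (snd z)) \<partial>(\<mu> \<Otimes>\<^sub>M \<nu>)) = d * (\<integral>x. g x * k x \<partial>\<nu>)"
      unfolding mass(1)[symmetric]
      by (rule integral_prod_pair) (auto simp: gh01 hk01 intro: \<mu>.prob_space_axioms \<nu>.prob_space_axioms)
    have i1: "integrable (\<mu> \<Otimes>\<^sub>M \<nu>) (\<lambda>z. (g (fst z) * h (fst z)) * k (snd z))"
      and i2: "integrable (\<mu> \<Otimes>\<^sub>M \<nu>) (\<lambda>z. h (fst z) * (g (snd z) * k (snd z)))"
      using g01 hk01 by (auto intro!: integrable_bounded[of _ _ 1] prob_space_axioms mult_le_one simp: abs_mult)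
    \<comment> \<open>Each single integral lacks one variable; integrating the other density in that
      variable supplies exactly the factor d, so both become integrals against the product of h and
      k.\<close>
    have "d * (measure (\<mu> \<bind> K) U - measure (\<nu> \<bind> K) U) = d * ((\<integral>x. g x * h x \<partial>\<mu>) - (\<integral>x. g x * k x \<partial>\<nu>))"
      unfolding measure_bind_prob[OF \<mu> K that] measure_bind_prob[OF \<nu> K that] g_def[symmetric]
      by (subst diff[of g 1]) (auto simp: g01)
    also have "\<dots> = (\<integral>z. (g (fst z) * h (fst z)) * k (snd z) - h (fst z) * (g (snd z) * k (snd z)) \<partial>(\<mu> \<Otimes>\<^sub>M \<nu>))"
      unfolding Bochner_Integration.integral_diff[OF i1 i2] 1 2 by (simp add: algebra_simps)
    finally have "\<bar>d * (measure (\<mu> \<bind> K) U - measure (\<nu> \<bind> K) U)\<bar> \<le>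
      (\<integral>z. \<bar>(g (fst z) * h (fst z)) * k (snd z) - h (fst z) * (g (snd z) * k (snd z))\<bar> \<partial>(\<mu> \<Otimes>\<^sub>M \<nu>))"
      by (simp only: integral_abs_bound)
    also have "\<dots> \<le> ?I"
    proof (rule integral_mono[OF _ int_tv])
      show "integrable (\<mu> \<Otimes>\<^sub>M \<nu>) (\<lambda>z. \<bar>(g (fst z) * h (fst z)) * k (snd z) - h (fst z) * (g (snd z) * k (snd z))\<bar>)"
        using i1 i2 by (intro integrable_abs Bochner_Integration.integrable_diff)
      fix z
      have "(g (fst z) * h (fst z)) * k (snd z) - h (fst z) * (g (snd z) * k (snd z)) =
        (g (fst z) - g (snd z)) * (h (fst z) * k (snd z))" by (simp add: algebra_simps)
      then have "\<bar>(g (fst z) * h (fst z)) * k (snd z) - h (fst z) * (g (snd z) * k (snd z))\<bar> =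
        \<bar>g (fst z) - g (snd z)\<bar> * (h (fst z) * k (snd z))"
        using hk_le(1)[of "fst z" "snd z"] by (simp only: abs_mult[of "g _ - g _"] abs_of_nonneg)
      also have "\<dots> \<le> tv (K (fst z)) (K (snd z)) * (h (fst z) * k (snd z))"
        unfolding g_def by (intro mult_right_mono abs_measure_diff_le_tv Kx that hk_le)
      finally show "\<bar>(g (fst z) * h (fst z)) * k (snd z) - h (fst z) * (g (snd z) * k (snd z))\<bar> \<le>
        tv (K (fst z)) (K (snd z)) * (h (fst z) * k (snd z))" .
    qed
    finally show ?thesis using d0 by (simp add: abs_mult)
  qed
  \<comment> \<open>Passing to the supremum over U requires division by d.\<close>
  show ?thesis
  proof (cases "d = 0")
    case True
    have "0 \<le> ?I"
      using tv_nonneg[OF Kx Kx] hk_le by (intro Bochner_Integration.integral_nonneg) auto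
    with True show ?thesis by simp
  next
    case False
    with d0 have "0 < d" by simp
    have "tv (\<mu> \<bind> K) (\<nu> \<bind> K) \<le> ?I / d"
      using main[OF sets_basis_unions] \<open>0 < d\<close> by (intro tv_least) (simp add: pos_le_divide_eq mult.commute)
    then show ?thesis using \<open>0 < d\<close> by (simp add: pos_le_divide_eq mult.commute)
  qed
qed

text \<open>The case h = k = 1 and d = 1 of the coupling bound: nothing is cancelled and the two
  starting points are independent.\<close>

lemma tv_bind_le_integral:
  fixes \<mu> \<nu> :: "'a::polish_space measure"
  assumes \<mu>: "\<mu> \<in> space (prob_algebra borel)" and \<nu>: "\<nu> \<in> space (prob_algebra borel)"
    and K: "prob_kernel K"
  shows "tv (\<mu> \<bind> K) (\<nu> \<bind> K) \<le> (\<integral>z. tv (K (fst z)) (K (snd z)) \<partial>(\<mu> \<Otimes>\<^sub>M \<nu>))"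
proof -
  have "measure \<mu> UNIV = 1" "measure \<nu> UNIV = 1"
    using prob_space.prob_space[OF prob_algebraD(1)[OF \<mu>]] prob_space.prob_space[OF prob_algebraD(1)[OF \<nu>]]
    by (simp_all add: prob_algebraD(3)[OF \<mu>] prob_algebraD(3)[OF \<nu>])
  then show ?thesis
    using tv_bind_coupling[OF \<mu> \<nu> K, of "\<lambda>_. 1" "\<lambda>_. 1" 1]
    by (simp add: prob_algebraD(3)[OF \<mu>] prob_algebraD(3)[OF \<nu>])
qed

lemma tv_bind_le:
  fixes \<mu> \<nu> :: "'a::polish_space measure"
  assumes \<mu>: "\<mu> \<in> space (prob_algebra borel)" and \<nu>: "\<nu> \<in> space (prob_algebra borel)"
    and K: "prob_kernel K"
  shows "tv (\<mu> \<bind> K) (\<nu> \<bind> K) \<le> tv \<mu> \<nu>"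
proof (rule tv_least)
  fix U :: "'a set" assume "U \<in> basis_unions"
  then have U: "U \<in> sets borel" by (rule sets_basis_unions)
  have [measurable]: "(\<lambda>x. measure (K x) U) \<in> borel_measurable borel"
    using U by (intro measurable_compose[OF K measurable_measure_prob_algebra])
  show "\<bar>measure (\<mu> \<bind> K) U - measure (\<nu> \<bind> K) U\<bar> \<le> tv \<mu> \<nu>"
    unfolding measure_bind_prob[OF \<mu> K U] measure_bind_prob[OF \<nu> K U]
    using prob_space.prob_le_1[OF prob_algebraD(1)[OF prob_kernelD[OF K]]]
    by (intro tv_integral_le \<mu> \<nu>) auto
qed

text \<open>By Fubini the masses of the sections of S form a test function with values in [0, 1];
  the factors are exchanged one at a time, by way of the product of \<mu> and \<nu>'.\<close>

lemma measure_pair_diff_le_tv: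
  fixes \<mu> \<nu> :: "'a::polish_space measure"
  assumes "\<mu> \<in> space (prob_algebra borel)" "\<nu> \<in> space (prob_algebra borel)"
    and "\<mu>' \<in> space (prob_algebra borel)" "\<nu>' \<in> space (prob_algebra borel)"
    and S [measurable]: "S \<in> sets (borel \<Otimes>\<^sub>M borel)"
  shows "\<bar>measure (\<mu> \<Otimes>\<^sub>M \<nu>) S - measure (\<mu>' \<Otimes>\<^sub>M \<nu>') S\<bar> \<le> tv \<mu> \<mu>' + tv \<nu> \<nu>'"
proof -
  have *: "measure (\<mu> \<Otimes>\<^sub>M \<nu>) S = (\<integral>x. measure \<nu> (Pair x -` S) \<partial>\<mu>)"
    if \<mu>: "\<mu> \<in> space (prob_algebra borel)" and \<nu>: "\<nu> \<in> space (prob_algebra borel)" for \<mu> \<nu> :: "'a measure"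
  proof -
    interpret \<nu>: prob_space \<nu> by (rule prob_algebraD[OF \<nu>])
    interpret \<mu>: prob_space \<mu> by (rule prob_algebraD[OF \<mu>])
    interpret pair_prob_space \<mu> \<nu> ..
    have s [measurable_cong]: "sets \<mu> = sets borel" "sets \<nu> = sets borel" using \<mu> \<nu> by (simp_all add: prob_algebraD)
    have S': "S \<in> sets (\<mu> \<Otimes>\<^sub>M \<nu>)" by simp
    have "(\<lambda>x. measure \<nu> (Pair x -` S)) \<in> borel_measurable \<mu>"
      unfolding measure_def using \<nu>.measurable_emeasure_Pair[OF S'] by simp
    moreover have "emeasure (\<mu> \<Otimes>\<^sub>M \<nu>) S = (\<integral>\<^sup>+x. ennreal (measure \<nu> (Pair x -` S)) \<partial>\<mu>)"
      unfolding \<nu>.emeasure_pair_measure_alt[OF S'] by (simp add: \<nu>.emeasure_eq_measure)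
    ultimately show ?thesis
      by (simp add: emeasure_eq_measure nn_integral_eq_integral integrable_bounded[of _ _ 1] \<mu>.prob_space_axioms
          Bochner_Integration.integral_nonneg)
  qed
  interpret \<nu>: prob_space \<nu> by (rule prob_algebraD) fact
  interpret \<mu>: prob_space \<mu> by (rule prob_algebraD) fact
  interpret \<nu>': prob_space \<nu>' by (rule prob_algebraD) fact
  have s [measurable_cong]: "sets \<mu> = sets borel" "sets \<nu> = sets borel" "sets \<nu>' = sets borel"
    using assms by (simp_all add: prob_algebraD)
  have m [measurable]: "(\<lambda>x. measure \<nu> (Pair x -` S)) \<in> borel_measurable borel" "(\<lambda>x. measure \<nu>' (Pair x -` S)) \<in> borel_measurable borel"
    unfolding measure_def using \<nu>.measurable_emeasure_Pair[of S borel] \<nu>'.measurable_emeasure_Pair[of S borel] by simp_all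
  have "\<bar>(\<integral>x. measure \<nu> (Pair x -` S) \<partial>\<mu>) - (\<integral>x. measure \<nu>' (Pair x -` S) \<partial>\<mu>)\<bar> =
    \<bar>\<integral>x. measure \<nu> (Pair x -` S) - measure \<nu>' (Pair x -` S) \<partial>\<mu>\<bar>"
    by (subst Bochner_Integration.integral_diff)
      (auto intro!: integrable_bounded[of _ _ 1] \<mu>.prob_space_axioms)
  also have "\<dots> \<le> (\<integral>x. \<bar>measure \<nu> (Pair x -` S) - measure \<nu>' (Pair x -` S)\<bar> \<partial>\<mu>)"
    by (rule integral_abs_bound)
  also have "\<dots> \<le> (\<integral>x. tv \<nu> \<nu>' \<partial>\<mu>)"
  proof (rule integral_mono)
    show "integrable \<mu> (\<lambda>x. \<bar>measure \<nu> (Pair x -` S) - measure \<nu>' (Pair x -` S)\<bar>)"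
      by (intro integrable_bounded[of _ _ 1] \<mu>.prob_space_axioms) (auto intro!: prob_diff_le_1 assms)
    show "\<bar>measure \<nu> (Pair x -` S) - measure \<nu>' (Pair x -` S)\<bar> \<le> tv \<nu> \<nu>'" for x
      by (intro abs_measure_diff_le_tv assms sets_Pair1[of S borel borel])
  qed simp
  finally have 1: "\<bar>(\<integral>x. measure \<nu> (Pair x -` S) \<partial>\<mu>) - (\<integral>x. measure \<nu>' (Pair x -` S) \<partial>\<mu>)\<bar> \<le> tv \<nu> \<nu>'"
    by (simp add: \<mu>.prob_space)
  have 2: "\<bar>(\<integral>x. measure \<nu>' (Pair x -` S) \<partial>\<mu>) - (\<integral>x. measure \<nu>' (Pair x -` S) \<partial>\<mu>')\<bar> \<le> tv \<mu> \<mu>'"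
    by (intro tv_integral_le assms m) auto
  from 1 2 show ?thesis unfolding *[OF assms(1,2)] *[OF assms(3,4)] by simp
qed

section \<open>Product chains\<close>

definition joint :: "'a::topological_space measure \<Rightarrow> ('a \<Rightarrow> 'a measure) \<Rightarrow> ('a \<times> 'a) measure" where
  "joint L K = L \<bind> (\<lambda>x. distr (K x) (borel \<Otimes>\<^sub>M borel) (Pair x))"

lemma measurable_joint_kernel:
  assumes "prob_kernel K"
  shows "(\<lambda>x. distr (K x) (borel \<Otimes>\<^sub>M borel) (Pair x)) \<in> borel \<rightarrow>\<^sub>M prob_algebra (borel \<Otimes>\<^sub>M borel)"
  using assms by measurable

lemma joint_in_prob_algebra:
  assumes "L \<in> space (prob_algebra borel)" "prob_kernel K"
  shows "joint L K \<in> space (prob_algebra (borel \<Otimes>\<^sub>M borel))"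
  unfolding joint_def by (rule bind_in_prob_algebra[OF assms(1) measurable_joint_kernel[OF assms(2)]])

lemma nn_integral_joint:
  assumes L: "L \<in> space (prob_algebra borel)" and K: "prob_kernel K"
    and f [measurable]: "f \<in> borel_measurable (borel \<Otimes>\<^sub>M borel)"
  shows "(\<integral>\<^sup>+p. f p \<partial>joint L K) = (\<integral>\<^sup>+x. \<integral>\<^sup>+y. f (x, y) \<partial>K x \<partial>L)"
  unfolding joint_def nn_integral_bind_prob[OF L measurable_joint_kernel[OF K] f]
proof (rule nn_integral_cong)
  fix x
  have [measurable_cong]: "sets (K x) = sets borel" by (rule prob_algebraD[OF prob_kernelD[OF K]])
  show "(\<integral>\<^sup>+ y. f y \<partial>distr (K x) (borel \<Otimes>\<^sub>M borel) (Pair x)) = (\<integral>\<^sup>+ y. f (x, y) \<partial>K x)"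
    by (simp add: nn_integral_distr)
qed

lemma emeasure_joint_Times:
  assumes L: "L \<in> space (prob_algebra borel)" and K: "prob_kernel K"
    and [measurable]: "A \<in> sets borel" "B \<in> sets borel"
  shows "emeasure (joint L K) (A \<times> B) = (\<integral>\<^sup>+x\<in>A. emeasure (K x) B \<partial>L)"
proof -
  have s: "sets (joint L K) = sets (borel \<Otimes>\<^sub>M borel)" by (rule prob_algebraD[OF joint_in_prob_algebra[OF L K]])
  have "emeasure (joint L K) (A \<times> B) = (\<integral>\<^sup>+p. indicator (A \<times> B) p \<partial>joint L K)"
    by (simp add: s)
  also have "\<dots> = (\<integral>\<^sup>+x. \<integral>\<^sup>+y. indicator A x * indicator B y \<partial>K x \<partial>L)"
    by (subst nn_integral_joint[OF L K]) (simp_all add: indicator_times)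
  also have "\<dots> = (\<integral>\<^sup>+x\<in>A. emeasure (K x) B \<partial>L)"
  proof (rule nn_integral_cong)
    fix x
    have [measurable_cong, simp]: "sets (K x) = sets borel" by (rule prob_algebraD[OF prob_kernelD[OF K]])
    show "(\<integral>\<^sup>+y. indicator A x * indicator B y \<partial>K x) = emeasure (K x) B * indicator A x"
      by (subst nn_integral_cmult) (simp_all add: mult.commute)
  qed
  finally show ?thesis .
qed

text \<open>The probability that the product chain started from L x L enters S from outside is
  regrouped: instead of two starting points followed by two successors, two independent transitions
  (x, y) and (x', y'). Only this grouping exhibits the joint law of one step, the object in which
  two kernels can be compared.\<close>

lemma pair_return_kernel_leaves_eq:
  fixes L :: "'a::polish_space measure"
  assumes L: "L \<in> space (prob_algebra borel)" and K: "prob_kernel K"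
    and S [measurable]: "S \<in> sets (borel \<Otimes>\<^sub>M borel)"
  shows "(\<integral>\<^sup>+z. indicator (- S) z * emeasure (K (fst z) \<Otimes>\<^sub>M K (snd z)) S \<partial>(L \<Otimes>\<^sub>M L)) =
    emeasure (joint L K \<Otimes>\<^sub>M joint L K) {(p, q). (fst p, fst q) \<notin> S \<and> (snd p, snd q) \<in> S}"
proof -
  let ?J = "joint L K"
  define W where "W = {(p :: 'a \<times> 'a, q :: 'a \<times> 'a). (fst p, fst q) \<notin> S \<and> (snd p, snd q) \<in> S}"
  have J: "?J \<in> space (prob_algebra (borel \<Otimes>\<^sub>M borel))" by (rule joint_in_prob_algebra[OF L K])
  interpret L: prob_space L by (rule prob_algebraD[OF L])
  interpret J: prob_space ?J by (rule prob_algebraD[OF J])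
  have s [measurable_cong]: "sets L = sets borel" "sets ?J = sets (borel \<Otimes>\<^sub>M borel)"
    using L J by (simp_all only: prob_algebraD(2))
  have sK [measurable_cong]: "sets (K x) = sets borel" for x by (rule prob_algebraD[OF prob_kernelD[OF K]])
  note [measurable] = measurable_prob_algebraD[OF K]
  have W [measurable]: "W \<in> sets ((borel \<Otimes>\<^sub>M borel) \<Otimes>\<^sub>M (borel \<Otimes>\<^sub>M borel))"
  proof -
    have "W = {w \<in> space ((borel \<Otimes>\<^sub>M borel) \<Otimes>\<^sub>M (borel \<Otimes>\<^sub>M borel)). (fst (fst w), fst (snd w)) \<notin> S \<and> (snd (fst w), snd (snd w)) \<in> S}"
      by (auto simp: W_def space_pair_measure)
    also have "\<dots> \<in> sets ((borel \<Otimes>\<^sub>M borel) \<Otimes>\<^sub>M (borel \<Otimes>\<^sub>M borel))" by measurable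
    finally show ?thesis .
  qed
  define F where "F x x' y y' = indicator (- S) (x, x') * (indicator S (y, y') :: ennreal)" for x x' y y' :: 'a
  have F_W: "indicator W ((x, y), (x', y')) = F x x' y y'" for x y x' y'
    by (simp add: W_def F_def indicator_def)
  have F_meas: "(\<lambda>(p, x'). \<integral>\<^sup>+y'. F (fst p) x' (snd p) y' \<partial>K x') \<in> borel_measurable ((borel \<Otimes>\<^sub>M borel) \<Otimes>\<^sub>M L)"
  proof -
    have "(\<lambda>w. \<integral>\<^sup>+y'. F (fst (fst w)) (snd w) (snd (fst w)) y' \<partial>K (snd w)) \<in> borel_measurable ((borel \<Otimes>\<^sub>M borel) \<Otimes>\<^sub>M borel)"
      by (rule nn_integral_measurable_subprob_algebra2[where N=borel]) (auto simp: F_def)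
    then show ?thesis
      unfolding measurable_cong_sets[OF sets_pair_measure_cong[OF refl s(1)] refl] by (simp add: case_prod_beta')
  qed
  have "emeasure (?J \<Otimes>\<^sub>M ?J) W = (\<integral>\<^sup>+p. \<integral>\<^sup>+q. indicator W (p, q) \<partial>?J \<partial>?J)"
    by (rule J.emeasure_pair_measure) measurable
  also have "\<dots> = (\<integral>\<^sup>+p. \<integral>\<^sup>+x'. \<integral>\<^sup>+y'. indicator W (p, (x', y')) \<partial>K x' \<partial>L \<partial>?J)"
  proof (intro nn_integral_cong nn_integral_joint[OF L K])
    fix p :: "'a \<times> 'a"
    have "Pair p \<in> (borel \<Otimes>\<^sub>M borel) \<rightarrow>\<^sub>M ((borel \<Otimes>\<^sub>M borel) \<Otimes>\<^sub>M (borel \<Otimes>\<^sub>M borel))"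
      by (rule measurable_Pair1') (simp add: space_pair_measure)
    from measurable_compose[OF this borel_measurable_indicator[OF W]]
    show "(\<lambda>q. indicator W (p, q) :: ennreal) \<in> borel_measurable (borel \<Otimes>\<^sub>M borel)" .
  qed
  also have "\<dots> = (\<integral>\<^sup>+p. \<integral>\<^sup>+x'. \<integral>\<^sup>+y'. F (fst p) x' (snd p) y' \<partial>K x' \<partial>L \<partial>?J)"
    using F_W by (intro nn_integral_cong) (metis prod.collapse)
  also have "\<dots> = (\<integral>\<^sup>+x. \<integral>\<^sup>+y. \<integral>\<^sup>+x'. \<integral>\<^sup>+y'. F x x' y y' \<partial>K x' \<partial>L \<partial>K x \<partial>L)"
  proof (subst nn_integral_joint[OF L K])
    show "(\<lambda>p. \<integral>\<^sup>+x'. \<integral>\<^sup>+y'. F (fst p) x' (snd p) y' \<partial>K x' \<partial>L) \<in> borel_measurable (borel \<Otimes>\<^sub>M borel)"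
      by (rule L.borel_measurable_nn_integral[OF F_meas])
  qed simp
  \<comment> \<open>The regrouping itself: the successor y of x and the other starting point x'
    trade places.\<close>
  also have "\<dots> = (\<integral>\<^sup>+x. \<integral>\<^sup>+x'. \<integral>\<^sup>+y. \<integral>\<^sup>+y'. F x x' y y' \<partial>K x' \<partial>K x \<partial>L \<partial>L)"
  proof (rule nn_integral_cong)
    fix x
    interpret Kx: prob_space "K x" by (rule prob_algebraD[OF prob_kernelD[OF K]])
    interpret pair_sigma_finite L "K x" ..
    have "(\<lambda>w. \<integral>\<^sup>+y'. F x (fst w) (snd w) y' \<partial>K (fst w)) \<in> borel_measurable (borel \<Otimes>\<^sub>M borel)"
      by (rule nn_integral_measurable_subprob_algebra2[where N=borel]) (auto simp: F_def)
    then have "(\<lambda>(x', y). \<integral>\<^sup>+y'. F x x' y y' \<partial>K x') \<in> borel_measurable (L \<Otimes>\<^sub>M K x)"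
      by (simp add: case_prod_beta' s sK cong: measurable_cong_sets sets_pair_measure_cong)
    then show "(\<integral>\<^sup>+y. \<integral>\<^sup>+x'. \<integral>\<^sup>+y'. F x x' y y' \<partial>K x' \<partial>L \<partial>K x) = (\<integral>\<^sup>+x'. \<integral>\<^sup>+y. \<integral>\<^sup>+y'. F x x' y y' \<partial>K x' \<partial>K x \<partial>L)"
      by (rule Fubini')
  qed
  also have "\<dots> = (\<integral>\<^sup>+x. \<integral>\<^sup>+x'. indicator (- S) (x, x') * emeasure (K x \<Otimes>\<^sub>M K x') S \<partial>L \<partial>L)"
  proof (intro nn_integral_cong)
    fix x x'
    interpret Kx: prob_space "K x'" by (rule prob_algebraD[OF prob_kernelD[OF K]])
    have "(\<integral>\<^sup>+y. \<integral>\<^sup>+y'. F x x' y y' \<partial>K x' \<partial>K x) = indicator (- S) (x, x') * (\<integral>\<^sup>+y. \<integral>\<^sup>+y'. indicator S (y, y') \<partial>K x' \<partial>K x)"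
      by (simp add: F_def indicator_def)
    also have "(\<integral>\<^sup>+y. \<integral>\<^sup>+y'. indicator S (y, y') \<partial>K x' \<partial>K x) = emeasure (K x \<Otimes>\<^sub>M K x') S"
      by (rule Kx.emeasure_pair_measure[symmetric]) measurable
    finally show "(\<integral>\<^sup>+y. \<integral>\<^sup>+y'. F x x' y y' \<partial>K x' \<partial>K x) = indicator (- S) (x, x') * emeasure (K x \<Otimes>\<^sub>M K x') S" .
  qed
  also have "\<dots> = (\<integral>\<^sup>+z. indicator (- S) z * emeasure (K (fst z) \<Otimes>\<^sub>M K (snd z)) S \<partial>(L \<Otimes>\<^sub>M L))"
  proof (subst L.nn_integral_fst[symmetric])
    have [measurable]: "(\<lambda>z. emeasure (K (fst z) \<Otimes>\<^sub>M K (snd z)) S) \<in> borel_measurable (borel \<Otimes>\<^sub>M borel)"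
      using measurable_emeasure_kernel[OF measurable_prob_algebraD[OF measurable_pair_kernel[OF K]] S] .
    show "(\<lambda>z. indicator (- S) z * emeasure (K (fst z) \<Otimes>\<^sub>M K (snd z)) S) \<in> borel_measurable (L \<Otimes>\<^sub>M L)"
      by measurable
  qed simp
  finally show ?thesis by (simp add: W_def)
qed

text \<open>Domination on rectangles passes to product chains, since every section of the event below
  is a rectangle.\<close>

lemma pair_kernel_absorbing:
  fixes L :: "'a::polish_space measure"
  assumes L: "L \<in> space (prob_algebra borel)" and K: "prob_kernel K" and P: "prob_kernel P"
    and dom: "\<And>A B. A \<in> sets borel \<Longrightarrow> B \<in> sets borel \<Longrightarrow>
      emeasure (joint L K) (A \<times> B) = 0 \<Longrightarrow> emeasure (joint L P) (A \<times> B) = 0"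
    and S [measurable]: "S \<in> sets (borel \<Otimes>\<^sub>M borel)"
    and abs: "AE z in L \<Otimes>\<^sub>M L. z \<notin> S \<longrightarrow> emeasure (K (fst z) \<Otimes>\<^sub>M K (snd z)) S = 0"
  shows "AE z in L \<Otimes>\<^sub>M L. z \<notin> S \<longrightarrow> emeasure (P (fst z) \<Otimes>\<^sub>M P (snd z)) S = 0"
proof -
  define W where "W = {(p :: 'a \<times> 'a, q :: 'a \<times> 'a). (fst p, fst q) \<notin> S \<and> (snd p, snd q) \<in> S}"
  let ?J = "joint L K" and ?J' = "joint L P"
  have J: "?J \<in> space (prob_algebra (borel \<Otimes>\<^sub>M borel))" "?J' \<in> space (prob_algebra (borel \<Otimes>\<^sub>M borel))"
    using joint_in_prob_algebra[OF L K] joint_in_prob_algebra[OF L P] by auto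
  interpret L: prob_space L by (rule prob_algebraD[OF L])
  interpret J: prob_space ?J by (rule prob_algebraD[OF J(1)])
  interpret J': prob_space ?J' by (rule prob_algebraD[OF J(2)])
  interpret JJ': pair_sigma_finite ?J ?J' ..
  interpret J'J': pair_sigma_finite ?J' ?J' ..
  have s [measurable_cong]: "sets L = sets borel" "sets ?J = sets (borel \<Otimes>\<^sub>M borel)" "sets ?J' = sets (borel \<Otimes>\<^sub>M borel)"
    using L J by (simp_all only: prob_algebraD(2))
  have W [measurable]: "W \<in> sets ((borel \<Otimes>\<^sub>M borel) \<Otimes>\<^sub>M (borel \<Otimes>\<^sub>M borel))"
  proof -
    have "W = {w \<in> space ((borel \<Otimes>\<^sub>M borel) \<Otimes>\<^sub>M (borel \<Otimes>\<^sub>M borel)). (fst (fst w), fst (snd w)) \<notin> S \<and> (snd (fst w), snd (snd w)) \<in> S}"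
      by (auto simp: W_def space_pair_measure)
    also have "\<dots> \<in> sets ((borel \<Otimes>\<^sub>M borel) \<Otimes>\<^sub>M (borel \<Otimes>\<^sub>M borel))" by measurable
    finally show ?thesis .
  qed
  have leaves: "(\<lambda>z. indicator (- S) z * emeasure (Q (fst z) \<Otimes>\<^sub>M Q (snd z)) S) \<in> borel_measurable (L \<Otimes>\<^sub>M L)"
    if Q: "prob_kernel Q" for Q
  proof -
    have [measurable]: "(\<lambda>z. emeasure (Q (fst z) \<Otimes>\<^sub>M Q (snd z)) S) \<in> borel_measurable (borel \<Otimes>\<^sub>M borel)"
      using measurable_emeasure_kernel[OF measurable_prob_algebraD[OF measurable_pair_kernel[OF Q]] S] .
    show ?thesis by measurable
  qed
  have sec1: "Pair p -` W = {x. (fst p, x) \<notin> S} \<times> {y. (snd p, y) \<in> S}" for p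
    by (auto simp: W_def)
  have sec2: "(\<lambda>p. (p, q)) -` W = {x. (x, fst q) \<notin> S} \<times> {y. (y, snd q) \<in> S}" for q
    by (auto simp: W_def)
  have m: "{y. (c, y) \<in> S} \<in> sets borel" "{y. (y, c) \<in> S} \<in> sets borel"
    "{y. (c, y) \<notin> S} \<in> sets borel" "{y. (y, c) \<notin> S} \<in> sets borel" for c
  proof -
    have "{y \<in> space borel. (c, y) \<in> S} \<in> sets borel" "{y \<in> space borel. (y, c) \<in> S} \<in> sets borel"
      "{y \<in> space borel. (c, y) \<notin> S} \<in> sets borel" "{y \<in> space borel. (y, c) \<notin> S} \<in> sets borel"
      by measurable
    then show "{y. (c, y) \<in> S} \<in> sets borel" "{y. (y, c) \<in> S} \<in> sets borel"
      "{y. (c, y) \<notin> S} \<in> sets borel" "{y. (y, c) \<notin> S} \<in> sets borel" by simp_all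
  qed
  have WW: "W \<in> sets (?J \<Otimes>\<^sub>M ?J)" "W \<in> sets (?J \<Otimes>\<^sub>M ?J')" "W \<in> sets (?J' \<Otimes>\<^sub>M ?J')" by measurable
  have "(\<integral>\<^sup>+z. indicator (- S) z * emeasure (K (fst z) \<Otimes>\<^sub>M K (snd z)) S \<partial>(L \<Otimes>\<^sub>M L)) = 0"
    using abs by (subst nn_integral_0_iff_AE[OF leaves[OF K]]) (auto simp: indicator_def)
  then have "emeasure (?J \<Otimes>\<^sub>M ?J) W = 0"
    by (simp add: pair_return_kernel_leaves_eq[OF L K S] W_def)
  then have "AE p in ?J. emeasure ?J (Pair p -` W) = 0"
    unfolding J.emeasure_pair_measure_alt[OF WW(1)]
    by (subst (asm) nn_integral_0_iff_AE[OF J.measurable_emeasure_Pair[OF WW(1)]])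
  \<comment> \<open>With the first transition fixed, the law of the second passes from K to P; a
    null rectangle stays null.\<close>
  then have "AE p in ?J. emeasure ?J' (Pair p -` W) = 0"
    by eventually_elim (unfold sec1, intro dom m)
  then have "emeasure (?J \<Otimes>\<^sub>M ?J') W = 0"
    unfolding J'.emeasure_pair_measure_alt[OF WW(2)]
    by (subst nn_integral_0_iff_AE[OF J'.measurable_emeasure_Pair[OF WW(2)]])
  then have "AE q in ?J'. emeasure ?J ((\<lambda>p. (p, q)) -` W) = 0"
    unfolding JJ'.emeasure_pair_measure_alt2[OF WW(2)]
    by (subst (asm) nn_integral_0_iff_AE[OF JJ'.measurable_emeasure_Pair2[OF WW(2)]])
  \<comment> \<open>Fubini now fixes the second transition, already governed by P, and the first is
    exchanged in the same way.\<close>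
  then have "AE q in ?J'. emeasure ?J' ((\<lambda>p. (p, q)) -` W) = 0"
    by eventually_elim (unfold sec2, intro dom m)
  then have "emeasure (?J' \<Otimes>\<^sub>M ?J') W = 0"
    unfolding J'J'.emeasure_pair_measure_alt2[OF WW(3)]
    by (subst nn_integral_0_iff_AE[OF J'J'.measurable_emeasure_Pair2[OF WW(3)]])
  then have "(\<integral>\<^sup>+z. indicator (- S) z * emeasure (P (fst z) \<Otimes>\<^sub>M P (snd z)) S \<partial>(L \<Otimes>\<^sub>M L)) = 0"
    by (simp add: pair_return_kernel_leaves_eq[OF L P S] W_def)
  then have "AE z in L \<Otimes>\<^sub>M L. indicator (- S) z * emeasure (P (fst z) \<Otimes>\<^sub>M P (snd z)) S = 0"
    by (subst (asm) nn_integral_0_iff_AE[OF leaves[OF P]])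
  then show ?thesis by eventually_elim (auto simp: indicator_def)
qed

lemma pair_invariant:
  fixes L :: "'a::polish_space measure"
  assumes L: "L \<in> space (prob_algebra borel)" and K: "prob_kernel K" and inv: "L \<bind> K = L"
  shows "(L \<Otimes>\<^sub>M L) \<bind> (\<lambda>z. K (fst z) \<Otimes>\<^sub>M K (snd z)) = L \<Otimes>\<^sub>M L"
  using bind_pair_kernel[OF L L K K] inv by simp

text \<open>From outside S no power of the product kernel charges S, while mixing brings these
  powers close to L x L for most starting points. With m the mass of S, integrating over the
  complement bounds m * (1 - m) by an error tending to 0.\<close>

lemma mixing_absorbing_trivial:
  fixes L :: "'a::polish_space measure"
  assumes L: "L \<in> space (prob_algebra borel)" and P: "prob_kernel P" and inv: "L \<bind> P = L"
    and mix: "(\<lambda>n. \<integral>x. tv (kpow P n x) L \<partial>L) \<longlonglongrightarrow> 0"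
    and S [measurable]: "S \<in> sets (borel \<Otimes>\<^sub>M borel)"
    and abs: "AE z in L \<Otimes>\<^sub>M L. z \<notin> S \<longrightarrow> emeasure (P (fst z) \<Otimes>\<^sub>M P (snd z)) S = 0"
  shows "measure (L \<Otimes>\<^sub>M L) S = 0 \<or> measure (L \<Otimes>\<^sub>M L) S = 1"
proof -
  let ?LL = "L \<Otimes>\<^sub>M L"
  define R where "R n z = kpow P n (fst z) \<Otimes>\<^sub>M kpow P n (snd z)" for n and z :: "'a \<times> 'a"
  interpret L: prob_space L by (rule prob_algebraD[OF L])
  interpret LL: pair_prob_space L L ..
  have s [measurable_cong]: "sets L = sets borel" using L by (simp_all only: prob_algebraD(2))
  have spL [simp]: "space L = UNIV" using L by (simp add: prob_algebraD(3))
  have LLp: "?LL \<in> space (prob_algebra (borel \<Otimes>\<^sub>M borel))" by (rule pair_in_prob_algebra[OF L L])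
  have Pn [measurable]: "prob_kernel (kpow P n)" for n by (rule prob_kernel_kpow[OF P])
  note Pnx = prob_kernelD[OF Pn]
  have R_meas: "R n \<in> (borel \<Otimes>\<^sub>M borel) \<rightarrow>\<^sub>M prob_algebra (borel \<Otimes>\<^sub>M borel)" for n
    using measurable_pair_kernel[OF Pn[of n]] by (simp add: R_def[abs_def])
  have RS_meas [measurable]: "(\<lambda>z. emeasure (R n z) S) \<in> borel_measurable (borel \<Otimes>\<^sub>M borel)" for n
    by (rule measurable_emeasure_kernel[OF measurable_prob_algebraD[OF R_meas] S])
  have R_Suc: "R (Suc n) z = (P (fst z) \<Otimes>\<^sub>M P (snd z)) \<bind> R n" for n z
    unfolding R_def kpow.simps by (rule bind_pair_kernel[OF prob_kernelD[OF P] prob_kernelD[OF P] Pn Pn])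
  have absn: "AE z in ?LL. z \<notin> S \<longrightarrow> emeasure (R n z) S = 0" for n
  proof (induction n)
    case 0
    show ?case
    proof (intro AE_I2 impI)
      fix z :: "'a \<times> 'a" assume "z \<notin> S"
      have "R 0 z = return (borel \<Otimes>\<^sub>M borel) z"
      proof (unfold R_def kpow.simps, rule pair_measure_eqI)
        show "sigma_finite_measure (return borel (fst z))" "sigma_finite_measure (return borel (snd z))"
          by (simp_all add: prob_space_imp_sigma_finite prob_space_return)
        fix A B :: "'a set" assume "A \<in> sets (return borel (fst z))" "B \<in> sets (return borel (snd z))"
        then have [measurable]: "A \<in> sets borel" "B \<in> sets borel" by auto
        have "A \<times> B \<in> sets (borel \<Otimes>\<^sub>M borel)" by measurable
        then show "emeasure (return borel (fst z)) A * emeasure (return borel (snd z)) B =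
          emeasure (return (borel \<Otimes>\<^sub>M borel) z) (A \<times> B)"
          by (cases z) (simp add: indicator_def)
      qed (simp cong: sets_pair_measure_cong)
      then show "emeasure (R 0 z) S = 0" using \<open>z \<notin> S\<close> by simp
    qed
  next
    case (Suc n)
    \<comment> \<open>The exceptional set of the n-step statement is still null after one step,
      because L x L is invariant; so almost every z moves almost surely to a point where the
      induction hypothesis applies.\<close>
    have "AE z in ?LL \<bind> (\<lambda>z. P (fst z) \<Otimes>\<^sub>M P (snd z)). z \<notin> S \<longrightarrow> emeasure (R n z) S = 0"
      using Suc by (subst pair_invariant[OF L P inv])
    then have "AE z in ?LL. AE w in P (fst z) \<Otimes>\<^sub>M P (snd z). w \<notin> S \<longrightarrow> emeasure (R n w) S = 0"
      by (subst (asm) AE_bind[OF measurable_kernel_cong[OF LLp measurable_pair_kernel[OF P]]]) auto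
    with abs show ?case
    proof eventually_elim
      case (elim z)
      have zp: "P (fst z) \<Otimes>\<^sub>M P (snd z) \<in> space (prob_algebra (borel \<Otimes>\<^sub>M borel))"
        by (intro pair_in_prob_algebra prob_kernelD[OF P])
      note sz [measurable_cong] = prob_algebraD(2)[OF zp]
      show ?case
      proof
        assume "z \<notin> S"
        with elim have "emeasure (P (fst z) \<Otimes>\<^sub>M P (snd z)) S = 0" by simp
        then have "AE w in P (fst z) \<Otimes>\<^sub>M P (snd z). w \<notin> S"
          by (intro AE_not_in) (simp add: null_sets_def sz)
        with elim(2) have "AE w in P (fst z) \<Otimes>\<^sub>M P (snd z). emeasure (R n w) S = 0"
          by eventually_elim simp
        then have "(\<integral>\<^sup>+w. emeasure (R n w) S \<partial>(P (fst z) \<Otimes>\<^sub>M P (snd z))) = 0"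
          by (subst nn_integral_0_iff_AE) auto
        then show "emeasure (R (Suc n) z) S = 0"
          unfolding R_Suc by (subst emeasure_bind_prob_algebra[OF zp R_meas S])
      qed
    qed
  qed
  let ?m = "measure ?LL S"
  have m01: "0 \<le> ?m" "?m \<le> 1" by auto
  have bound: "?m * (1 - ?m) \<le> 2 * (\<integral>x. tv (kpow P n x) L \<partial>L)" for n
  proof -
    have t01: "0 \<le> tv (kpow P n x) L" "tv (kpow P n x) L \<le> 1" for x
      using tv_nonneg[OF Pnx L] tv_le_1[OF Pnx L] by auto
    have [measurable]: "(\<lambda>x. tv (kpow P n x) L) \<in> borel_measurable borel"
      using L by (intro borel_measurable_tv Pn measurable_const) 
    have i0: "integrable L (\<lambda>x. tv (kpow P n x) L)"
      using t01 by (intro integrable_bounded[of _ _ 1] L.prob_space_axioms) (auto)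
    have i1: "integrable ?LL (\<lambda>z. tv (kpow P n (fst z)) L)" "integrable ?LL (\<lambda>z. tv (kpow P n (snd z)) L)"
      using t01 by (intro integrable_bounded[of _ _ 1] LL.prob_space_axioms; auto)+
    have "?m * (1 - ?m) = (\<integral>z. indicator (- S) z * ?m \<partial>?LL)"
      using LL.prob_compl[of S] by (simp add: s space_pair_measure Compl_eq_Diff_UNIV mult.commute)
    also have "\<dots> \<le> (\<integral>z. tv (kpow P n (fst z)) L + tv (kpow P n (snd z)) L \<partial>?LL)"
    proof (rule integral_mono_AE)
      show "integrable ?LL (\<lambda>z. indicator (- S) z * ?m)"
        using m01 by (intro integrable_bounded[of _ _ 1] LL.prob_space_axioms) (auto simp: indicator_def)
      show "integrable ?LL (\<lambda>z. tv (kpow P n (fst z)) L + tv (kpow P n (snd z)) L)"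
        using i1 by (rule Bochner_Integration.integrable_add)
      show "AE z in ?LL. indicator (- S) z * ?m \<le> tv (kpow P n (fst z)) L + tv (kpow P n (snd z)) L"
        using absn[of n]
      proof eventually_elim
        case (elim z)
        have "\<bar>measure (R n z) S - ?m\<bar> \<le> tv (kpow P n (fst z)) L + tv (kpow P n (snd z)) L"
          unfolding R_def by (intro measure_pair_diff_le_tv Pnx L S)
        then show ?case using elim t01[of "fst z"] t01[of "snd z"] m01
          by (cases "z \<in> S") (auto simp: measure_def)
      qed
    qed
    also have "\<dots> = (\<integral>z. tv (kpow P n (fst z)) L \<partial>?LL) + (\<integral>z. tv (kpow P n (snd z)) L \<partial>?LL)"
      using i1 by (rule Bochner_Integration.integral_add)
    also have "(\<integral>z. tv (kpow P n (fst z)) L \<partial>?LL) = (\<integral>x. tv (kpow P n x) L \<partial>L)"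
      using integral_prod_pair[of L L "\<lambda>x. tv (kpow P n x) L" "\<lambda>_. 1"] t01 L.prob_space_axioms L.prob_space by simp
    also have "(\<integral>z. tv (kpow P n (snd z)) L \<partial>?LL) = (\<integral>x. tv (kpow P n x) L \<partial>L)"
      using integral_prod_pair[of L L "\<lambda>_. 1" "\<lambda>x. tv (kpow P n x) L"] t01 L.prob_space_axioms L.prob_space by simp
    finally show ?thesis by simp
  qed
  have "(\<lambda>n. 2 * (\<integral>x. tv (kpow P n x) L \<partial>L)) \<longlonglongrightarrow> 2 * 0" by (intro tendsto_intros mix)
  then have "?m * (1 - ?m) \<le> 2 * 0" by (rule LIMSEQ_le_const) (use bound in blast)
  moreover have "0 \<le> ?m * (1 - ?m)" using m01 by (intro mult_nonneg_nonneg) auto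
  ultimately have "?m * (1 - ?m) = 0" by simp
  then show ?thesis by simp
qed

section \<open>Convergence in total variation\<close>

text \<open>Every level a below the mean is exceeded almost everywhere, since otherwise f <= a
  almost everywhere and the mean would be at most a. So f is at least its mean, and equal integrals
  force equality.\<close>

lemma AE_const_if_trivial_level_sets:
  fixes f :: "'a \<Rightarrow> real"
  assumes "prob_space M" and [measurable]: "f \<in> borel_measurable M"
    and f: "\<And>x. \<bar>f x\<bar> \<le> b"
    and triv: "\<And>a. measure M {x\<in>space M. a < f x} = 0 \<or> measure M {x\<in>space M. a < f x} = 1"
  shows "AE x in M. f x = (\<integral>x. f x \<partial>M)"
proof -
  interpret prob_space M by fact
  let ?c = "\<integral>x. f x \<partial>M"
  have int: "integrable M f" by (rule integrable_bounded[OF prob_space_axioms _ f]) simp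
  have gt: "AE x in M. a < f x" if "a < ?c" for a
  proof -
    have "measure M {x\<in>space M. a < f x} \<noteq> 0"
    proof
      assume "measure M {x\<in>space M. a < f x} = 0"
      then have "AE x in M. f x \<le> a"
        by (subst (asm) prob_eq_0) (auto simp: not_less)
      then have "?c \<le> (\<integral>x. a \<partial>M)" by (intro integral_mono_AE int) auto
      then show False using that by (simp add: prob_space)
    qed
    then have "measure M {x\<in>space M. a < f x} = 1" using triv by auto
    then show ?thesis by (subst (asm) prob_Collect_eq_1) auto
  qed
  have "AE x in M. \<forall>n. ?c - 1 / real (Suc n) < f x"
    unfolding AE_all_countable by (intro allI gt) simp
  then have "AE x in M. ?c \<le> f x"
  proof eventually_elim
    case (elim x)
    have "(\<lambda>n. ?c - 1 / real (Suc n)) \<longlonglongrightarrow> ?c - 0"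
      by (intro tendsto_intros LIMSEQ_Suc[OF lim_1_over_n])
    then have "?c - 0 \<le> f x" using elim by (intro LIMSEQ_le_const2) (auto intro: less_imp_le)
    then show ?case by simp
  qed
  then have "AE x in M. ?c = f x"
    by (intro integral_eq_mono_AE_eq_AE int) (auto simp: prob_space)
  then show ?thesis by eventually_elim simp
qed

text \<open>The limit of \<open>tv (kpow K n x) (kpow K n y)\<close> is invariant for the product chain, hence almost
  everywhere a constant \<open>c\<close>. Coupling the uncancelled parts of the two laws after \<open>n\<close> steps
  gives \<open>c \<le> tv (kpow K n x) (kpow K n y) * c\<close>, so \<open>c > 0\<close> forces all distances to be 1.\<close>

theorem tv_kpow_tendsto_0:
  fixes L :: "'a::polish_space measure"
  assumes L: "L \<in> space (prob_algebra borel)"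
    and K: "prob_kernel K" and invK: "L \<bind> K = L"
    and P: "prob_kernel P" and invP: "L \<bind> P = L"
    and dom: "\<And>A B. A \<in> sets borel \<Longrightarrow> B \<in> sets borel \<Longrightarrow>
      emeasure (joint L K) (A \<times> B) = 0 \<Longrightarrow> emeasure (joint L P) (A \<times> B) = 0"
    and mix: "(\<lambda>n. \<integral>x. tv (kpow P n x) L \<partial>L) \<longlonglongrightarrow> 0"
    and nonsing: "\<not> (\<forall>n. AE z in L \<Otimes>\<^sub>M L. tv (kpow K n (fst z)) (kpow K n (snd z)) = 1)"
  shows "(\<lambda>n. \<integral>z. tv (kpow K n (fst z)) (kpow K n (snd z)) \<partial>(L \<Otimes>\<^sub>M L)) \<longlonglongrightarrow> 0"
proof -
  let ?LL = "L \<Otimes>\<^sub>M L"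
  define D where "D n z = tv (kpow K n (fst z)) (kpow K n (snd z))" for n and z :: "'a \<times> 'a"
  define Q where "Q n z = kpow K n (fst z) \<Otimes>\<^sub>M kpow K n (snd z)" for n and z :: "'a \<times> 'a"
  interpret L: prob_space L by (rule prob_algebraD[OF L])
  interpret LL: pair_prob_space L L ..
  have LLp: "?LL \<in> space (prob_algebra (borel \<Otimes>\<^sub>M borel))" by (rule pair_in_prob_algebra[OF L L])
  have s [measurable_cong]: "sets L = sets borel" using L by (simp_all only: prob_algebraD(2))
  have spL: "space ?LL = UNIV" using L by (simp add: prob_algebraD(3) space_pair_measure)
  have Kn [measurable]: "prob_kernel (kpow K n)" for n by (rule prob_kernel_kpow[OF K])
  note Knx = prob_kernelD[OF Kn]
  have Qp: "Q n z \<in> space (prob_algebra (borel \<Otimes>\<^sub>M borel))" for n z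
    unfolding Q_def by (intro pair_in_prob_algebra Knx)
  have Q_prob: "prob_space (Q n z)" for n z by (rule prob_algebraD[OF Qp])
  have Q_sets [measurable_cong]: "sets (Q n z) = sets (borel \<Otimes>\<^sub>M borel)" for n z by (rule prob_algebraD[OF Qp])
  have Q_space: "space (Q n z) = UNIV" for n z using prob_algebraD(3)[OF Qp] by (simp add: space_pair_measure)
  have Q_meas: "Q n \<in> (borel \<Otimes>\<^sub>M borel) \<rightarrow>\<^sub>M prob_algebra (borel \<Otimes>\<^sub>M borel)" for n
    using measurable_pair_kernel[OF Kn[of n]] by (simp add: Q_def[abs_def])
  have Q_inv: "?LL \<bind> Q n = ?LL" for n
    using pair_invariant[OF L Kn bind_kpow_invariant[OF L K invK], of n] by (simp add: Q_def[abs_def])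
  have AE_Q: "AE z in ?LL. AE w in Q n z. pr w"
    if "AE z in ?LL. pr z" and [measurable]: "Measurable.pred (borel \<Otimes>\<^sub>M borel) pr" for n pr
  proof -
    have "AE z in ?LL \<bind> Q n. pr z" using that(1) by (subst Q_inv)
    then show ?thesis by (subst (asm) AE_bind[OF measurable_kernel_cong[OF LLp Q_meas]]) auto
  qed
  have D_meas [measurable]: "D n \<in> borel_measurable (borel \<Otimes>\<^sub>M borel)" for n
    unfolding D_def[abs_def] by (intro borel_measurable_tv measurable_compose[OF measurable_fst Kn] measurable_compose[OF measurable_snd Kn])
  have D01: "0 \<le> D n z" "D n z \<le> 1" for n z
    unfolding D_def by (auto intro!: tv_nonneg tv_le_1 Knx)
  have kpow1: "kpow K (Suc 0) x = K x" for x
    using prob_algebraD(2)[OF prob_kernelD[OF K]] by (simp add: bind_return'')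
  have D_add: "D (n + m) z \<le> (\<integral>w. D m w \<partial>Q n z)" for n m z
    unfolding D_def Q_def kpow_add[OF K] by (intro tv_bind_le_integral Knx Kn)
  have D_dec: "D (Suc n) z \<le> D n z" for n z
    using kpow_add[OF K, of n 1] unfolding D_def by (simp only: Suc_eq_plus1) (intro tv_bind_le Knx Kn)
  define d where "d z = (INF n. D n z)" for z
  have bdd: "bdd_below (range (\<lambda>n. D n z))" for z using D01(1) by (intro bdd_belowI2[where m=0]) blast
  have D_lim: "(\<lambda>n. D n z) \<longlonglongrightarrow> d z" for z
    unfolding d_def using D_dec bdd by (intro LIMSEQ_decseq_INF decseq_SucI)
  have d_meas [measurable]: "d \<in> borel_measurable (borel \<Otimes>\<^sub>M borel)"
    by (rule borel_measurable_LIMSEQ_real[of _ D]) (auto simp: D_lim)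
  have d01: "0 \<le> d z" "d z \<le> 1" for z
    using D01 by (blast intro: LIMSEQ_le_const[OF D_lim] LIMSEQ_le_const2[OF D_lim])+
  have int_b: "integrable (Q n z) f" if "f \<in> borel_measurable (borel \<Otimes>\<^sub>M borel)" "\<And>w. \<bar>f w\<bar> \<le> 1" for n z and f :: "_ \<Rightarrow> real"
    using that by (intro integrable_bounded[OF Q_prob, of _ _ _ 1]) auto
  have D_int_lim: "(\<lambda>m. \<integral>w. D m w * f w \<partial>Q n z) \<longlonglongrightarrow> (\<integral>w. d w * f w \<partial>Q n z)"
    if [measurable]: "f \<in> borel_measurable (borel \<Otimes>\<^sub>M borel)" and f: "\<And>w. \<bar>f w\<bar> \<le> 1" for f n z
  proof (rule integral_dominated_convergence)
    show "integrable (Q n z) (\<lambda>_. 1 :: real)" by (rule int_b) auto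
    show "AE w in Q n z. (\<lambda>m. D m w * f w) \<longlonglongrightarrow> d w * f w"
      by (intro AE_I2 tendsto_intros D_lim)
    show "AE w in Q n z. norm (D m w * f w) \<le> 1" for m
      using D01 f by (intro AE_I2) (auto simp: abs_mult intro!: mult_le_one)
  qed auto
  \<comment> \<open>The limit of \<open>D_add\<close> yields only an inequality; equality comes
    later, from integrating against the invariant law.\<close>
  have d_sub: "d z \<le> (\<integral>w. d w \<partial>Q (Suc 0) z)" for z
  proof (rule LIMSEQ_le)
    show "(\<lambda>n. D (Suc n) z) \<longlonglongrightarrow> d z" by (rule LIMSEQ_Suc[OF D_lim])
    show "(\<lambda>n. \<integral>w. D n w \<partial>Q (Suc 0) z) \<longlonglongrightarrow> (\<integral>w. d w \<partial>Q (Suc 0) z)"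
      using D_int_lim[of "\<lambda>_. 1" "Suc 0" z] by simp
    show "\<exists>N. \<forall>n\<ge>N. D (Suc n) z \<le> (\<integral>w. D n w \<partial>Q (Suc 0) z)"
      using D_add[of "Suc 0" _ z] by simp
  qed
  have level: "measure ?LL {z\<in>space ?LL. a < d z} = 0 \<or> measure ?LL {z\<in>space ?LL. a < d z} = 1" for a
  proof -
    \<comment> \<open>Clamping the level at 0 keeps the truncation below within [0, 1]; negative
      levels are exceeded everywhere and are settled at the end.\<close>
    define a' where "a' = max a 0"
    \<comment> \<open>Like d, its truncation is at most its own average after one step. It is
      positive exactly on the level set, so once it is invariant, the level set cannot be entered
      from outside.\<close>
    define f where "f z = max 0 (d z - a')" for z
    have [measurable]: "f \<in> borel_measurable (borel \<Otimes>\<^sub>M borel)" unfolding f_def[abs_def] by measurable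
    have f01: "0 \<le> f z" "f z \<le> 1" for z using d01[of z] by (auto simp: f_def a'_def)
    have int_f: "integrable (Q n z) f" for n z using f01 by (intro int_b) auto
    have f_sub: "f z \<le> (\<integral>w. f w \<partial>Q (Suc 0) z)" for z
    proof -
      have "(\<integral>w. d w \<partial>Q (Suc 0) z) - a' = (\<integral>w. d w - a' \<partial>Q (Suc 0) z)"
        using prob_space.prob_space[OF Q_prob[of "Suc 0" z]] prob_space.finite_measure[OF Q_prob[of "Suc 0" z]] d01
        by (subst Bochner_Integration.integral_diff) (auto intro!: int_b finite_measure.integrable_const)
      also have "\<dots> \<le> (\<integral>w. f w \<partial>Q (Suc 0) z)"
      proof (rule integral_mono[OF _ int_f])
        show "integrable (Q (Suc 0) z) (\<lambda>w. d w - a')"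
          using prob_space.finite_measure[OF Q_prob[of "Suc 0" z]] d01
          by (intro Bochner_Integration.integrable_diff int_b finite_measure.integrable_const) auto
      qed (simp add: f_def)
      finally have "d z - a' \<le> (\<integral>w. f w \<partial>Q (Suc 0) z)" using d_sub[of z] by simp
      moreover have "0 \<le> (\<integral>w. f w \<partial>Q (Suc 0) z)" using f01 by (intro Bochner_Integration.integral_nonneg) auto
      ultimately show ?thesis by (simp add: f_def)
    qed
    have Qf_meas [measurable]: "(\<lambda>z. \<integral>w. f w \<partial>Q (Suc 0) z) \<in> borel_measurable (borel \<Otimes>\<^sub>M borel)"
      by (rule measurable_compose[OF measurable_prob_algebraD[OF Q_meas] integral_measurable_subprob_algebra]) simp
    have Qf01: "0 \<le> (\<integral>w. f w \<partial>Q (Suc 0) z)" "(\<integral>w. f w \<partial>Q (Suc 0) z) \<le> 1" for z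
    proof -
      show "0 \<le> (\<integral>w. f w \<partial>Q (Suc 0) z)" using f01 by (intro Bochner_Integration.integral_nonneg) auto
      have "(\<integral>w. f w \<partial>Q (Suc 0) z) \<le> (\<integral>w. 1 \<partial>Q (Suc 0) z)"
        using f01 by (intro integral_mono int_f int_b) auto
      then show "(\<integral>w. f w \<partial>Q (Suc 0) z) \<le> 1" using prob_space.prob_space[OF Q_prob[of "Suc 0" z]] by simp
    qed
    \<comment> \<open>A pointwise inequality between functions with the same integral is an almost
      sure equality; the integrals agree because L x L is invariant.\<close>
    have "AE z in ?LL. f z = (\<integral>w. f w \<partial>Q (Suc 0) z)"
    proof (rule LL.integral_eq_mono_AE_eq_AE)
      show "integrable ?LL f" using f01 by (intro integrable_bounded[of _ _ 1] LL.prob_space_axioms) auto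
      show "integrable ?LL (\<lambda>z. \<integral>w. f w \<partial>Q (Suc 0) z)"
        using Qf01 by (intro integrable_bounded[of _ _ 1] LL.prob_space_axioms) auto
      have "(\<integral>z. f z \<partial>?LL) = (\<integral>z. f z \<partial>(?LL \<bind> Q (Suc 0)))" by (simp add: Q_inv)
      also have "\<dots> = (\<integral>z. \<integral>w. f w \<partial>Q (Suc 0) z \<partial>?LL)"
        using f01 by (intro integral_bind_prob[OF LLp Q_meas, of _ 1]) auto
      finally show "(\<integral>z. f z \<partial>?LL) = (\<integral>z. \<integral>w. f w \<partial>Q (Suc 0) z \<partial>?LL)" .
      show "AE z in ?LL. f z \<le> (\<integral>w. f w \<partial>Q (Suc 0) z)" by (intro AE_I2 f_sub)
    qed
    note f_inv = this
    define S where "S = {z. a' < d z}"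
    have S [measurable]: "S \<in> sets (borel \<Otimes>\<^sub>M borel)"
    proof -
      have "{z \<in> space (borel \<Otimes>\<^sub>M borel). a' < d z} \<in> sets (borel \<Otimes>\<^sub>M borel)" by measurable
      then show ?thesis by (simp add: S_def space_pair_measure)
    qed
    from f_inv have "AE z in ?LL. z \<notin> S \<longrightarrow> emeasure (K (fst z) \<Otimes>\<^sub>M K (snd z)) S = 0"
    proof eventually_elim
      case (elim z)
      show ?case
      proof (rule impI)
        assume "z \<notin> S"
        then have "(\<integral>w. f w \<partial>Q (Suc 0) z) = 0" using elim by (simp add: S_def f_def)
        then have "AE w in Q (Suc 0) z. f w = 0"
          using f01 by (subst (asm) integral_nonneg_eq_0_iff_AE[OF int_f]) auto
        then have "AE w in Q (Suc 0) z. w \<notin> S"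
          by eventually_elim (auto simp: f_def S_def max_def split: if_splits)
        then have "emeasure (Q (Suc 0) z) S = 0"
          by (subst (asm) AE_iff_null) (auto simp: Q_space null_sets_def)
        then show "emeasure (K (fst z) \<Otimes>\<^sub>M K (snd z)) S = 0" by (simp add: Q_def kpow1 del: kpow.simps)
      qed
    qed
    from pair_kernel_absorbing[OF L K P dom S this]
    have "AE z in ?LL. z \<notin> S \<longrightarrow> emeasure (P (fst z) \<Otimes>\<^sub>M P (snd z)) S = 0" .
    from mixing_absorbing_trivial[OF L P invP mix S this]
    have S01: "measure ?LL S = 0 \<or> measure ?LL S = 1" .
    show ?thesis
    proof (cases "0 \<le> a")
      case True
      then show ?thesis using S01 by (simp add: S_def a'_def spL)
    next
      case False
      then have "a < d z" for z using d01(1)[of z] by simp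
      then have "{z\<in>space ?LL. a < d z} = space ?LL" by simp
      then show ?thesis using LL.prob_space by simp
    qed
  qed
  define c where "c = (\<integral>z. d z \<partial>?LL)"
  have d_const: "AE z in ?LL. d z = c"
    unfolding c_def using d01 level
    by (intro AE_const_if_trivial_level_sets[of _ _ 1] LL.prob_space_axioms) auto
  have c0: "0 \<le> c" unfolding c_def using d01 by (intro Bochner_Integration.integral_nonneg) auto
  have "c = 0"
  proof (rule ccontr)
    assume "c \<noteq> 0"
    with c0 have "0 < c" by simp
    \<comment> \<open>By invariance the n-step law of almost every z is carried by the set where d =
      c, for all n at once.\<close>
    have "AE z in ?LL. \<forall>n. AE w in Q n z. d w = c"
      unfolding AE_all_countable using d_const by (intro allI AE_Q) auto
    with d_const have "AE z in ?LL. \<forall>n. D n z = 1"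
    proof eventually_elim
      case (elim z)
      show ?case
      proof
        fix n
        obtain h k :: "'a \<Rightarrow> real" where hk [measurable]: "h \<in> borel_measurable borel" "k \<in> borel_measurable borel"
          and hk01: "\<And>x. 0 \<le> h x" "\<And>x. h x \<le> 1" "\<And>x. 0 \<le> k x" "\<And>x. k x \<le> 1"
          and mass: "(\<integral>x. h x \<partial>kpow K n (fst z)) = D n z" "(\<integral>x. k x \<partial>kpow K n (snd z)) = D n z"
          and diff: "\<And>f c. f \<in> borel_measurable borel \<Longrightarrow> (\<And>x. \<bar>f x\<bar> \<le> c) \<Longrightarrow>
            (\<integral>x. f x \<partial>kpow K n (fst z)) - (\<integral>x. f x \<partial>kpow K n (snd z)) =
            (\<integral>x. f x * h x \<partial>kpow K n (fst z)) - (\<integral>x. f x * k x \<partial>kpow K n (snd z))"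
          unfolding D_def by (rule tv_coupling[OF Knx Knx]) blast
        have sK [measurable_cong]: "sets (kpow K n x) = sets borel" for x by (rule prob_algebraD[OF Knx])
        have hk_le: "0 \<le> h x * k y" "h x * k y \<le> 1" for x y using hk01 by (auto intro: mult_le_one)
        \<comment> \<open>The parts uncancelled after n steps run for m further steps. With n fixed
          and m tending to infinity, \<open>D m\<close> under the integral becomes d, which equals c
          there.\<close>
        have "D n z * d z \<le> (\<integral>w. d w * (h (fst w) * k (snd w)) \<partial>Q n z)"
        proof (rule LIMSEQ_le)
          show "(\<lambda>m. D n z * D (n + m) z) \<longlonglongrightarrow> D n z * d z"
            using LIMSEQ_ignore_initial_segment[OF D_lim[of z], of n] by (intro tendsto_intros) (simp add: add.commute)
          show "(\<lambda>m. \<integral>w. D m w * (h (fst w) * k (snd w)) \<partial>Q n z) \<longlonglongrightarrow> (\<integral>w. d w * (h (fst w) * k (snd w)) \<partial>Q n z)"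
            using hk_le by (intro D_int_lim) (auto simp: abs_of_nonneg simp del: abs_mult)
          have "D n z * D (n + m) z \<le> (\<integral>w. D m w * (h (fst w) * k (snd w)) \<partial>Q n z)" for m
            unfolding D_def[of "n + m"] D_def[of m] kpow_add[OF K] Q_def
            by (rule tv_bind_coupling[OF Knx Knx Kn[of m] hk hk01 mass]) (rule diff)
          then show "\<exists>N. \<forall>m\<ge>N. D n z * D (n + m) z \<le> (\<integral>w. D m w * (h (fst w) * k (snd w)) \<partial>Q n z)" by blast
        qed
        also have "\<dots> = (\<integral>w. c * (h (fst w) * k (snd w)) \<partial>Q n z)"
        proof (rule integral_cong_AE)
          have "AE w in Q n z. d w = c" using elim by blast
          then show "AE w in Q n z. d w * (h (fst w) * k (snd w)) = c * (h (fst w) * k (snd w))"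
            by eventually_elim simp
        qed measurable
        also have "\<dots> = c * (D n z * D n z)"
          using integral_prod_pair[of "kpow K n (fst z)" "kpow K n (snd z)" h k] hk01 prob_algebraD(1)[OF Knx]
          by (simp add: Q_def mass)
        \<comment> \<open>Both h and k have mass \<open>D n z\<close>, which explains the square;
          since \<open>D n z\<close> is at least c > 0, a factor can be cancelled.\<close>
        finally have le: "D n z * c \<le> c * (D n z * D n z)" using elim by simp
        have "c \<le> D n z"
        proof -
          have "d z \<le> D n z" unfolding d_def using bdd by (intro cINF_lower) auto
          then show ?thesis using elim by simp
        qed
        with \<open>0 < c\<close> have "0 < c * D n z" by simp
        moreover have "(c * D n z) * 1 \<le> (c * D n z) * D n z" using le by (simp add: ac_simps)
        ultimately have "1 \<le> D n z" by (simp only: mult_le_cancel_left_pos)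
        then show "D n z = 1" using D01(2)[of n z] by simp
      qed
    qed
    then have "\<forall>n. AE z in ?LL. D n z = 1" unfolding AE_all_countable .
    with nonsing show False by (simp add: D_def)
  qed
  have "(\<lambda>n. \<integral>z. D n z \<partial>?LL) \<longlonglongrightarrow> (\<integral>z. d z \<partial>?LL)"
  proof (rule integral_dominated_convergence)
    show "integrable ?LL (\<lambda>_. 1 :: real)" by (rule integrable_bounded[of _ _ 1]) (auto intro: LL.prob_space_axioms)
    show "AE w in ?LL. (\<lambda>m. D m w) \<longlonglongrightarrow> d w" by (intro AE_I2 D_lim)
    show "AE w in ?LL. norm (D m w) \<le> 1" for m using D01 by (intro AE_I2) auto
  qed auto
  then show ?thesis using \<open>c = 0\<close> by (simp add: c_def D_def)
qed

section \<open>The mixing coefficients of a Markov chain\<close>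

text \<open>Exhaustion: some countable subfamily has a pointwise supremum of largest integral.
  Adjoining one more index cannot raise that integral, so the new member exceeds the supremum only
  on a null set.\<close>

lemma ess_sup_exists:
  fixes f :: "'i \<Rightarrow> 'a \<Rightarrow> real"
  assumes "prob_space M" and "I \<noteq> {}"
    and meas: "\<And>i. i \<in> I \<Longrightarrow> f i \<in> borel_measurable M"
    and f01: "\<And>i. i \<in> I \<Longrightarrow> AE \<omega> in M. 0 \<le> f i \<omega> \<and> f i \<omega> \<le> 1"
  shows "\<exists>Z. is_ess_sup M I f Z"
proof -
  interpret prob_space M by fact
  define g where "g J \<omega> = (SUP i\<in>J. ennreal (f i \<omega>))" for J \<omega>
  define CC where "CC = {J. countable J \<and> J \<subseteq> I}"
  have g_meas: "g J \<in> borel_measurable M" if "J \<in> CC" for J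
    unfolding g_def[abs_def] using that meas
    by (intro borel_measurable_SUP measurable_compose[OF _ measurable_ennreal]) (auto simp: CC_def)
  have g_le: "AE \<omega> in M. g J \<omega> \<le> 1" if "J \<in> CC" for J
  proof -
    have "AE \<omega> in M. \<forall>i\<in>J. 0 \<le> f i \<omega> \<and> f i \<omega> \<le> 1"
      using that f01 by (intro AE_ball_countable[THEN iffD2]) (auto simp: CC_def)
    then show ?thesis by eventually_elim (auto simp: g_def intro!: SUP_least)
  qed
  obtain i0 where i0: "i0 \<in> I" using \<open>I \<noteq> {}\<close> by auto
  have "CC \<noteq> {}" by (auto simp: CC_def)
  from ennreal_SUP_countable_SUP[OF this, of "\<lambda>J. \<integral>\<^sup>+\<omega>. g J \<omega> \<partial>M"]
  obtain a :: "nat \<Rightarrow> ennreal" where a: "range a \<subseteq> (\<lambda>J. \<integral>\<^sup>+\<omega>. g J \<omega> \<partial>M) ` CC"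
    "(SUP J\<in>CC. \<integral>\<^sup>+\<omega>. g J \<omega> \<partial>M) = Sup (range a)" by blast
  then have "\<forall>n. \<exists>J\<in>CC. a n = (\<integral>\<^sup>+\<omega>. g J \<omega> \<partial>M)" by auto
  then obtain Js where Js: "\<And>n. Js n \<in> CC" "\<And>n. a n = (\<integral>\<^sup>+\<omega>. g (Js n) \<omega> \<partial>M)" by metis
  \<comment> \<open>The index \<open>i0\<close> makes the family nonempty, so every majorant is
    nonnegative almost everywhere and the return from \<open>ennreal\<close> to the reals loses
    nothing.\<close>
  define J where "J = insert i0 (\<Union>n. Js n)"
  have J: "J \<in> CC" using Js(1) i0 by (auto simp: J_def CC_def)
  have g_mono: "g A \<omega> \<le> g B \<omega>" if "A \<subseteq> B" for A B \<omega>
    unfolding g_def using that by (intro SUP_subset_mono) auto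
  have sup: "(\<integral>\<^sup>+\<omega>. g A \<omega> \<partial>M) \<le> (\<integral>\<^sup>+\<omega>. g J \<omega> \<partial>M)" if "A \<in> CC" for A
  proof -
    have "(\<integral>\<^sup>+\<omega>. g A \<omega> \<partial>M) \<le> Sup (range a)"
      unfolding a(2)[symmetric] using that by (intro SUP_upper)
    also have "\<dots> \<le> (\<integral>\<^sup>+\<omega>. g J \<omega> \<partial>M)"
      using Js(2) by (auto intro!: Sup_least nn_integral_mono g_mono simp: J_def)
    finally show ?thesis .
  qed
  define Z where "Z \<omega> = enn2real (g J \<omega>)" for \<omega>
  show ?thesis
    unfolding is_ess_sup_def
  proof (intro exI[of _ Z] conjI ballI impI)
    show "Z \<in> borel_measurable M"
      unfolding Z_def[abs_def] using g_meas[OF J] by (rule borel_measurable_enn2real)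
    fix i assume i: "i \<in> I"
    have J': "insert i J \<in> CC" using J i by (auto simp: CC_def)
    have fin: "(\<integral>\<^sup>+\<omega>. g J \<omega> \<partial>M) \<noteq> \<infinity>"
    proof -
      have "(\<integral>\<^sup>+\<omega>. g J \<omega> \<partial>M) \<le> (\<integral>\<^sup>+\<omega>. 1 \<partial>M)" using g_le[OF J] by (rule nn_integral_mono_AE)
      then show ?thesis by (auto simp: emeasure_space_1 top_unique)
    qed
    have "AE \<omega> in M. g (insert i J) \<omega> \<le> g J \<omega>"
    proof (rule ccontr)
      assume "\<not> ?thesis"
      with fin have "(\<integral>\<^sup>+\<omega>. g J \<omega> \<partial>M) < (\<integral>\<^sup>+\<omega>. g (insert i J) \<omega> \<partial>M)"
        by (intro nn_integral_less g_meas J J' AE_I2 g_mono) auto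
      with sup[OF J'] show False by simp
    qed
    with g_le[OF J] f01[OF i] show "AE \<omega> in M. f i \<omega> \<le> Z \<omega>"
    proof eventually_elim
      case (elim \<omega>)
      have "ennreal (f i \<omega>) \<le> g (insert i J) \<omega>" unfolding g_def by (rule SUP_upper) simp
      also have "\<dots> \<le> g J \<omega>" by (rule elim)
      finally have "enn2real (ennreal (f i \<omega>)) \<le> Z \<omega>"
        unfolding Z_def using elim(1) by (intro enn2real_mono) (auto intro: le_less_trans)
      then show ?case using elim by simp
    qed
  next
    fix Z' assume "Z' \<in> borel_measurable M" "\<forall>i\<in>I. AE \<omega> in M. f i \<omega> \<le> Z' \<omega>"
    then have "AE \<omega> in M. \<forall>i\<in>J. f i \<omega> \<le> Z' \<omega>"
      using J by (intro AE_ball_countable[THEN iffD2]) (auto simp: CC_def)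
    with f01[OF i0] show "AE \<omega> in M. Z \<omega> \<le> Z' \<omega>"
    proof eventually_elim
      case (elim \<omega>)
      then have "0 \<le> Z' \<omega>" by (auto simp: J_def intro: order_trans)
      moreover have "g J \<omega> \<le> ennreal (Z' \<omega>)"
        unfolding g_def using elim by (auto intro!: SUP_least ennreal_leI)
      then have "Z \<omega> \<le> enn2real (ennreal (Z' \<omega>))"
        unfolding Z_def by (intro enn2real_mono) auto
      ultimately show ?case by simp
    qed
  qed
qed

section \<open>Sigma-fields generated by a real process\<close>

lemma sets_sigma_of: "sets (sigma_of M X I) = sigma_sets (space M) {X i -` A \<inter> space M | i A. i \<in> I \<and> A \<in> sets borel}"
  and space_sigma_of: "space (sigma_of M X I) = space M"
  unfolding sigma_of_def by (auto intro!: sets_measure_of space_measure_of)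

lemma sigma_of_mono: "I \<subseteq> J \<Longrightarrow> sets (sigma_of M X I) \<subseteq> sets (sigma_of M X J)"
  unfolding sets_sigma_of by (rule sigma_sets_mono') auto

lemma measurable_sigma_of: "i \<in> I \<Longrightarrow> X i \<in> borel_measurable (sigma_of M X I)"
  by (intro measurableI) (auto simp: sets_sigma_of space_sigma_of intro!: sigma_sets.Basic)

lemma subalgebra_sigma_of:
  assumes "\<And>i. i \<in> I \<Longrightarrow> X i \<in> borel_measurable M"
  shows "subalgebra M (sigma_of M X I)"
  unfolding subalgebra_def space_sigma_of sets_sigma_of
  using assms by (auto intro!: sets.sigma_sets_subset measurable_sets)

lemma sets_sigma_of_singleton:
  "sets (sigma_of M X {m}) = {X m -` A \<inter> space M | A. A \<in> sets borel}"
proof -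
  have "sets (sigma_of M X {m}) = sets (vimage_algebra (space M) (X m) borel)"
    unfolding sets_sigma_of sets_vimage_algebra by (rule arg_cong[where f="sigma_sets _"]) auto
  then show ?thesis by (simp add: sets_vimage_algebra2)
qed

section \<open>The Markov property for events of the whole future\<close>

text \<open>The process is tied to a kernel chosen in advance: \<open>pair_law\<close> says that one
  step follows K. Stationarity is present in that \<open>law\<close> and \<open>pair_law\<close>
  hold with the same L and K at all times; the Markov property is given for a single step and
  extended below.\<close>

locale kernel_chain = prob_space N for N :: "'b measure" +
  fixes Y :: "int \<Rightarrow> 'b \<Rightarrow> real" and L :: "real measure" and K :: "real \<Rightarrow> real measure"
  assumes Y_meas: "\<And>i. Y i \<in> borel_measurable N"
    and markov: "markov_property N Y"
    and law: "\<And>i. distr N borel (Y i) = L"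
    and L_prob: "L \<in> space (prob_algebra borel)"
    and K_kernel: "prob_kernel K"
    and pair_law: "\<And>i A B. A \<in> sets borel \<Longrightarrow> B \<in> sets borel \<Longrightarrow>
      emeasure N (Y i -` A \<inter> Y (i + 1) -` B \<inter> space N) = (\<integral>\<^sup>+x\<in>A. emeasure (K x) B \<partial>L)"
begin

declare Y_meas [measurable]

abbreviation "past m \<equiv> sigma_of N Y {..m}"

lemma subalg_past: "subalgebra N (past m)" and subalg_sigma: "subalgebra N (sigma_of N Y I)"
  by (intro subalgebra_sigma_of Y_meas)+

lemma sets_pastD: "E \<in> sets (past m) \<Longrightarrow> E \<in> sets N"
  using subalg_past[of m] by (auto simp: subalgebra_def)

lemma past_mono: "E \<in> sets (past m) \<Longrightarrow> m \<le> m' \<Longrightarrow> E \<in> sets (past m')"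
  using sigma_of_mono[of "{..m}" "{..m'}" N Y] by auto

lemma measure_kernel_measurable: "A \<in> sets borel \<Longrightarrow> (\<lambda>x. measure (K x) A) \<in> borel_measurable borel"
  by (rule measurable_compose[OF K_kernel measurable_measure_prob_algebra])

lemma kernel_01: "0 \<le> measure (K x) A" "measure (K x) A \<le> 1"
  using prob_space.prob_le_1[OF prob_algebraD(1)[OF prob_kernelD[OF K_kernel]]] by auto

lemma kernel_emeasure: "emeasure (K x) A = ennreal (measure (K x) A)"
  using prob_space.finite_measure[OF prob_algebraD(1)[OF prob_kernelD[OF K_kernel]]]
  by (rule finite_measure.emeasure_eq_measure)

text \<open>Events of \<open>sigma_of N Y {m}\<close> are preimages under \<open>Y m\<close>, so the
  averaging identity that characterizes a conditional expectation reduces to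
  \<open>pair_law\<close>.\<close>

lemma cond_exp_present:
  assumes A [measurable]: "A \<in> sets borel"
  shows "AE \<omega> in N. cond_prob_given N (sigma_of N Y {m}) (Y (m + 1) -` A \<inter> space N) \<omega> = measure (K (Y m \<omega>)) A"
proof -
  interpret finite_measure_subalgebra N "sigma_of N Y {m}"
    by unfold_locales (rule subalg_sigma)
  have [measurable]: "(\<lambda>x. measure (K x) A) \<in> borel_measurable borel" by (rule measure_kernel_measurable[OF A])
  show ?thesis
    unfolding cond_prob_given_def
  proof (rule real_cond_exp_charact)
    fix E assume "E \<in> sets (sigma_of N Y {m})"
    then obtain B where [measurable]: "B \<in> sets borel" and E: "E = Y m -` B \<inter> space N"
      by (auto simp: sets_sigma_of_singleton)
    have [measurable]: "E \<in> sets N" unfolding E by measurable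
    have "ennreal (\<integral>\<omega>\<in>E. measure (K (Y m \<omega>)) A \<partial>N) = (\<integral>\<^sup>+\<omega>. ennreal (indicator E \<omega> * measure (K (Y m \<omega>)) A) \<partial>N)"
      unfolding set_lebesgue_integral_def real_scaleR_def using kernel_01
      by (intro nn_integral_eq_integral[symmetric] integrable_bounded[of _ _ 1] prob_space_axioms)
        (auto simp: indicator_def)
    also have "\<dots> = (\<integral>\<^sup>+\<omega>. emeasure (K (Y m \<omega>)) A * indicator B (Y m \<omega>) \<partial>N)"
      by (intro nn_integral_cong) (auto simp: E kernel_emeasure indicator_def)
    also have "\<dots> = (\<integral>\<^sup>+x\<in>B. emeasure (K x) A \<partial>L)"
      unfolding law[of m, symmetric]
      by (subst nn_integral_distr) (auto simp: kernel_emeasure)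
    also have "\<dots> = emeasure N (E \<inter> (Y (m + 1) -` A \<inter> space N))"
      by (subst pair_law[symmetric]) (auto simp: E intro!: arg_cong[where f="emeasure N"])
    also have "\<dots> = ennreal (\<integral>\<omega>\<in>E. indicator (Y (m + 1) -` A \<inter> space N) \<omega> \<partial>N)"
      unfolding set_lebesgue_integral_def real_scaleR_def by (simp add: indicator_inter_arith[symmetric] emeasure_eq_measure)
    finally show "(\<integral>\<omega>\<in>E. indicator (Y (m + 1) -` A \<inter> space N) \<omega> \<partial>N) = (\<integral>\<omega>\<in>E. measure (K (Y m \<omega>)) A \<partial>N)"
      using kernel_01 by (subst (asm) ennreal_inj)
        (auto simp: set_lebesgue_integral_def intro!: Bochner_Integration.integral_nonneg)
  next
    show "integrable N (indicat_real (Y (m + 1) -` A \<inter> space N))" by (intro integrable_real_indicator) (auto simp: less_top[symmetric])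
    show "integrable N (\<lambda>\<omega>. measure (K (Y m \<omega>)) A)"
      using kernel_01 by (intro integrable_bounded[of _ _ 1] prob_space_axioms) auto
    show "(\<lambda>\<omega>. measure (K (Y m \<omega>)) A) \<in> borel_measurable (sigma_of N Y {m})"
      by (rule measurable_compose[OF measurable_sigma_of]) auto
  qed
qed

text \<open>For fixed E both sides integrate g, one against the law of the next state on E, the
  other against the K-image of the law of the present state on E. That these measures agree on sets
  is the Markov property.\<close>

lemma one_step:
  assumes E: "E \<in> sets (past m)" and g: "g \<in> borel_measurable borel"
  shows "(\<integral>\<^sup>+\<omega>\<in>E. g (Y (m + 1) \<omega>) \<partial>N) = (\<integral>\<^sup>+\<omega>\<in>E. (\<integral>\<^sup>+y. g y \<partial>K (Y m \<omega>)) \<partial>N)"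
proof -
  interpret finite_measure_subalgebra N "past m"
    by unfold_locales (rule subalg_past)
  have [measurable]: "E \<in> sets N" using E by (rule sets_pastD)
  note [measurable] = measurable_prob_algebraD[OF K_kernel]
  define \<mu> where "\<mu> = distr (density N (indicator E)) borel (Y (m + 1))"
  define \<nu> where "\<nu> = distr (density N (indicator E)) borel (Y m)"
  have sK: "sets (K x) = sets borel" for x by (rule prob_algebraD[OF prob_kernelD[OF K_kernel]])
  have "\<mu> = \<nu> \<bind> K"
  proof (rule measure_eqI)
    show "sets \<mu> = sets (\<nu> \<bind> K)" by (simp add: \<mu>_def \<nu>_def sets_bind[OF sK])
    fix A assume "A \<in> sets \<mu>"
    then have A [measurable]: "A \<in> sets borel" by (simp add: \<mu>_def)
    have [measurable]: "(\<lambda>x. measure (K x) A) \<in> borel_measurable borel" by (rule measure_kernel_measurable[OF A])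
    let ?B = "Y (m + 1) -` A \<inter> space N"
    have AEK: "AE \<omega> in N. real_cond_exp N (past m) (indicator ?B) \<omega> = measure (K (Y m \<omega>)) A"
      using markov[unfolded markov_property_def, rule_format, OF A, of m] cond_exp_present[OF A, of m]
      unfolding cond_prob_given_def by eventually_elim simp
    have "emeasure \<mu> A = emeasure N (E \<inter> ?B)"
      by (simp add: \<mu>_def emeasure_distr emeasure_density indicator_inter_arith[symmetric])
    also have "\<dots> = ennreal (\<integral>\<omega>\<in>E. indicator ?B \<omega> \<partial>N)"
      unfolding set_lebesgue_integral_def real_scaleR_def by (simp add: indicator_inter_arith[symmetric] emeasure_eq_measure)
    also have "(\<integral>\<omega>\<in>E. indicator ?B \<omega> \<partial>N) = (\<integral>\<omega>\<in>E. real_cond_exp N (past m) (indicator ?B) \<omega> \<partial>N)"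
      by (intro real_cond_exp_intA E integrable_real_indicator) (auto simp: less_top[symmetric])
    also have "\<dots> = (\<integral>\<omega>\<in>E. measure (K (Y m \<omega>)) A \<partial>N)"
      unfolding set_lebesgue_integral_def
    proof (rule integral_cong_AE)
      show "AE \<omega> in N. indicat_real E \<omega> *\<^sub>R real_cond_exp N (past m) (indicator ?B) \<omega> = indicat_real E \<omega> *\<^sub>R measure (K (Y m \<omega>)) A"
        using AEK by eventually_elim simp
    qed auto
    also have "ennreal \<dots> = (\<integral>\<^sup>+\<omega>. ennreal (indicator E \<omega> * measure (K (Y m \<omega>)) A) \<partial>N)"
      unfolding set_lebesgue_integral_def real_scaleR_def using kernel_01
      by (intro nn_integral_eq_integral[symmetric] integrable_bounded[of _ _ 1] prob_space_axioms)
        (auto simp: indicator_def)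
    also have "\<dots> = (\<integral>\<^sup>+\<omega>. indicator E \<omega> * emeasure (K (Y m \<omega>)) A \<partial>N)"
      by (intro nn_integral_cong) (auto simp: kernel_emeasure indicator_def)
    also have "\<dots> = (\<integral>\<^sup>+\<omega>. emeasure (K (Y m \<omega>)) A \<partial>density N (indicator E))"
      by (subst nn_integral_density) (auto simp: kernel_emeasure)
    also have "\<dots> = (\<integral>\<^sup>+x. emeasure (K x) A \<partial>\<nu>)"
      unfolding \<nu>_def by (subst nn_integral_distr) (auto simp: kernel_emeasure)
    also have "\<dots> = emeasure (\<nu> \<bind> K) A"
      by (rule emeasure_bind[symmetric, of _ _ borel]) (auto simp: \<nu>_def)
    finally show "emeasure \<mu> A = emeasure (\<nu> \<bind> K) A" .
  qed
  then have "(\<integral>\<^sup>+x. g x \<partial>\<mu>) = (\<integral>\<^sup>+x. \<integral>\<^sup>+y. g y \<partial>K x \<partial>\<nu>)"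
    using g by (simp add: nn_integral_bind[of g borel K] \<nu>_def)
  moreover have "(\<integral>\<^sup>+x. f x \<partial>distr (density N (indicator E)) borel (Y i)) = (\<integral>\<^sup>+\<omega>\<in>E. f (Y i \<omega>) \<partial>N)"
    if [measurable]: "f \<in> borel_measurable borel" for f i
    by (simp add: nn_integral_distr nn_integral_density mult.commute)
  moreover have "(\<lambda>x. \<integral>\<^sup>+y. g y \<partial>K x) \<in> borel_measurable borel"
    using g by (intro measurable_compose[OF measurable_prob_algebraD[OF K_kernel] nn_integral_measurable_subprob_algebra])
  ultimately show ?thesis using g by (simp add: \<mu>_def \<nu>_def)
qed

text \<open>An event of the past of m belongs to the past of m + 1 as well, so E is kept while the
  induction shifts the starting time.\<close>

lemma n_step:
  assumes E: "E \<in> sets (past m)" and g: "g \<in> borel_measurable borel"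
  shows "(\<integral>\<^sup>+\<omega>\<in>E. g (Y (m + int n) \<omega>) \<partial>N) = (\<integral>\<^sup>+\<omega>\<in>E. (\<integral>\<^sup>+y. g y \<partial>kpow K n (Y m \<omega>)) \<partial>N)"
  using E
proof (induction n arbitrary: m)
  case 0
  then show ?case using g by (simp add: nn_integral_return)
next
  case (Suc n)
  note Kn = prob_kernel_kpow[OF K_kernel, of n]
  have "(\<integral>\<^sup>+\<omega>\<in>E. g (Y (m + int (Suc n)) \<omega>) \<partial>N) = (\<integral>\<^sup>+\<omega>\<in>E. g (Y ((m + 1) + int n) \<omega>) \<partial>N)"
    by (simp add: ac_simps)
  also have "\<dots> = (\<integral>\<^sup>+\<omega>\<in>E. (\<integral>\<^sup>+y. g y \<partial>kpow K n (Y (m + 1) \<omega>)) \<partial>N)"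
    by (rule Suc.IH[OF past_mono[OF Suc.prems]]) simp
  also have "\<dots> = (\<integral>\<^sup>+\<omega>\<in>E. (\<integral>\<^sup>+x. \<integral>\<^sup>+y. g y \<partial>kpow K n x \<partial>K (Y m \<omega>)) \<partial>N)"
    using g by (intro one_step[OF Suc.prems] measurable_compose[OF measurable_prob_algebraD[OF Kn] nn_integral_measurable_subprob_algebra])
  also have "\<dots> = (\<integral>\<^sup>+\<omega>\<in>E. (\<integral>\<^sup>+y. g y \<partial>kpow K (Suc n) (Y m \<omega>)) \<partial>N)"
    by (simp add: nn_integral_bind_prob[OF prob_kernelD[OF K_kernel] Kn g])
  finally show ?case .
qed

definition cylinder :: "int \<Rightarrow> nat \<Rightarrow> (nat \<Rightarrow> real set) \<Rightarrow> 'b set" where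
  "cylinder n k A = {\<omega> \<in> space N. \<forall>i<k. Y (n + int i) \<omega> \<in> A i}"

lemma sets_cylinder [measurable]:
  assumes [measurable]: "\<And>i. A i \<in> sets borel"
  shows "cylinder n k A \<in> sets N"
  unfolding cylinder_def by measurable

text \<open>Here b is the conditional probability of the cylinder given the present state, built
  backwards from the last time: the present coordinate contributes an indicator, the rest is
  averaged by K. Letting E range over the past encodes conditioning on it.\<close>

lemma cylinder_cond:
  assumes "\<And>i. A i \<in> sets borel"
  shows "\<exists>b\<in>borel_measurable borel. (\<forall>x. b x \<le> 1) \<and>
    (\<forall>E\<in>sets (past n). emeasure N (E \<inter> cylinder n k A) = (\<integral>\<^sup>+\<omega>\<in>E. b (Y n \<omega>) \<partial>N))"
  using assms
proof (induction k arbitrary: n A)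
  case 0
  have "E \<inter> cylinder n 0 A = E" if "E \<in> sets (past n)" for E
    using sets.sets_into_space[OF sets_pastD[OF that]] by (auto simp: cylinder_def)
  then have 1: "emeasure N (E \<inter> cylinder n 0 A) = (\<integral>\<^sup>+\<omega>\<in>E. 1 \<partial>N)" if "E \<in> sets (past n)" for E
    using nn_integral_indicator[OF sets_pastD[OF that]] that by simp
  show ?case
  proof (intro bexI[of _ "\<lambda>_. 1"] conjI allI ballI)
    fix E assume "E \<in> sets (past n)"
    then show "emeasure N (E \<inter> cylinder n 0 A) = (\<integral>\<^sup>+\<omega>\<in>E. 1 \<partial>N)" by (rule 1)
  qed simp_all
next
  case (Suc k)
  have A0 [measurable]: "A 0 \<in> sets borel" by (rule Suc.prems)
  have "\<exists>b\<in>borel_measurable borel. (\<forall>x. b x \<le> 1) \<and> (\<forall>E\<in>sets (past (n + 1)).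
      emeasure N (E \<inter> cylinder (n + 1) k (\<lambda>i. A (Suc i))) = (\<integral>\<^sup>+\<omega>\<in>E. b (Y (n + 1) \<omega>) \<partial>N))"
    by (rule Suc.IH) (rule Suc.prems)
  then obtain b
    where b [measurable]: "b \<in> borel_measurable borel" and b1: "\<And>x. b x \<le> 1"
      and b_eq: "\<And>E. E \<in> sets (past (n + 1)) \<Longrightarrow>
        emeasure N (E \<inter> cylinder (n + 1) k (\<lambda>i. A (Suc i))) = (\<integral>\<^sup>+\<omega>\<in>E. b (Y (n + 1) \<omega>) \<partial>N)"
    by blast
  define b' where "b' x = indicator (A 0) x * (\<integral>\<^sup>+y. b y \<partial>K x)" for x
  have [measurable]: "(\<lambda>x. \<integral>\<^sup>+y. b y \<partial>K x) \<in> borel_measurable borel"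
    by (intro measurable_compose[OF measurable_prob_algebraD[OF K_kernel] nn_integral_measurable_subprob_algebra] b)
  show ?case
  proof (intro bexI[of _ b'] conjI allI ballI)
    show "b' \<in> borel_measurable borel" unfolding b'_def[abs_def] by measurable
    show "b' x \<le> 1" for x
    proof -
      have "(\<integral>\<^sup>+y. b y \<partial>K x) \<le> (\<integral>\<^sup>+y. 1 \<partial>K x)" by (intro nn_integral_mono b1)
      then show ?thesis
        using prob_space.emeasure_space_1[OF prob_algebraD(1)[OF prob_kernelD[OF K_kernel]], of x]
        by (auto simp: b'_def indicator_def)
    qed
    fix E assume E: "E \<in> sets (past n)"
    let ?E = "E \<inter> (Y n -` A 0 \<inter> space N)"
    have "Y n -` A 0 \<inter> space (past n) \<in> sets (past n)"
      by (intro measurable_sets[OF measurable_sigma_of]) auto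
    then have E': "?E \<in> sets (past n)" using E by (auto simp: space_sigma_of)
    have "E \<inter> cylinder n (Suc k) A = ?E \<inter> cylinder (n + 1) k (\<lambda>i. A (Suc i))"
      using sets.sets_into_space[OF sets_pastD[OF E]]
      by (auto simp: cylinder_def All_less_Suc2 add.assoc)
    then have "emeasure N (E \<inter> cylinder n (Suc k) A) = (\<integral>\<^sup>+\<omega>\<in>?E. b (Y (n + 1) \<omega>) \<partial>N)"
      using b_eq[OF past_mono[OF E']] by simp
    also have "\<dots> = (\<integral>\<^sup>+\<omega>\<in>?E. (\<integral>\<^sup>+y. b y \<partial>K (Y n \<omega>)) \<partial>N)"
      by (rule one_step[OF E' b])
    also have "\<dots> = (\<integral>\<^sup>+\<omega>\<in>E. b' (Y n \<omega>) \<partial>N)"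
      by (intro nn_integral_cong) (auto simp: b'_def indicator_def)
    finally show "emeasure N (E \<inter> cylinder n (Suc k) A) = (\<integral>\<^sup>+\<omega>\<in>E. b' (Y n \<omega>) \<partial>N)" .
  qed
qed

text \<open>Dynkin's argument: cylinders form an intersection-stable generator of the future, and
  the property passes to complements and disjoint unions.\<close>

lemma future_cond:
  assumes "B \<in> sets (sigma_of N Y {n..})"
  shows "\<exists>b\<in>borel_measurable borel. (\<forall>x. b x \<le> 1) \<and>
    (\<forall>E\<in>sets (past n). emeasure N (E \<inter> B) = (\<integral>\<^sup>+\<omega>\<in>E. b (Y n \<omega>) \<partial>N))" (is "?P B")
proof -
  define G where "G = {cylinder n k A | k A. \<forall>i. A i \<in> sets borel}"
  have B_in: "B \<in> sigma_sets (space N) G"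
  proof -
    have "{Y i -` A \<inter> space N | i A. i \<in> {n..} \<and> A \<in> sets borel} \<subseteq> G"
    proof
      fix S assume "S \<in> {Y i -` A \<inter> space N | i A. i \<in> {n..} \<and> A \<in> sets borel}"
      then obtain i A where S: "S = Y i -` A \<inter> space N" and i: "i \<in> {n..}" and A: "A \<in> sets borel" by blast
      \<comment> \<open>A condition at one single time becomes a cylinder by leaving the other
        coordinates of the window free.\<close>
      define A' where "A' j = (if n + int j = i then A else UNIV)" for j
      have "Y i -` A \<inter> space N = cylinder n (Suc (nat (i - n))) A'"
      proof -
        have "(\<forall>j<Suc (nat (i - n)). Y (n + int j) \<omega> \<in> A' j) \<longleftrightarrow> Y i \<omega> \<in> A" for \<omega>
        proof
          assume "\<forall>j<Suc (nat (i - n)). Y (n + int j) \<omega> \<in> A' j"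
          then have "Y (n + int (nat (i - n))) \<omega> \<in> A' (nat (i - n))" by blast
          then show "Y i \<omega> \<in> A" using i by (simp add: A'_def)
        qed (auto simp: A'_def)
        then show ?thesis by (auto simp: cylinder_def)
      qed
      then show "S \<in> G" using A
        unfolding S G_def by (intro CollectI exI[of _ "Suc (nat (i - n))"] exI[of _ A'] conjI) (auto simp: A'_def)
    qed
    then show ?thesis using assms sigma_sets_mono'[of _ G "space N"] by (auto simp: sets_sigma_of)
  qed
  have stable: "Int_stable G"
  proof (rule Int_stableI)
    fix a b assume "a \<in> G" "b \<in> G"
    then obtain k A l B where a: "a = cylinder n k A" "\<And>i. A i \<in> sets borel"
      and b: "b = cylinder n l B" "\<And>i. B i \<in> sets borel" by (auto simp: G_def)
    define A' where "A' i = (if i < k then A i else UNIV) \<inter> (if i < l then B i else UNIV)" for i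
    have iff: "(\<forall>i<max k l. y i \<in> A' i) \<longleftrightarrow> (\<forall>i<k. y i \<in> A i) \<and> (\<forall>i<l. y i \<in> B i)" for y :: "nat \<Rightarrow> real"
      unfolding A'_def less_max_iff_disj by (auto split: if_splits)
    have eq: "a \<inter> b = cylinder n (max k l) A'"
    proof (rule set_eqI)
      fix \<omega>
      show "\<omega> \<in> a \<inter> b \<longleftrightarrow> \<omega> \<in> cylinder n (max k l) A'"
        unfolding a(1) b(1) cylinder_def using iff[of "\<lambda>i. Y (n + int i) \<omega>"]
        by (simp only: Int_iff mem_Collect_eq) blast
    qed
    have A': "A' i \<in> sets borel" for i using a(2) b(2) by (simp add: A'_def)
    show "a \<inter> b \<in> G"
      unfolding G_def by (rule CollectI, rule exI[of _ "max k l"], rule exI[of _ A'], rule conjI[OF eq], rule allI, rule A')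
  qed
  have G_Pow: "G \<subseteq> Pow (space N)" by (auto simp: G_def cylinder_def)
  have G_sets: "sigma_sets (space N) G \<subseteq> sets N"
    by (intro sets.sigma_sets_subset) (auto simp: G_def)
  from stable G_Pow B_in show ?thesis
  proof (induction rule: sigma_sets_induct_disjoint)
    case (basic B)
    then show ?case using cylinder_cond unfolding G_def by blast
  next
    case empty
    show ?case by (intro bexI[of _ "\<lambda>_. 0"]) auto
  next
    case (compl B)
    then obtain b where b [measurable]: "b \<in> borel_measurable borel" and b1: "\<And>x. b x \<le> 1"
      and b_eq: "\<And>E. E \<in> sets (past n) \<Longrightarrow> emeasure N (E \<inter> B) = (\<integral>\<^sup>+\<omega>\<in>E. b (Y n \<omega>) \<partial>N)" by blast
    have [measurable]: "B \<in> sets N" using compl G_sets by auto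
    show ?case
    proof (intro bexI[of _ "\<lambda>x. 1 - b x"] conjI allI ballI)
      show "1 - b x \<le> 1" for x by (rule diff_le_self_ennreal)
      fix E assume E: "E \<in> sets (past n)"
      have [measurable]: "E \<in> sets N" using E by (rule sets_pastD)
      have "(\<integral>\<^sup>+\<omega>\<in>E. (1 - b (Y n \<omega>)) \<partial>N) = (\<integral>\<^sup>+\<omega>. indicator E \<omega> - b (Y n \<omega>) * indicator E \<omega> \<partial>N)"
        by (intro nn_integral_cong) (auto simp: indicator_def)
      also have "\<dots> = (\<integral>\<^sup>+\<omega>. indicator E \<omega> \<partial>N) - (\<integral>\<^sup>+\<omega>\<in>E. b (Y n \<omega>) \<partial>N)"
      proof (rule nn_integral_diff)
        show "(\<integral>\<^sup>+\<omega>\<in>E. b (Y n \<omega>) \<partial>N) \<noteq> \<infinity>" by (simp add: b_eq[OF E, symmetric])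
        show "AE \<omega> in N. b (Y n \<omega>) * indicator E \<omega> \<le> indicator E \<omega>"
          by (intro AE_I2) (auto simp: indicator_def b1)
      qed auto
      also have "\<dots> = emeasure N E - emeasure N (E \<inter> B)" by (simp add: b_eq[OF E])
      also have "\<dots> = emeasure N (E - (E \<inter> B))"
        by (intro emeasure_Diff[symmetric]) auto
      also have "E - (E \<inter> B) = E \<inter> (space N - B)"
        using sets.sets_into_space[OF sets_pastD[OF E]] by auto
      finally show "emeasure N (E \<inter> (space N - B)) = (\<integral>\<^sup>+\<omega>\<in>E. (1 - b (Y n \<omega>)) \<partial>N)" ..
    qed auto
  next
    case (union B)
    then have "\<forall>i. \<exists>b. b \<in> borel_measurable borel \<and>
        (\<forall>E\<in>sets (past n). emeasure N (E \<inter> B i) = (\<integral>\<^sup>+\<omega>\<in>E. b (Y n \<omega>) \<partial>N))" by blast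
    then obtain b :: "nat \<Rightarrow> real \<Rightarrow> ennreal" where b [measurable]: "\<And>i. b i \<in> borel_measurable borel"
      and b_eq: "\<And>i E. E \<in> sets (past n) \<Longrightarrow> emeasure N (E \<inter> B i) = (\<integral>\<^sup>+\<omega>\<in>E. b i (Y n \<omega>) \<partial>N)" by metis
    have B [measurable]: "B i \<in> sets N" for i using union(2) G_sets by blast
    define c where "c x = (\<Sum>i. b i x)" for x
    have c_meas [measurable]: "c \<in> borel_measurable borel" unfolding c_def[abs_def] by measurable
    have c_eq: "emeasure N (E \<inter> (\<Union>i. B i)) = (\<integral>\<^sup>+\<omega>\<in>E. c (Y n \<omega>) \<partial>N)" if E: "E \<in> sets (past n)" for E
    proof -
      have [measurable]: "E \<in> sets N" using E by (rule sets_pastD)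
      have "emeasure N (E \<inter> (\<Union>i. B i)) = emeasure N (\<Union>i. E \<inter> B i)" by (auto intro!: arg_cong[where f="emeasure N"])
      also have "\<dots> = (\<Sum>i. emeasure N (E \<inter> B i))"
        using union(1) by (intro suminf_emeasure[symmetric]) (auto simp: disjoint_family_on_def)
      also have "\<dots> = (\<Sum>i. \<integral>\<^sup>+\<omega>\<in>E. b i (Y n \<omega>) \<partial>N)" by (simp add: b_eq[OF E])
      also have "\<dots> = (\<integral>\<^sup>+\<omega>. (\<Sum>i. b i (Y n \<omega>) * indicator E \<omega>) \<partial>N)"
        by (rule nn_integral_suminf[symmetric]) auto
      finally show ?thesis by (simp add: c_def)
    qed
    \<comment> \<open>The sum of the chosen versions may exceed 1 somewhere, but not with positive
      probability along \<open>Y n\<close>: on that event its integral would exceed the probability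
      of the event.\<close>
    have c_le: "AE \<omega> in N. c (Y n \<omega>) \<le> 1"
    proof -
      have sp: "space N \<in> sets (past n)" using sets.top[of "past n"] by (simp add: space_sigma_of)
      define E where "E = {\<omega>\<in>space N. 1 < c (Y n \<omega>)}"
      have E: "E \<in> sets (past n)"
      proof -
        have "Y n -` {x. 1 < c x} \<inter> space (past n) \<in> sets (past n)"
          by (intro measurable_sets[OF measurable_sigma_of]) auto
        moreover have "Y n -` {x. 1 < c x} \<inter> space (past n) = E" by (auto simp: E_def space_sigma_of)
        ultimately show ?thesis by simp
      qed
      have [measurable]: "E \<in> sets N" using E by (rule sets_pastD)
      have "(\<integral>\<^sup>+\<omega>\<in>E. c (Y n \<omega>) \<partial>N) \<le> emeasure N E"
        unfolding c_eq[OF E, symmetric] by (intro emeasure_mono) auto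
      then have le: "(\<integral>\<^sup>+\<omega>\<in>E. c (Y n \<omega>) \<partial>N) \<le> (\<integral>\<^sup>+\<omega>. indicator E \<omega> \<partial>N)" by simp
      have "AE \<omega> in N. c (Y n \<omega>) * indicator E \<omega> \<le> indicator E \<omega>"
      proof (rule ccontr)
        assume neg: "\<not> ?thesis"
        have "(\<integral>\<^sup>+\<omega>. indicator E \<omega> \<partial>N) \<noteq> \<infinity>" by simp
        moreover have "AE \<omega> in N. indicator E \<omega> \<le> c (Y n \<omega>) * indicator E \<omega>"
          by (intro AE_I2) (auto simp: E_def indicator_def)
        ultimately have "(\<integral>\<^sup>+\<omega>. indicator E \<omega> \<partial>N) < (\<integral>\<^sup>+\<omega>\<in>E. c (Y n \<omega>) \<partial>N)"
          using neg by (rule nn_integral_less[rotated 2]) measurable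
        with le show False by (meson not_less)
      qed
      with AE_space show ?thesis
      proof eventually_elim
        case (elim \<omega>)
        then show ?case by (cases "1 < c (Y n \<omega>)") (auto simp: E_def)
      qed
    qed
    \<comment> \<open>Cutting at 1 restores the pointwise bound without changing any of the
      integrals.\<close>
    show ?case
    proof (intro bexI[of _ "\<lambda>x. min 1 (c x)"] conjI allI ballI)
      fix E assume E: "E \<in> sets (past n)"
      have "(\<integral>\<^sup>+\<omega>\<in>E. c (Y n \<omega>) \<partial>N) = (\<integral>\<^sup>+\<omega>\<in>E. min 1 (c (Y n \<omega>)) \<partial>N)"
      proof (rule nn_integral_cong_AE)
        show "AE \<omega> in N. c (Y n \<omega>) * indicator E \<omega> = min 1 (c (Y n \<omega>)) * indicator E \<omega>"
          using c_le by eventually_elim (simp add: min_absorb2)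
      qed
      then show "emeasure N (E \<inter> (\<Union>i. B i)) = (\<integral>\<^sup>+\<omega>\<in>E. min 1 (c (Y n \<omega>)) \<partial>N)"
        by (simp add: c_eq[OF E])
    qed auto
  qed
qed

lemma kpow_integral_measurable:
  fixes f :: "real \<Rightarrow> real"
  assumes "f \<in> borel_measurable borel"
  shows "(\<lambda>x. \<integral>y. f y \<partial>kpow K n x) \<in> borel_measurable borel"
  by (rule measurable_compose[OF measurable_prob_algebraD[OF prob_kernel_kpow[OF K_kernel]]
        integral_measurable_subprob_algebra[OF assms]])

lemma kpow_integral_01:
  fixes f :: "real \<Rightarrow> real"
  assumes [measurable]: "f \<in> borel_measurable borel" and f: "\<And>x. 0 \<le> f x" "\<And>x. f x \<le> 1"
  shows "0 \<le> (\<integral>y. f y \<partial>kpow K n x)" "(\<integral>y. f y \<partial>kpow K n x) \<le> 1"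
    "(\<integral>\<^sup>+y. ennreal (f y) \<partial>kpow K n x) = ennreal (\<integral>y. f y \<partial>kpow K n x)"
proof -
  note Knx = prob_kernelD[OF prob_kernel_kpow[OF K_kernel, of n], of x]
  interpret Kn: prob_space "kpow K n x" by (rule prob_algebraD[OF Knx])
  have [measurable_cong]: "sets (kpow K n x) = sets borel" by (rule prob_algebraD[OF Knx])
  have i: "integrable (kpow K n x) f" using f by (intro integrable_bounded[of _ _ 1] Kn.prob_space_axioms) auto
  show "0 \<le> (\<integral>y. f y \<partial>kpow K n x)" using f by (intro Bochner_Integration.integral_nonneg) auto
  have "(\<integral>y. f y \<partial>kpow K n x) \<le> (\<integral>y. 1 \<partial>kpow K n x)" using f by (intro integral_mono i) auto
  then show "(\<integral>y. f y \<partial>kpow K n x) \<le> 1" by (simp add: Kn.prob_space)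
  show "(\<integral>\<^sup>+y. ennreal (f y) \<partial>kpow K n x) = ennreal (\<integral>y. f y \<partial>kpow K n x)"
    using f by (intro nn_integral_eq_integral i) auto
qed

text \<open>Conditioning at time n gives b of the state there, and \<open>n_step\<close> carries
  this back to time 0: the tower property in integrated form. With E the whole space it evaluates
  the probability of B.\<close>

lemma cond_prob_future:
  assumes b [measurable]: "b \<in> borel_measurable borel" and b01: "\<And>x. 0 \<le> b x" "\<And>x. b x \<le> 1"
    and B [measurable]: "B \<in> sets N"
    and b_eq: "\<And>E. E \<in> sets (past (int n)) \<Longrightarrow> emeasure N (E \<inter> B) = (\<integral>\<^sup>+\<omega>\<in>E. ennreal (b (Y (int n) \<omega>)) \<partial>N)"
  shows "AE \<omega> in N. cond_prob_given N (past 0) B \<omega> = (\<integral>y. b y \<partial>kpow K n (Y 0 \<omega>))"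
    and "measure N B = (\<integral>x. \<integral>y. b y \<partial>kpow K n x \<partial>L)"
proof -
  interpret finite_measure_subalgebra N "past 0"
    by unfold_locales (rule subalg_past)
  define h where "h x = (\<integral>y. b y \<partial>kpow K n x)" for x
  have [measurable]: "h \<in> borel_measurable borel" unfolding h_def[abs_def] by (rule kpow_integral_measurable[OF b])
  have h01: "0 \<le> h x" "h x \<le> 1" for x unfolding h_def by (rule kpow_integral_01[OF b b01])+
  have i: "integrable N (\<lambda>\<omega>. indicat_real E \<omega> * h (Y 0 \<omega>))" if [measurable]: "E \<in> sets N" for E
    using h01 by (intro integrable_bounded[of _ _ 1] prob_space_axioms) (auto simp: indicator_def)
  have main: "measure N (E \<inter> B) = (\<integral>\<omega>. indicator E \<omega> * h (Y 0 \<omega>) \<partial>N)" if E: "E \<in> sets (past 0)" for E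
  proof -
    have [measurable]: "E \<in> sets N" using E by (rule sets_pastD)
    have "emeasure N (E \<inter> B) = (\<integral>\<^sup>+\<omega>\<in>E. ennreal (b (Y (0 + int n) \<omega>)) \<partial>N)"
      using b_eq[OF past_mono[OF E]] by simp
    also have "\<dots> = (\<integral>\<^sup>+\<omega>\<in>E. (\<integral>\<^sup>+y. ennreal (b y) \<partial>kpow K n (Y 0 \<omega>)) \<partial>N)"
      by (rule n_step[OF E]) simp
    also have "\<dots> = (\<integral>\<^sup>+\<omega>. ennreal (indicator E \<omega> * h (Y 0 \<omega>)) \<partial>N)"
      by (intro nn_integral_cong) (simp add: kpow_integral_01(3)[OF b b01] h_def indicator_def)
    also have "\<dots> = ennreal (\<integral>\<omega>. indicator E \<omega> * h (Y 0 \<omega>) \<partial>N)"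
      using h01 by (intro nn_integral_eq_integral i) auto
    finally show ?thesis
      using h01 by (simp add: emeasure_eq_measure Bochner_Integration.integral_nonneg)
  qed
  show "AE \<omega> in N. cond_prob_given N (past 0) B \<omega> = (\<integral>y. b y \<partial>kpow K n (Y 0 \<omega>))"
    unfolding cond_prob_given_def h_def[symmetric]
  proof (rule real_cond_exp_charact)
    fix E assume E: "E \<in> sets (past 0)"
    have [measurable]: "E \<in> sets N" using E by (rule sets_pastD)
    show "(\<integral>\<omega>\<in>E. indicat_real B \<omega> \<partial>N) = (\<integral>\<omega>\<in>E. h (Y 0 \<omega>) \<partial>N)"
      using main[OF E] by (simp add: set_lebesgue_integral_def indicator_inter_arith[symmetric])
  next
    show "integrable N (indicat_real B)" by (intro integrable_real_indicator) (auto simp: less_top[symmetric])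
    show "integrable N (\<lambda>\<omega>. h (Y 0 \<omega>))"
      using h01 by (intro integrable_bounded[of _ _ 1] prob_space_axioms) auto
    show "(\<lambda>\<omega>. h (Y 0 \<omega>)) \<in> borel_measurable (past 0)"
      by (rule measurable_compose[OF measurable_sigma_of]) auto
  qed
  have "space N \<in> sets (past 0)" using sets.top[of "past 0"] by (simp add: space_sigma_of)
  from main[OF this] have "measure N B = (\<integral>\<omega>. indicator (space N) \<omega> * h (Y 0 \<omega>) \<partial>N)"
    using sets.sets_into_space[OF B] by (simp add: Int_absorb1)
  also have "\<dots> = (\<integral>\<omega>. h (Y 0 \<omega>) \<partial>N)" by (intro Bochner_Integration.integral_cong) auto
  also have "\<dots> = (\<integral>x. h x \<partial>L)" unfolding law[of 0, symmetric] by (subst integral_distr) auto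
  finally show "measure N B = (\<integral>x. \<integral>y. b y \<partial>kpow K n x \<partial>L)" by (simp add: h_def)
qed

lemma future_cond_prob:
  assumes "B \<in> sets (sigma_of N Y {int n..})"
  obtains b :: "real \<Rightarrow> real" where "b \<in> borel_measurable borel" "\<And>x. 0 \<le> b x" "\<And>x. b x \<le> 1"
    "AE \<omega> in N. cond_prob_given N (past 0) B \<omega> = (\<integral>y. b y \<partial>kpow K n (Y 0 \<omega>))"
    "measure N B = (\<integral>x. \<integral>y. b y \<partial>kpow K n x \<partial>L)"
proof -
  from future_cond[OF assms] obtain c where c [measurable]: "c \<in> borel_measurable borel" and c1: "\<And>x. c x \<le> 1"
    and c_eq: "\<And>E. E \<in> sets (past (int n)) \<Longrightarrow> emeasure N (E \<inter> B) = (\<integral>\<^sup>+\<omega>\<in>E. c (Y (int n) \<omega>) \<partial>N)"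
    by blast
  define b where "b x = enn2real (c x)" for x
  have cb: "ennreal (b x) = c x" for x
    unfolding b_def using c1[of x] by (intro ennreal_enn2real) (auto intro: le_less_trans)
  have b: "b \<in> borel_measurable borel" unfolding b_def[abs_def] by measurable
  have b01: "0 \<le> b x" "b x \<le> 1" for x
    using enn2real_mono[OF c1[of x]] by (auto simp: b_def)
  have B: "B \<in> sets N" using assms subalg_sigma[of "{int n..}"] by (auto simp: subalgebra_def)
  have "AE \<omega> in N. cond_prob_given N (past 0) B \<omega> = (\<integral>y. b y \<partial>kpow K n (Y 0 \<omega>))"
    "measure N B = (\<integral>x. \<integral>y. b y \<partial>kpow K n x \<partial>L)"
    using cond_prob_future[OF b b01 B, of n] c_eq by (auto simp: cb)
  with b b01 show ?thesis by (intro that)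
qed

section \<open>Two-sided bounds for the mixing coefficient\<close>

text \<open>The \<open>SOME\<close> in \<open>beta_coeff\<close> is thereby known to pick a genuine
  essential supremum. Its majorant property yields the lower bound on the coefficient, its
  minimality the upper one.\<close>

lemma beta_ess_sup:
  obtains Z where "beta_mix N Y n = (\<integral>\<omega>. Z \<omega> \<partial>N)"
    "is_ess_sup N (sets (sigma_of N Y {int n..})) (\<lambda>B \<omega>. \<bar>cond_prob_given N (past 0) B \<omega> - measure N B\<bar>) Z"
proof -
  let ?f = "\<lambda>B \<omega>. \<bar>cond_prob_given N (past 0) B \<omega> - measure N B\<bar>"
  let ?G = "sigma_of N Y {int n..}"
  have "\<exists>Z. is_ess_sup N (sets ?G) ?f Z"
  proof (rule ess_sup_exists[OF prob_space_axioms])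
    show "sets ?G \<noteq> {}" using sets.empty_sets[of ?G] by blast
    fix B assume B: "B \<in> sets ?G"
    show "?f B \<in> borel_measurable N" unfolding cond_prob_given_def by measurable
    from B obtain b :: "real \<Rightarrow> real" where b: "b \<in> borel_measurable borel" "\<And>x. 0 \<le> b x" "\<And>x. b x \<le> 1"
      and ae: "AE \<omega> in N. cond_prob_given N (past 0) B \<omega> = (\<integral>y. b y \<partial>kpow K n (Y 0 \<omega>))"
      by (rule future_cond_prob) blast
    show "AE \<omega> in N. 0 \<le> ?f B \<omega> \<and> ?f B \<omega> \<le> 1"
      using ae
    proof eventually_elim
      case (elim \<omega>)
      show ?case
        unfolding elim using kpow_integral_01(1,2)[OF b, of n "Y 0 \<omega>"] prob_le_1[of B] measure_nonneg[of N B]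
        by (intro conjI) linarith+
    qed
  qed
  then have "is_ess_sup N (sets ?G) ?f (SOME Z. is_ess_sup N (sets ?G) ?f Z)" by (rule someI_ex)
  moreover have "beta_mix N Y n = (\<integral>\<omega>. (SOME Z. is_ess_sup N (sets ?G) ?f Z) \<omega> \<partial>N)"
    by (simp add: beta_mix_def beta_coeff_def)
  ultimately show ?thesis by (rule that[rotated])
qed

text \<open>The probability of B is the L-average of its conditional probabilities, so their
  deviation is at most the mean distance between \<open>Y 0\<close> and an independent starting
  point, whatever B is. Minimality of the essential supremum transfers this bound to Z.\<close>

lemma beta_mix_le:
  "beta_mix N Y n \<le> (\<integral>z. tv (kpow K n (fst z)) (kpow K n (snd z)) \<partial>(L \<Otimes>\<^sub>M L))"
proof -
  obtain Z where Z: "beta_mix N Y n = (\<integral>\<omega>. Z \<omega> \<partial>N)"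
    "is_ess_sup N (sets (sigma_of N Y {int n..})) (\<lambda>B \<omega>. \<bar>cond_prob_given N (past 0) B \<omega> - measure N B\<bar>) Z"
    by (rule beta_ess_sup)
  note Kn = prob_kernel_kpow[OF K_kernel, of n]
  note Knx = prob_kernelD[OF Kn]
  interpret L: prob_space L by (rule prob_algebraD[OF L_prob])
  interpret LL: pair_prob_space L L ..
  have sL [measurable_cong]: "sets L = sets borel" by (rule prob_algebraD[OF L_prob])
  have [measurable]: "(\<lambda>z. tv (kpow K n (fst z)) (kpow K n (snd z))) \<in> borel_measurable (borel \<Otimes>\<^sub>M borel)"
    by (intro borel_measurable_tv measurable_compose[OF measurable_fst Kn] measurable_compose[OF measurable_snd Kn])
  have [measurable]: "(\<lambda>y. tv (kpow K n x) (kpow K n y)) \<in> borel_measurable borel" for x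
    by (intro borel_measurable_tv Kn measurable_const Knx)
  have t01: "0 \<le> tv (kpow K n x) (kpow K n y)" "tv (kpow K n x) (kpow K n y) \<le> 1" for x y
    by (intro tv_nonneg tv_le_1 Knx)+
  define H where "H x = (\<integral>y. tv (kpow K n x) (kpow K n y) \<partial>L)" for x
  have i_tv: "integrable L (\<lambda>y. tv (kpow K n x) (kpow K n y))" for x
    using t01 by (intro integrable_bounded[of _ _ 1] L.prob_space_axioms) auto
  have H01: "0 \<le> H x" "H x \<le> 1" for x
  proof -
    show "0 \<le> H x" unfolding H_def using t01 by (intro Bochner_Integration.integral_nonneg) auto
    have "H x \<le> (\<integral>y. 1 \<partial>L)" unfolding H_def using t01 by (intro integral_mono i_tv) auto
    then show "H x \<le> 1" by (simp add: L.prob_space)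
  qed
  have [measurable]: "H \<in> borel_measurable borel"
  proof -
    have "(\<lambda>(x, y). tv (kpow K n x) (kpow K n y)) \<in> borel_measurable (borel \<Otimes>\<^sub>M L)"
      by (simp add: case_prod_beta')
    then show ?thesis unfolding H_def[abs_def] by (rule L.borel_measurable_lebesgue_integral)
  qed
  have le: "AE \<omega> in N. \<bar>cond_prob_given N (past 0) B \<omega> - measure N B\<bar> \<le> H (Y 0 \<omega>)"
    if B: "B \<in> sets (sigma_of N Y {int n..})" for B
  proof -
    from B obtain b :: "real \<Rightarrow> real" where b: "b \<in> borel_measurable borel" "\<And>x. 0 \<le> b x" "\<And>x. b x \<le> 1"
      and ae: "AE \<omega> in N. cond_prob_given N (past 0) B \<omega> = (\<integral>y. b y \<partial>kpow K n (Y 0 \<omega>))"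
      and mB: "measure N B = (\<integral>x. \<integral>y. b y \<partial>kpow K n x \<partial>L)"
      by (rule future_cond_prob) blast
    define h where "h x = (\<integral>y. b y \<partial>kpow K n x)" for x
    have [measurable]: "h \<in> borel_measurable borel" unfolding h_def[abs_def] by (rule kpow_integral_measurable[OF b(1)])
    have h01: "0 \<le> h x" "h x \<le> 1" for x unfolding h_def by (rule kpow_integral_01[OF b])+
    have i_h: "integrable L h" using h01 by (intro integrable_bounded[of _ _ 1] L.prob_space_axioms) auto
    have bound: "\<bar>h x - measure N B\<bar> \<le> H x" for x
    proof -
      have "h x - measure N B = (\<integral>y. h x - h y \<partial>L)"
        using i_h by (simp add: mB h_def[symmetric] L.prob_space)
      then have "\<bar>h x - measure N B\<bar> \<le> (\<integral>y. \<bar>h x - h y\<bar> \<partial>L)" by (simp only: integral_abs_bound)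
      also have "\<dots> \<le> H x"
        unfolding H_def
      proof (rule integral_mono[OF _ i_tv])
        show "integrable L (\<lambda>y. \<bar>h x - h y\<bar>)"
          using i_h by (intro integrable_abs Bochner_Integration.integrable_diff) auto
        show "\<bar>h x - h y\<bar> \<le> tv (kpow K n x) (kpow K n y)" for y
          unfolding h_def by (intro tv_integral_le Knx b)
      qed
      finally show ?thesis .
    qed
    from ae show ?thesis
    proof eventually_elim
      case (elim \<omega>)
      show ?case unfolding elim using bound[of "Y 0 \<omega>"] by (simp add: h_def)
    qed
  qed
  have "AE \<omega> in N. Z \<omega> \<le> H (Y 0 \<omega>)"
    using Z(2) le unfolding is_ess_sup_def by auto
  moreover have "integrable N (\<lambda>\<omega>. H (Y 0 \<omega>))"
    using H01 by (intro integrable_bounded[of _ _ 1] prob_space_axioms) auto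
  moreover have "0 \<le> H (Y 0 \<omega>)" for \<omega> by (rule H01)
  \<comment> \<open>Were Z not integrable, its integral would be 0 by convention, and the bound
    still holds because \<open>H\<close> is nonnegative.\<close>
  ultimately have "(\<integral>\<omega>. Z \<omega> \<partial>N) \<le> (\<integral>\<omega>. H (Y 0 \<omega>) \<partial>N)"
    by (cases "integrable N Z") (auto intro!: integral_mono_AE Bochner_Integration.integral_nonneg simp: not_integrable_integral_eq)
  also have "\<dots> = (\<integral>x. H x \<partial>L)" unfolding law[of 0, symmetric] by (subst integral_distr) auto
  also have "\<dots> = (\<integral>z. tv (kpow K n (fst z)) (kpow K n (snd z)) \<partial>(L \<Otimes>\<^sub>M L))"
    unfolding H_def using t01
    by (subst LL.integral_fst'[symmetric]) (auto intro!: integrable_bounded[of _ _ 1] LL.prob_space_axioms)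
  finally show ?thesis by (simp add: Z)
qed

text \<open>The events that \<open>Y n\<close> lies in U belong to the future, and their conditional
  probability is the n-step law of U. Countably many U determine \<open>tv\<close>, so almost
  everywhere the essential supremum dominates them all at once.\<close>

lemma tv_le_beta_mix:
  assumes inv: "L \<bind> K = L"
  shows "(\<integral>x. tv (kpow K n x) L \<partial>L) \<le> beta_mix N Y n" "0 \<le> (\<integral>x. tv (kpow K n x) L \<partial>L)"
proof -
  obtain Z where Z: "beta_mix N Y n = (\<integral>\<omega>. Z \<omega> \<partial>N)"
    "is_ess_sup N (sets (sigma_of N Y {int n..})) (\<lambda>B \<omega>. \<bar>cond_prob_given N (past 0) B \<omega> - measure N B\<bar>) Z"
    by (rule beta_ess_sup)
  have Z_meas [measurable]: "Z \<in> borel_measurable N" using Z(2) by (simp add: is_ess_sup_def)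
  note Kn = prob_kernel_kpow[OF K_kernel, of n]
  note Knx = prob_kernelD[OF Kn]
  interpret L: prob_space L by (rule prob_algebraD[OF L_prob])
  have sL [measurable_cong]: "sets L = sets borel" by (rule prob_algebraD[OF L_prob])
  have t01: "0 \<le> tv (kpow K n x) L" "tv (kpow K n x) L \<le> 1" for x
    by (intro tv_nonneg tv_le_1 Knx L_prob)+
  have [measurable]: "(\<lambda>x. tv (kpow K n x) L) \<in> borel_measurable borel"
    using L_prob by (intro borel_measurable_tv Kn measurable_const)
  show "0 \<le> (\<integral>x. tv (kpow K n x) L \<partial>L)" using t01 by (intro Bochner_Integration.integral_nonneg) auto
  have cond: "AE \<omega> in N. cond_prob_given N (past 0) (Y (int n) -` U \<inter> space N) \<omega> = measure (kpow K n (Y 0 \<omega>)) U"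
    "measure N (Y (int n) -` U \<inter> space N) = measure L U"
    if [measurable]: "U \<in> sets borel" for U
  proof -
    have [simp]: "(\<integral>y. indicat_real U y \<partial>kpow K n x) = measure (kpow K n x) U" for x
      using prob_algebraD(2,3)[OF Knx, of x] by simp
    have "AE \<omega> in N. cond_prob_given N (past 0) (Y (int n) -` U \<inter> space N) \<omega> = (\<integral>y. indicat_real U y \<partial>kpow K n (Y 0 \<omega>))"
    proof (rule cond_prob_future(1))
      fix E assume E: "E \<in> sets (past (int n))"
      have [measurable]: "E \<in> sets N" using E by (rule sets_pastD)
      have "emeasure N (E \<inter> (Y (int n) -` U \<inter> space N)) = (\<integral>\<^sup>+\<omega>. indicator (E \<inter> (Y (int n) -` U \<inter> space N)) \<omega> \<partial>N)"
        by simp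
      also have "\<dots> = (\<integral>\<^sup>+\<omega>\<in>E. ennreal (indicat_real U (Y (int n) \<omega>)) \<partial>N)"
        by (intro nn_integral_cong) (auto simp: indicator_def)
      finally show "emeasure N (E \<inter> (Y (int n) -` U \<inter> space N)) = (\<integral>\<^sup>+\<omega>\<in>E. ennreal (indicat_real U (Y (int n) \<omega>)) \<partial>N)" .
    qed auto
    then show "AE \<omega> in N. cond_prob_given N (past 0) (Y (int n) -` U \<inter> space N) \<omega> = measure (kpow K n (Y 0 \<omega>)) U"
      using prob_algebraD(2,3)[OF Knx] by simp
    show "measure N (Y (int n) -` U \<inter> space N) = measure L U"
      unfolding law[of "int n", symmetric] by (simp add: measure_distr)
  qed
  have U_in: "Y (int n) -` U \<inter> space N \<in> sets (sigma_of N Y {int n..})" if "U \<in> sets borel" for U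
    using measurable_sets[OF measurable_sigma_of[of "int n" "{int n..}" Y N] that] by (simp add: space_sigma_of)
  have "AE \<omega> in N. \<forall>U\<in>basis_unions. \<bar>measure (kpow K n (Y 0 \<omega>)) U - measure L U\<bar> \<le> Z \<omega>"
  proof (intro AE_ball_countable[THEN iffD2] countable_basis_unions ballI)
    fix U :: "real set" assume "U \<in> basis_unions"
    then have U: "U \<in> sets borel" by (rule sets_basis_unions)
    have "AE \<omega> in N. \<bar>cond_prob_given N (past 0) (Y (int n) -` U \<inter> space N) \<omega> - measure N (Y (int n) -` U \<inter> space N)\<bar> \<le> Z \<omega>"
      using Z(2) U_in[OF U] unfolding is_ess_sup_def by blast
    with cond(1)[OF U] show "AE \<omega> in N. \<bar>measure (kpow K n (Y 0 \<omega>)) U - measure L U\<bar> \<le> Z \<omega>"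
      by eventually_elim (simp add: cond(2)[OF U])
  qed
  then have le: "AE \<omega> in N. tv (kpow K n (Y 0 \<omega>)) L \<le> Z \<omega>"
    by eventually_elim (intro tv_least, auto)
  \<comment> \<open>Needed for integrability: a non-integrable Z would have integral 0 and the
    comparison would break down. The constant 1 majorizes the family, hence Z by minimality.\<close>
  have "AE \<omega> in N. Z \<omega> \<le> 1"
  proof -
    have "AE \<omega> in N. \<bar>cond_prob_given N (past 0) B \<omega> - measure N B\<bar> \<le> 1"
      if B: "B \<in> sets (sigma_of N Y {int n..})" for B
    proof -
      from B obtain b :: "real \<Rightarrow> real" where b: "b \<in> borel_measurable borel" "\<And>x. 0 \<le> b x" "\<And>x. b x \<le> 1"
        and ae: "AE \<omega> in N. cond_prob_given N (past 0) B \<omega> = (\<integral>y. b y \<partial>kpow K n (Y 0 \<omega>))"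
        by (rule future_cond_prob) blast
      from ae show ?thesis
      proof eventually_elim
        case (elim \<omega>)
        show ?case
          unfolding elim using kpow_integral_01(1,2)[OF b, of n "Y 0 \<omega>"] prob_le_1[of B] measure_nonneg[of N B]
          by linarith
      qed
    qed
    then show ?thesis using Z(2) unfolding is_ess_sup_def by auto
  qed
  with le have "AE \<omega> in N. norm (Z \<omega>) \<le> 1"
  proof eventually_elim
    case (elim \<omega>)
    with t01(1)[of "Y 0 \<omega>"] show ?case by simp
  qed
  then have "integrable N Z" by (intro integrable_const_bound[of _ 1]) auto
  moreover have "integrable N (\<lambda>\<omega>. tv (kpow K n (Y 0 \<omega>)) L)"
    using t01 by (intro integrable_bounded[of _ _ 1] prob_space_axioms) auto
  ultimately have "(\<integral>\<omega>. tv (kpow K n (Y 0 \<omega>)) L \<partial>N) \<le> beta_mix N Y n"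
    unfolding Z(1) using le by (intro integral_mono_AE)
  also have "(\<integral>\<omega>. tv (kpow K n (Y 0 \<omega>)) L \<partial>N) = (\<integral>x. tv (kpow K n x) L \<partial>distr N borel (Y 0))"
    by (subst integral_distr) auto
  finally show "(\<integral>x. tv (kpow K n x) L \<partial>L) \<le> beta_mix N Y n" by (simp add: law)
qed

end

section \<open>Mixtures of kernels\<close>

text \<open>A coin with success probability \<theta> selects the second measure, so the weights are
  1 - \<theta> and \<theta>. In the form of a bind, total mass and measurability come from general
  facts on kernels.\<close>

definition mix_measure :: "real \<Rightarrow> 'a measure \<Rightarrow> 'a measure \<Rightarrow> 'a measure" where
  "mix_measure \<theta> \<mu> \<nu> = measure_pmf (bernoulli_pmf \<theta>) \<bind> (\<lambda>b. if b then \<nu> else \<mu>)"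

definition mix_kernel :: "real \<Rightarrow> ('a \<Rightarrow> 'b measure) \<Rightarrow> ('a \<Rightarrow> 'b measure) \<Rightarrow> 'a \<Rightarrow> 'b measure" where
  "mix_kernel \<theta> P Q x = mix_measure \<theta> (P x) (Q x)"

lemma measurable_mix_kernel:
  assumes [measurable]: "P \<in> M \<rightarrow>\<^sub>M prob_algebra N" "Q \<in> M \<rightarrow>\<^sub>M prob_algebra N"
  shows "mix_kernel \<theta> P Q \<in> M \<rightarrow>\<^sub>M prob_algebra N"
  unfolding mix_kernel_def[abs_def] mix_measure_def
proof (rule measurable_bind_prob_space2)
  show "(\<lambda>x. measure_pmf (bernoulli_pmf \<theta>)) \<in> M \<rightarrow>\<^sub>M prob_algebra (count_space UNIV)"
    by (rule measurable_const) (simp add: space_prob_algebra measure_pmf.prob_space_axioms)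
  show "(\<lambda>(x, b). if b then Q x else P x) \<in> M \<Otimes>\<^sub>M count_space UNIV \<rightarrow>\<^sub>M prob_algebra N"
    by measurable
qed

lemma nn_integral_mix_measure:
  assumes \<mu>: "\<mu> \<in> space (prob_algebra N)" and \<nu>: "\<nu> \<in> space (prob_algebra N)"
    and \<theta>: "0 \<le> \<theta>" "\<theta> \<le> 1" and f: "f \<in> borel_measurable N"
  shows "(\<integral>\<^sup>+y. f y \<partial>mix_measure \<theta> \<mu> \<nu>) = ennreal (1 - \<theta>) * (\<integral>\<^sup>+y. f y \<partial>\<mu>) + ennreal \<theta> * (\<integral>\<^sup>+y. f y \<partial>\<nu>)"
proof -
  have b: "measure_pmf (bernoulli_pmf \<theta>) \<in> space (prob_algebra (count_space UNIV))"
    by (simp add: space_prob_algebra measure_pmf.prob_space_axioms)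
  have k: "(\<lambda>b. if b then \<nu> else \<mu>) \<in> count_space UNIV \<rightarrow>\<^sub>M prob_algebra N"
    using \<mu> \<nu> by simp
  show ?thesis
    unfolding mix_measure_def nn_integral_bind_prob[OF b k f] using \<theta>
    by (simp add: mult.commute add.commute)
qed

lemma mix_measure_in_prob_algebra:
  assumes \<mu>: "\<mu> \<in> space (prob_algebra N)" and \<nu>: "\<nu> \<in> space (prob_algebra N)"
  shows "mix_measure \<theta> \<mu> \<nu> \<in> space (prob_algebra N)"
  unfolding mix_measure_def using \<mu> \<nu>
  by (intro bind_in_prob_algebra[where M="count_space UNIV"]) (simp_all add: space_prob_algebra measure_pmf.prob_space_axioms)

lemma emeasure_mix_measure:
  assumes \<mu>: "\<mu> \<in> space (prob_algebra N)" and \<nu>: "\<nu> \<in> space (prob_algebra N)"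
    and \<theta>: "0 \<le> \<theta>" "\<theta> \<le> 1" and A: "A \<in> sets N"
  shows "emeasure (mix_measure \<theta> \<mu> \<nu>) A = ennreal (1 - \<theta>) * emeasure \<mu> A + ennreal \<theta> * emeasure \<nu> A"
  using nn_integral_mix_measure[OF \<mu> \<nu> \<theta>, of "indicator A"] A
  by (simp add: prob_algebraD(2)[OF \<mu>] prob_algebraD(2)[OF \<nu>] prob_algebraD(2)[OF mix_measure_in_prob_algebra[OF \<mu> \<nu>]])

lemma measure_convex_combination:
  assumes "\<mu> \<in> space (prob_algebra N)" "\<nu> \<in> space (prob_algebra N)" and \<theta>: "0 \<le> \<theta>" "\<theta> \<le> 1"
    and eq: "emeasure \<rho> A = ennreal (1 - \<theta>) * emeasure \<mu> A + ennreal \<theta> * emeasure \<nu> A"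
  shows "measure \<rho> A = (1 - \<theta>) * measure \<mu> A + \<theta> * measure \<nu> A"
proof -
  have "emeasure \<mu> A = ennreal (measure \<mu> A)" "emeasure \<nu> A = ennreal (measure \<nu> A)"
    using assms(1,2) by (auto dest!: prob_algebraD(1) intro!: finite_measure.emeasure_eq_measure prob_space.finite_measure)
  then have "emeasure \<rho> A = ennreal ((1 - \<theta>) * measure \<mu> A + \<theta> * measure \<nu> A)"
    using \<theta> by (simp add: eq ennreal_mult[symmetric] ennreal_plus[symmetric] del: ennreal_plus)
  then show ?thesis using \<theta> by (simp add: measure_eq_emeasure_eq_ennreal)
qed

lemma emeasure_joint_mix_kernel:
  assumes L: "L \<in> space (prob_algebra borel)" and P: "prob_kernel P" and Q: "prob_kernel Q"
    and \<theta>: "0 \<le> \<theta>" "\<theta> \<le> 1" and A [measurable]: "A \<in> sets borel" and B [measurable]: "B \<in> sets borel"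
  shows "emeasure (joint L (mix_kernel \<theta> P Q)) (A \<times> B) =
    ennreal (1 - \<theta>) * emeasure (joint L P) (A \<times> B) + ennreal \<theta> * emeasure (joint L Q) (A \<times> B)"
proof -
  have s [measurable_cong]: "sets L = sets borel" by (rule prob_algebraD[OF L])
  have [measurable]: "(\<lambda>x. emeasure (P x) B) \<in> borel_measurable borel" "(\<lambda>x. emeasure (Q x) B) \<in> borel_measurable borel"
    using measurable_emeasure_kernel[OF measurable_prob_algebraD[OF P] B]
      measurable_emeasure_kernel[OF measurable_prob_algebraD[OF Q] B] by auto
  have "emeasure (joint L (mix_kernel \<theta> P Q)) (A \<times> B) = (\<integral>\<^sup>+x\<in>A. emeasure (mix_kernel \<theta> P Q x) B \<partial>L)"
    by (rule emeasure_joint_Times[OF L measurable_mix_kernel[OF P Q] A B])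
  also have "\<dots> = (\<integral>\<^sup>+x. ennreal (1 - \<theta>) * (emeasure (P x) B * indicator A x) + ennreal \<theta> * (emeasure (Q x) B * indicator A x) \<partial>L)"
    by (intro nn_integral_cong)
      (simp add: mix_kernel_def emeasure_mix_measure[OF prob_kernelD[OF P] prob_kernelD[OF Q] \<theta> B] indicator_def)
  also have "\<dots> = ennreal (1 - \<theta>) * (\<integral>\<^sup>+x\<in>A. emeasure (P x) B \<partial>L) + ennreal \<theta> * (\<integral>\<^sup>+x\<in>A. emeasure (Q x) B \<partial>L)"
    by (subst nn_integral_add) (auto simp: nn_integral_cmult)
  finally show ?thesis
    by (simp add: emeasure_joint_Times[OF L P A B] emeasure_joint_Times[OF L Q A B])
qed

lemma measure_joint_mix_kernel:
  assumes L: "L \<in> space (prob_algebra borel)" and P: "prob_kernel P" and Q: "prob_kernel Q"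
    and \<theta>: "0 \<le> \<theta>" "\<theta> \<le> 1" and A: "A \<in> sets borel" and B: "B \<in> sets borel"
  shows "measure (joint L (mix_kernel \<theta> P Q)) (A \<times> B) =
    (1 - \<theta>) * measure (joint L P) (A \<times> B) + \<theta> * measure (joint L Q) (A \<times> B)"
  using emeasure_joint_mix_kernel[OF assms] \<theta>
  by (intro measure_convex_combination[OF joint_in_prob_algebra[OF L P] joint_in_prob_algebra[OF L Q]])

section \<open>Powers of a mixed kernel\<close>

text \<open>The component L ignores the starting point and cancels in the difference; what remains
  is 1 - \<theta> times a difference between laws started from P-successors, which the previous
  power bounds uniformly.\<close>

lemma tv_kpow_mix_const_le:
  fixes L :: "'a::polish_space measure"
  assumes L: "L \<in> space (prob_algebra borel)" and P: "prob_kernel P" and \<theta>: "0 \<le> \<theta>" "\<theta> \<le> 1"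
  shows "tv (kpow (mix_kernel \<theta> P (\<lambda>_. L)) n x) (kpow (mix_kernel \<theta> P (\<lambda>_. L)) n y) \<le> (1 - \<theta>) ^ n"
proof (induction n arbitrary: x y)
  case 0
  show ?case by (simp add: tv_le_1 prob_kernelD[OF measurable_return_prob_space])
next
  case (Suc n)
  define K where "K = mix_kernel \<theta> P (\<lambda>_. L)"
  have cL: "prob_kernel (\<lambda>_. L)" using L by (intro measurable_const)
  have K: "prob_kernel K" unfolding K_def by (rule measurable_mix_kernel[OF P cL])
  note Kn = prob_kernel_kpow[OF K, of n]
  note Px = prob_kernelD[OF P]
  have mix_bind: "measure (K x \<bind> kpow K n) U = (1 - \<theta>) * measure (P x \<bind> kpow K n) U + \<theta> * measure (L \<bind> kpow K n) U"
    if U: "U \<in> sets borel" for x U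
  proof -
    have [measurable]: "(\<lambda>y. emeasure (kpow K n y) U) \<in> borel_measurable borel"
      by (rule measurable_emeasure_kernel[OF measurable_prob_algebraD[OF Kn] U])
    have "emeasure (K x \<bind> kpow K n) U = (\<integral>\<^sup>+y. emeasure (kpow K n y) U \<partial>mix_measure \<theta> (P x) L)"
      using emeasure_bind_prob_algebra[OF prob_kernelD[OF K, of x] Kn U] by (simp add: K_def mix_kernel_def)
    also have "\<dots> = ennreal (1 - \<theta>) * emeasure (P x \<bind> kpow K n) U + ennreal \<theta> * emeasure (L \<bind> kpow K n) U"
      unfolding emeasure_bind_prob_algebra[OF Px Kn U] emeasure_bind_prob_algebra[OF L Kn U]
      by (rule nn_integral_mix_measure[OF Px L \<theta>]) measurable
    finally show ?thesis
      by (rule measure_convex_combination[OF bind_in_prob_algebra[OF Px Kn] bind_in_prob_algebra[OF L Kn] \<theta>])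
  qed
  show ?case
    unfolding K_def[symmetric]
  proof (rule tv_least)
    fix U :: "'a set" assume "U \<in> basis_unions"
    then have U: "U \<in> sets borel" by (rule sets_basis_unions)
    interpret pair_prob_space "P x" "P y"
      using prob_algebraD(1)[OF Px] by (simp add: pair_prob_space_def pair_sigma_finite_def prob_space_imp_sigma_finite)
    have "\<bar>measure (P x \<bind> kpow K n) U - measure (P y \<bind> kpow K n) U\<bar> \<le> tv (P x \<bind> kpow K n) (P y \<bind> kpow K n)"
      by (intro abs_measure_diff_le_tv bind_in_prob_algebra[OF Px Kn] U)
    also have "\<dots> \<le> (\<integral>z. tv (kpow K n (fst z)) (kpow K n (snd z)) \<partial>(P x \<Otimes>\<^sub>M P y))"
      by (rule tv_bind_le_integral[OF Px Px Kn])
    also have "\<dots> \<le> (\<integral>z. (1 - \<theta>) ^ n \<partial>(P x \<Otimes>\<^sub>M P y))"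
    proof (rule integral_mono)
      have [measurable_cong]: "sets (P x) = sets borel" for x by (rule prob_algebraD[OF Px])
      have "(\<lambda>z. tv (kpow K n (fst z)) (kpow K n (snd z))) \<in> borel_measurable (borel \<Otimes>\<^sub>M borel)"
        by (intro borel_measurable_tv measurable_compose[OF measurable_fst Kn] measurable_compose[OF measurable_snd Kn])
      then have m: "(\<lambda>z. tv (kpow K n (fst z)) (kpow K n (snd z))) \<in> borel_measurable (P x \<Otimes>\<^sub>M P y)" by measurable
      show "integrable (P x \<Otimes>\<^sub>M P y) (\<lambda>z. tv (kpow K n (fst z)) (kpow K n (snd z)))"
        by (rule integrable_bounded[OF prob_space_axioms m, of 1])
          (simp add: abs_of_nonneg tv_nonneg tv_le_1 prob_kernelD[OF Kn])
    qed (use Suc in \<open>auto simp: K_def\<close>)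
    finally have "(1 - \<theta>) * \<bar>measure (P x \<bind> kpow K n) U - measure (P y \<bind> kpow K n) U\<bar> \<le> (1 - \<theta>) * (1 - \<theta>) ^ n"
      using \<theta> prob_space by (intro mult_left_mono) auto
    moreover have "measure (kpow K (Suc n) x) U - measure (kpow K (Suc n) y) U =
      (1 - \<theta>) * (measure (P x \<bind> kpow K n) U - measure (P y \<bind> kpow K n) U)"
      by (simp add: mix_bind[OF U] algebra_simps)
    ultimately show "\<bar>measure (kpow K (Suc n) x) U - measure (kpow K (Suc n) y) U\<bar> \<le> (1 - \<theta>) ^ Suc n"
      using \<theta> by (simp add: abs_mult)
  qed
qed

text \<open>The left side is the contribution of the paths along which every step uses P.\<close>

lemma kpow_mix_ge:
  assumes P: "prob_kernel P" and Q: "prob_kernel Q" and \<theta>: "0 \<le> \<theta>" "\<theta> \<le> 1" and U: "U \<in> sets borel"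
  shows "ennreal ((1 - \<theta>) ^ n) * emeasure (kpow P n x) U \<le> emeasure (kpow (mix_kernel \<theta> P Q) n x) U"
proof (induction n arbitrary: x)
  case 0
  show ?case by simp
next
  case (Suc n)
  define K where "K = mix_kernel \<theta> P Q"
  have K: "prob_kernel K" unfolding K_def by (rule measurable_mix_kernel[OF P Q])
  note Kn = prob_kernel_kpow[OF K, of n] and Pn = prob_kernel_kpow[OF P, of n]
  note Px = prob_kernelD[OF P] and Qx = prob_kernelD[OF Q]
  have [measurable]: "(\<lambda>y. emeasure (kpow K n y) U) \<in> borel_measurable borel" "(\<lambda>y. emeasure (kpow P n y) U) \<in> borel_measurable borel"
    by (rule measurable_emeasure_kernel[OF measurable_prob_algebraD[OF Kn] U] measurable_emeasure_kernel[OF measurable_prob_algebraD[OF Pn] U])+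
  have [measurable_cong]: "sets (P x) = sets borel" for x by (rule prob_algebraD[OF Px])
  have "ennreal ((1 - \<theta>) ^ Suc n) * emeasure (kpow P (Suc n) x) U =
    ennreal (1 - \<theta>) * (\<integral>\<^sup>+y. ennreal ((1 - \<theta>) ^ n) * emeasure (kpow P n y) U \<partial>P x)"
    using \<theta> by (simp add: emeasure_bind_prob_algebra[OF Px Pn U] nn_integral_cmult ennreal_mult mult.assoc)
  also have "\<dots> \<le> ennreal (1 - \<theta>) * (\<integral>\<^sup>+y. emeasure (kpow K n y) U \<partial>P x)"
    using Suc by (intro mult_left_mono nn_integral_mono) (auto simp: K_def)
  also have "\<dots> \<le> ennreal (1 - \<theta>) * (\<integral>\<^sup>+y. emeasure (kpow K n y) U \<partial>P x) + ennreal \<theta> * (\<integral>\<^sup>+y. emeasure (kpow K n y) U \<partial>Q x)"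
    by simp
  also have "\<dots> = (\<integral>\<^sup>+y. emeasure (kpow K n y) U \<partial>mix_kernel \<theta> P Q x)"
    unfolding mix_kernel_def by (rule nn_integral_mix_measure[symmetric, OF Px Qx \<theta>]) measurable
  also have "\<dots> = emeasure (kpow K (Suc n) x) U"
    using emeasure_bind_prob_algebra[OF prob_kernelD[OF K] Kn U, of x] by (simp add: K_def)
  finally show ?case by (simp only: K_def)
qed

text \<open>The overlap 1 - \<open>tv\<close> of the P-powers survives up to the factor (1 -
  \<theta>) ^ n: the minorization is applied to U from one starting point and to its complement from
  the other.\<close>

lemma tv_kpow_mix_le:
  fixes P Q :: "'a::polish_space \<Rightarrow> 'a measure"
  assumes P: "prob_kernel P" and Q: "prob_kernel Q" and \<theta>: "0 \<le> \<theta>" "\<theta> \<le> 1"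
  shows "tv (kpow (mix_kernel \<theta> P Q) n x) (kpow (mix_kernel \<theta> P Q) n y) \<le> 1 - (1 - \<theta>) ^ n * (1 - tv (kpow P n x) (kpow P n y))"
proof (rule tv_least)
  fix U :: "'a set" assume "U \<in> basis_unions"
  then have U: "U \<in> sets borel" "- U \<in> sets borel" by (auto dest: sets_basis_unions)
  define K where "K = mix_kernel \<theta> P Q"
  have K: "prob_kernel K" unfolding K_def by (rule measurable_mix_kernel[OF P Q])
  note Kn = prob_kernelD[OF prob_kernel_kpow[OF K, of n]] and Pn = prob_kernelD[OF prob_kernel_kpow[OF P, of n]]
  let ?c = "(1 - \<theta>) ^ n"
  have c0: "0 \<le> ?c" using \<theta> by simp
  have ge: "?c * measure (kpow P n x) A \<le> measure (kpow K n x) A" if A: "A \<in> sets borel" for x A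
  proof -
    have "emeasure (kpow P n x) A = ennreal (measure (kpow P n x) A)" "emeasure (kpow K n x) A = ennreal (measure (kpow K n x) A)"
      using prob_algebraD(1)[OF Kn] prob_algebraD(1)[OF Pn]
      by (auto intro!: finite_measure.emeasure_eq_measure prob_space.finite_measure)
    then have "ennreal (?c * measure (kpow P n x) A) \<le> ennreal (measure (kpow K n x) A)"
      using kpow_mix_ge[OF P Q \<theta> A, of n x] c0 by (simp add: K_def ennreal_mult)
    then show ?thesis by simp
  qed
  have compl: "measure \<mu> (- U) = 1 - measure \<mu> U" if "\<mu> \<in> space (prob_algebra borel)" for \<mu> :: "'a measure"
    using prob_space.prob_compl[OF prob_algebraD(1)[OF that], of U] U prob_algebraD(2,3)[OF that]
    by (simp add: Compl_eq_Diff_UNIV)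
  have "measure (kpow K n x) U - measure (kpow K n y) U \<le> 1 - ?c * (1 - tv (kpow P n x) (kpow P n y))" for x y
  proof -
    have "1 - measure (kpow K n x) U \<ge> ?c * (1 - measure (kpow P n x) U)"
      using ge[OF U(2), of x] by (simp add: compl Kn Pn)
    moreover have "measure (kpow K n y) U \<ge> ?c * measure (kpow P n y) U" by (rule ge[OF U(1)])
    moreover have "?c * (measure (kpow P n x) U - measure (kpow P n y) U) \<le> ?c * tv (kpow P n x) (kpow P n y)"
      using abs_measure_diff_le_tv[OF Pn Pn U(1), of x y] by (intro mult_left_mono c0) simp
    ultimately show ?thesis by (simp add: algebra_simps)
  qed
  from this[of x y] this[of y x]
  show "\<bar>measure (kpow (mix_kernel \<theta> P Q) n x) U - measure (kpow (mix_kernel \<theta> P Q) n y) U\<bar>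
    \<le> 1 - ?c * (1 - tv (kpow P n x) (kpow P n y))"
    by (simp add: K_def abs_le_iff tv_commute[of "kpow P n y"])
qed

text \<open>Both conditions of \<open>tv_kpow_tendsto_0\<close> come from the P-component: it has
  positive weight on rectangles, and singular powers of the mixture would force singular powers of
  P, against mixing.\<close>

lemma tv_kpow_mix_tendsto_0:
  fixes L :: "'a::polish_space measure"
  assumes L: "L \<in> space (prob_algebra borel)"
    and P: "prob_kernel P" and invP: "L \<bind> P = L"
    and Q: "prob_kernel Q" and invK: "L \<bind> mix_kernel \<theta> P Q = L"
    and \<theta>: "0 \<le> \<theta>" "\<theta> < 1"
    and mix: "(\<lambda>n. \<integral>x. tv (kpow P n x) L \<partial>L) \<longlonglongrightarrow> 0"
  shows "(\<lambda>n. \<integral>z. tv (kpow (mix_kernel \<theta> P Q) n (fst z)) (kpow (mix_kernel \<theta> P Q) n (snd z)) \<partial>(L \<Otimes>\<^sub>M L)) \<longlonglongrightarrow> 0"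
proof (rule tv_kpow_tendsto_0[OF L measurable_mix_kernel[OF P Q] invK P invP _ mix])
  have \<theta>': "0 \<le> \<theta>" "\<theta> \<le> 1" using \<theta> by auto
  fix A B :: "'a set" assume AB: "A \<in> sets borel" "B \<in> sets borel"
    and "emeasure (joint L (mix_kernel \<theta> P Q)) (A \<times> B) = 0"
  then show "emeasure (joint L P) (A \<times> B) = 0"
    using \<theta> by (simp add: emeasure_joint_mix_kernel[OF L P Q \<theta>' AB])
next
  have \<theta>': "0 \<le> \<theta>" "\<theta> \<le> 1" using \<theta> by auto
  let ?LL = "L \<Otimes>\<^sub>M L"
  interpret L: prob_space L by (rule prob_algebraD[OF L])
  interpret LL: pair_prob_space L L ..
  have [measurable_cong]: "sets L = sets borel" by (rule prob_algebraD[OF L])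
  \<comment> \<open>The threshold 1/2 makes the two terms of the triangle inequality, one for each
    starting point, add up to less than 1 on average.\<close>
  have "\<forall>\<^sub>F n in sequentially. (\<integral>x. tv (kpow P n x) L \<partial>L) < 1 / 2"
    using order_tendstoD(2)[OF mix, of "1 / 2"] by simp
  then obtain n where n: "(\<integral>x. tv (kpow P n x) L \<partial>L) < 1 / 2" by (auto simp: eventually_sequentially)
  note Pn = prob_kernel_kpow[OF P, of n]
  note Pnx = prob_kernelD[OF Pn]
  have t01: "0 \<le> tv (kpow P n x) L" "tv (kpow P n x) L \<le> 1" for x
    using tv_nonneg[OF Pnx L] tv_le_1[OF Pnx L] by auto
  have [measurable]: "(\<lambda>x. tv (kpow P n x) L) \<in> borel_measurable borel"
    using L by (intro borel_measurable_tv Pn measurable_const)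
  have i1: "integrable ?LL (\<lambda>z. tv (kpow P n (fst z)) L)" "integrable ?LL (\<lambda>z. tv (kpow P n (snd z)) L)"
    using t01 by (intro integrable_bounded[of _ _ 1] LL.prob_space_axioms; auto)+
  show "\<not> (\<forall>n. AE z in ?LL. tv (kpow (mix_kernel \<theta> P Q) n (fst z)) (kpow (mix_kernel \<theta> P Q) n (snd z)) = 1)"
  proof
    assume "\<forall>n. AE z in ?LL. tv (kpow (mix_kernel \<theta> P Q) n (fst z)) (kpow (mix_kernel \<theta> P Q) n (snd z)) = 1"
    then have "AE z in ?LL. tv (kpow (mix_kernel \<theta> P Q) n (fst z)) (kpow (mix_kernel \<theta> P Q) n (snd z)) = 1" by blast
    then have "AE z in ?LL. 1 \<le> tv (kpow P n (fst z)) L + tv (kpow P n (snd z)) L"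
    proof eventually_elim
      case (elim z)
      have "(1 - \<theta>) ^ n * (1 - tv (kpow P n (fst z)) (kpow P n (snd z))) \<le> 0"
        using tv_kpow_mix_le[OF P Q \<theta>', of n "fst z" "snd z"] elim by simp
      then have "1 \<le> tv (kpow P n (fst z)) (kpow P n (snd z))"
        using \<theta> by (simp add: mult_le_0_iff) (smt (verit) zero_less_power)
      also have "\<dots> \<le> tv (kpow P n (fst z)) L + tv L (kpow P n (snd z))"
        by (rule tv_triangle[OF Pnx Pnx L])
      finally show ?case by (simp add: tv_commute[of L])
    qed
    then have "(\<integral>z. 1 \<partial>?LL) \<le> (\<integral>z. tv (kpow P n (fst z)) L + tv (kpow P n (snd z)) L \<partial>?LL)"
      using i1 by (intro integral_mono_AE Bochner_Integration.integrable_add) auto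
    also have "\<dots> = (\<integral>z. tv (kpow P n (fst z)) L \<partial>?LL) + (\<integral>z. tv (kpow P n (snd z)) L \<partial>?LL)"
      using i1 by (rule Bochner_Integration.integral_add)
    also have "(\<integral>z. tv (kpow P n (fst z)) L \<partial>?LL) = (\<integral>x. tv (kpow P n x) L \<partial>L)"
      using integral_prod_pair[of L L "\<lambda>x. tv (kpow P n x) L" "\<lambda>_. 1"] t01 L.prob_space_axioms L.prob_space by simp
    also have "(\<integral>z. tv (kpow P n (snd z)) L \<partial>?LL) = (\<integral>x. tv (kpow P n x) L \<partial>L)"
      using integral_prod_pair[of L L "\<lambda>_. 1" "\<lambda>x. tv (kpow P n x) L"] t01 L.prob_space_axioms L.prob_space by simp
    finally show False using n by (simp add: LL.prob_space)
  qed
qed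

section \<open>Copulas and their kernels\<close>

lemma unif01_in_prob_algebra: "unif01 \<in> space (prob_algebra borel)"
proof -
  have "prob_space unif01" by (rule prob_space_uniform_measure) auto
  then show ?thesis by (simp add: space_prob_algebra)
qed

lemma measure_unif01_atMost: "measure unif01 {..x} = max 0 (min x 1)"
proof -
  have "{0<..<1} \<inter> {..x} = (if x \<le> 0 then {} else if x < 1 then {0<..x} else {0<..<1::real})" by auto
  then show ?thesis by (simp add: measure_uniform_measure max_def min_def)
qed

text \<open>Uniformity of the marginals is recorded through boundary values of D, a form that passes
  to convex combinations at once and is easy to check for \<open>C_one\<close>.\<close>

definition copula_law :: "(real \<times> real) measure \<Rightarrow> (real \<Rightarrow> real \<Rightarrow> real) \<Rightarrow> bool" where
  "copula_law \<mu> D \<longleftrightarrow> \<mu> \<in> space (prob_algebra (borel \<Otimes>\<^sub>M borel)) \<and>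
     (\<forall>x\<in>{0..1}. \<forall>y\<in>{0..1}. measure \<mu> ({..x} \<times> {..y}) = D x y) \<and>
     (\<forall>x\<in>{0..1}. D x 1 = x \<and> D 1 x = x)"

lemma copula_lawD:
  assumes "copula_law \<mu> D"
  shows "\<mu> \<in> space (prob_algebra (borel \<Otimes>\<^sub>M borel))"
    and "x \<in> {0..1} \<Longrightarrow> y \<in> {0..1} \<Longrightarrow> measure \<mu> ({..x} \<times> {..y}) = D x y"
    and "x \<in> {0..1} \<Longrightarrow> D x 1 = x" "x \<in> {0..1} \<Longrightarrow> D 1 x = x"
  using assms by (auto simp: copula_law_def)

lemma copula_law_unit_square:
  assumes \<mu>: "copula_law \<mu> D" and A: "A \<in> sets (borel \<Otimes>\<^sub>M borel)"
  shows "measure \<mu> (A \<inter> {..1} \<times> {..1}) = measure \<mu> A"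
proof -
  interpret prob_space \<mu> by (rule prob_algebraD[OF copula_lawD(1)[OF \<mu>]])
  have [measurable_cong]: "sets \<mu> = sets (borel \<Otimes>\<^sub>M borel)" by (rule prob_algebraD[OF copula_lawD(1)[OF \<mu>]])
  have "prob ({..1} \<times> {..1}) = 1" using copula_lawD(2,3)[OF \<mu>, of 1] by simp
  then have "AE p in \<mu>. p \<in> {..1} \<times> {..1}" by (subst (asm) prob_eq_1) auto
  then show ?thesis using A by (intro finite_measure_eq_AE) auto
qed

text \<open>The quadrant at (1, 1) has mass D 1 1 = 1, so coordinates may be cut at 1; below 0,
  monotonicity and the boundary value 0 leave no mass. Hence the values on the unit square determine
  the law.\<close>

lemma copula_law_atMost:
  assumes \<mu>: "copula_law \<mu> D"
  shows "measure \<mu> ({..x} \<times> {..y}) = (if x < 0 \<or> y < 0 then 0 else D (min x 1) (min y 1))"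
proof -
  interpret prob_space \<mu> by (rule prob_algebraD[OF copula_lawD(1)[OF \<mu>]])
  have [measurable_cong]: "sets \<mu> = sets (borel \<Otimes>\<^sub>M borel)" by (rule prob_algebraD[OF copula_lawD(1)[OF \<mu>]])
  have "({..x} \<times> {..y}) \<inter> {..1} \<times> {..1} = {..min x 1} \<times> {..min y 1}" by auto
  then have eq: "measure \<mu> ({..x} \<times> {..y}) = measure \<mu> ({..min x 1} \<times> {..min y 1})"
    using copula_law_unit_square[OF \<mu>, of "{..x} \<times> {..y}"] by simp
  show ?thesis
  proof (cases "x < 0 \<or> y < 0")
    case True
    have z: "measure \<mu> ({..0} \<times> {..1}) = 0" "measure \<mu> ({..1} \<times> {..0}) = 0"
      using copula_lawD(2)[OF \<mu>, of 0 1] copula_lawD(2)[OF \<mu>, of 1 0] copula_lawD(3,4)[OF \<mu>, of 0] by simp_all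
    have "measure \<mu> ({..min x 1} \<times> {..min y 1}) \<le> 0"
    proof (cases "x < 0")
      case True
      then have "measure \<mu> ({..min x 1} \<times> {..min y 1}) \<le> measure \<mu> ({..0} \<times> {..1})"
        by (intro finite_measure_mono) auto
      with z show ?thesis by simp
    next
      case False
      with \<open>x < 0 \<or> y < 0\<close> have "measure \<mu> ({..min x 1} \<times> {..min y 1}) \<le> measure \<mu> ({..1} \<times> {..0})"
        by (intro finite_measure_mono) auto
      with z show ?thesis by simp
    qed
    with True eq show ?thesis by (auto simp: measure_le_0_iff)
  next
    case False
    with eq copula_lawD(2)[OF \<mu>, of "min x 1" "min y 1"] show ?thesis by auto
  qed
qed

lemma measure_eqI_atMost_Times:
  fixes \<mu> \<nu> :: "(real \<times> real) measure"
  assumes \<mu>: "\<mu> \<in> space (prob_algebra (borel \<Otimes>\<^sub>M borel))" and \<nu>: "\<nu> \<in> space (prob_algebra (borel \<Otimes>\<^sub>M borel))"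
    and eq: "\<And>x y. measure \<mu> ({..x} \<times> {..y}) = measure \<nu> ({..x} \<times> {..y})"
  shows "\<mu> = \<nu>"
proof -
  interpret \<mu>: prob_space \<mu> by (rule prob_algebraD[OF \<mu>])
  interpret \<nu>: prob_space \<nu> by (rule prob_algebraD[OF \<nu>])
  have at: "{..p} = {..fst p} \<times> {..snd p}" for p :: "real \<times> real"
    by (auto simp: less_eq_prod_def)
  have sets_eq: "sets (borel \<Otimes>\<^sub>M borel) = sigma_sets UNIV (range (\<lambda>p :: real \<times> real. {..p}))"
    unfolding borel_prod by (subst borel_eq_atMost) simp
  show ?thesis
  proof (rule measure_eqI_generator_eq)
    show "Int_stable (range (\<lambda>p :: real \<times> real. {..p}))"
    proof (rule Int_stableI)
      fix a b :: "(real \<times> real) set" assume "a \<in> range atMost" "b \<in> range atMost"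
      then obtain p q where "a = {..p}" "b = {..q}" by auto
      then have "a \<inter> b = {..(min (fst p) (fst q), min (snd p) (snd q))}" by (auto simp: at)
      then show "a \<inter> b \<in> range atMost" by simp
    qed
    show "sets \<mu> = sigma_sets UNIV (range (\<lambda>p :: real \<times> real. {..p}))"
      "sets \<nu> = sigma_sets UNIV (range (\<lambda>p :: real \<times> real. {..p}))"
      using prob_algebraD(2)[OF \<mu>] prob_algebraD(2)[OF \<nu>] by (simp_all add: sets_eq)
    show "range (\<lambda>n. {..(real n, real n)}) \<subseteq> range (\<lambda>p :: real \<times> real. {..p})" by auto
    show "(\<Union>n. {..(real n, real n)}) = UNIV"
    proof (intro equalityI subsetI UNIV_I)
      fix p :: "real \<times> real"
      obtain n where "max (fst p) (snd p) \<le> real n" using real_arch_simple[of "max (fst p) (snd p)"] by blast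
      then show "p \<in> (\<Union>n. {..(real n, real n)})" by (auto simp: less_eq_prod_def)
    qed
    show "emeasure \<mu> X = emeasure \<nu> X" if "X \<in> range (\<lambda>p :: real \<times> real. {..p})" for X
      using that eq by (auto simp: at \<mu>.emeasure_eq_measure \<nu>.emeasure_eq_measure)
  qed (auto simp: \<mu>.emeasure_eq_measure)
qed

lemma copula_law_unique:
  assumes "copula_law \<mu> D" "copula_law \<nu> D"
  shows "\<mu> = \<nu>"
  by (rule measure_eqI_atMost_Times[OF copula_lawD(1)[OF assms(1)] copula_lawD(1)[OF assms(2)]])
    (simp add: copula_law_atMost[OF assms(1)] copula_law_atMost[OF assms(2)])

lemma copula_law_marginals:
  assumes \<mu>: "copula_law \<mu> D"
  shows "distr \<mu> borel fst = unif01" "distr \<mu> borel snd = unif01"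
proof -
  interpret prob_space \<mu> by (rule prob_algebraD[OF copula_lawD(1)[OF \<mu>]])
  have [measurable_cong]: "sets \<mu> = sets (borel \<Otimes>\<^sub>M borel)" by (rule prob_algebraD[OF copula_lawD(1)[OF \<mu>]])
  have sp: "space \<mu> = UNIV" using prob_algebraD(3)[OF copula_lawD(1)[OF \<mu>]] by (simp add: space_pair_measure)
  interpret U: prob_space unif01 using unif01_in_prob_algebra by (rule prob_algebraD)
  have rU: "real_distribution unif01" by unfold_locales auto
  have r: "real_distribution (distr \<mu> borel f)" if "f \<in> borel_measurable \<mu>" for f
    using that by (rule real_distribution_distr)
  have "cdf (distr \<mu> borel fst) x = cdf unif01 x" for x
  proof -
    have "fst -` {..x} \<inter> space \<mu> = {..x} \<times> UNIV" by (auto simp: sp)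
    then have "cdf (distr \<mu> borel fst) x = measure \<mu> ({..x} \<times> UNIV)" by (simp add: cdf_def2 measure_distr)
    also have "\<dots> = measure \<mu> (({..x} \<times> UNIV) \<inter> {..1} \<times> {..1})"
      by (rule copula_law_unit_square[OF \<mu>, symmetric]) simp
    also have "({..x} \<times> UNIV) \<inter> {..1} \<times> {..1} = {..min x 1} \<times> {..1::real}" by auto
    also have "measure \<mu> \<dots> = max 0 (min x 1)"
      using copula_lawD(3)[OF \<mu>, of "min x 1"] by (simp add: copula_law_atMost[OF \<mu>])
    finally show ?thesis by (simp add: cdf_def2 measure_unif01_atMost)
  qed
  then show "distr \<mu> borel fst = unif01"
    by (intro cdf_unique r rU ext) simp_all
  have "cdf (distr \<mu> borel snd) x = cdf unif01 x" for x
  proof -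
    have "snd -` {..x} \<inter> space \<mu> = UNIV \<times> {..x}" by (auto simp: sp)
    then have "cdf (distr \<mu> borel snd) x = measure \<mu> (UNIV \<times> {..x})" by (simp add: cdf_def2 measure_distr)
    also have "\<dots> = measure \<mu> ((UNIV \<times> {..x}) \<inter> {..1} \<times> {..1})"
      by (rule copula_law_unit_square[OF \<mu>, symmetric]) simp
    also have "(UNIV \<times> {..x}) \<inter> {..1} \<times> {..1} = {..1::real} \<times> {..min x 1}" by auto
    also have "measure \<mu> \<dots> = max 0 (min x 1)"
      using copula_lawD(4)[OF \<mu>, of "min x 1"] by (simp add: copula_law_atMost[OF \<mu>])
    finally show ?thesis by (simp add: cdf_def2 measure_unif01_atMost)
  qed
  then show "distr \<mu> borel snd = unif01"
    by (intro cdf_unique r rU ext) simp_all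
qed

lemma copula_law_of_marginals:
  assumes \<mu>: "\<mu> \<in> space (prob_algebra (borel \<Otimes>\<^sub>M borel))"
    and marg: "distr \<mu> borel fst = unif01" "distr \<mu> borel snd = unif01"
    and cdf: "\<And>x y. x \<in> {0..1} \<Longrightarrow> y \<in> {0..1} \<Longrightarrow> measure \<mu> ({..x} \<times> {..y}) = D x y"
  shows "copula_law \<mu> D"
proof -
  interpret prob_space \<mu> by (rule prob_algebraD[OF \<mu>])
  have [measurable_cong]: "sets \<mu> = sets (borel \<Otimes>\<^sub>M borel)" by (rule prob_algebraD[OF \<mu>])
  have sp: "space \<mu> = UNIV" using prob_algebraD(3)[OF \<mu>] by (simp add: space_pair_measure)
  have m: "measure \<mu> ({..x} \<times> UNIV) = max 0 (min x 1)" "measure \<mu> (UNIV \<times> {..x}) = max 0 (min x 1)" for x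
  proof -
    have "fst -` {..x} \<inter> space \<mu> = {..x} \<times> UNIV" "snd -` {..x} \<inter> space \<mu> = UNIV \<times> {..x}" by (auto simp: sp)
    then show "measure \<mu> ({..x} \<times> UNIV) = max 0 (min x 1)" "measure \<mu> (UNIV \<times> {..x}) = max 0 (min x 1)"
      using measure_unif01_atMost[of x, folded marg(1)] measure_unif01_atMost[of x, folded marg(2)]
      by (simp_all add: measure_distr)
  qed
  have "AE p in \<mu>. p \<in> {..1} \<times> UNIV" "AE p in \<mu>. p \<in> UNIV \<times> {..1}"
    using m[of 1] by (subst prob_eq_1[symmetric]; simp)+
  then have "AE p in \<mu>. p \<in> {..1} \<times> {..1}" by eventually_elim auto
  then have "measure \<mu> ({..x} \<times> {..1}) = measure \<mu> ({..x} \<times> UNIV)" "measure \<mu> ({..1} \<times> {..x}) = measure \<mu> (UNIV \<times> {..x})" for x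
    by (auto intro!: finite_measure_eq_AE)
  then have "D x 1 = x \<and> D 1 x = x" if "x \<in> {0..1}" for x
    using cdf[OF that, of 1] cdf[OF _ that, of 1] that by (simp add: m)
  then show ?thesis using \<mu> cdf by (simp add: copula_law_def)
qed

lemma copula_imp_law:
  assumes "copula C"
  obtains \<mu> where "copula_law \<mu> C"
proof -
  obtain \<mu> :: "(real \<times> real) measure" where \<mu>: "prob_space \<mu>" "sets \<mu> = sets borel"
    and "distr \<mu> borel fst = unif01" "distr \<mu> borel snd = unif01"
    and "\<forall>x\<in>{0..1}. \<forall>y\<in>{0..1}. C x y = measure \<mu> ({..x} \<times> {..y})"
    using assms unfolding copula_def by blast
  moreover have "\<mu> \<in> space (prob_algebra (borel \<Otimes>\<^sub>M borel))"
    using \<mu> by (simp add: space_prob_algebra borel_prod)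
  ultimately show ?thesis by (intro that copula_law_of_marginals) auto
qed

lemma joint_invariant:
  assumes K: "prob_kernel K" and \<mu>: "copula_law (joint unif01 K) D"
  shows "unif01 \<bind> K = unif01"
proof (rule measure_eqI)
  show "sets (unif01 \<bind> K) = sets unif01"
    using prob_algebraD(2)[OF bind_in_prob_algebra[OF unif01_in_prob_algebra K]] by simp
  fix B assume "B \<in> sets (unif01 \<bind> K)"
  then have B [measurable]: "B \<in> sets borel"
    using prob_algebraD(2)[OF bind_in_prob_algebra[OF unif01_in_prob_algebra K]] by simp
  have s [measurable_cong]: "sets (joint unif01 K) = sets (borel \<Otimes>\<^sub>M borel)" by (rule prob_algebraD[OF copula_lawD(1)[OF \<mu>]])
  have sp: "space (joint unif01 K) = UNIV" using prob_algebraD(3)[OF copula_lawD(1)[OF \<mu>]] by (simp add: space_pair_measure)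
  have "emeasure (unif01 \<bind> K) B = (\<integral>\<^sup>+x\<in>UNIV. emeasure (K x) B \<partial>unif01)"
    by (simp add: emeasure_bind_prob_algebra[OF unif01_in_prob_algebra K B])
  also have "\<dots> = emeasure (joint unif01 K) (UNIV \<times> B)"
    by (rule emeasure_joint_Times[OF unif01_in_prob_algebra K, symmetric]) auto
  also have "\<dots> = emeasure (distr (joint unif01 K) borel snd) B"
  proof -
    have "snd -` B \<inter> space (joint unif01 K) = UNIV \<times> B" by (auto simp: sp)
    then show ?thesis by (simp add: emeasure_distr)
  qed
  finally show "emeasure (unif01 \<bind> K) B = emeasure unif01 B" by (simp add: copula_law_marginals[OF \<mu>])
qed

text \<open>Uniformity of the first marginal provides the base of the disintegration, uniformity of
  the second the invariance.\<close>

lemma copula_law_kernel: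
  assumes \<mu>: "copula_law \<mu> D"
  obtains K where "prob_kernel K" "joint unif01 K = \<mu>" "unif01 \<bind> K = unif01"
proof -
  note \<mu>p = copula_lawD(1)[OF \<mu>]
  interpret prob_space \<mu> by (rule prob_algebraD[OF \<mu>p])
  have s [measurable_cong]: "sets \<mu> = sets (borel \<Otimes>\<^sub>M borel)" by (rule prob_algebraD[OF \<mu>p])
  obtain K where K: "prob_kernel K"
    and K_eq: "\<And>A B. A \<in> sets borel \<Longrightarrow> B \<in> sets borel \<Longrightarrow> emeasure \<mu> (A \<times> B) = (\<integral>\<^sup>+x\<in>A. emeasure (K x) B \<partial>unif01)"
    using real_disintegration[OF prob_space_axioms s copula_law_marginals(1)[OF \<mu>, symmetric]] by blast
  note Jp = joint_in_prob_algebra[OF unif01_in_prob_algebra K]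
  have J: "emeasure (joint unif01 K) (A \<times> B) = emeasure \<mu> (A \<times> B)" if "A \<in> sets borel" "B \<in> sets borel" for A B
    using that by (simp add: emeasure_joint_Times[OF unif01_in_prob_algebra K] K_eq)
  have joint: "joint unif01 K = \<mu>"
    by (rule measure_eqI_atMost_Times[OF Jp \<mu>p]) (simp add: measure_def J)
  have inv: "unif01 \<bind> K = unif01"
    using \<mu> by (intro joint_invariant[OF K, of D]) (simp add: joint)
  show ?thesis by (rule that[OF K joint inv])
qed

text \<open>The law of two consecutive states and \<open>joint unif01 K\<close> share the copula D
  and hence coincide. So a kernel built from the copula alone serves every chain generated by
  it.\<close>

lemma kernel_chainI:
  assumes chain: "copula_markov_chain D N Y"
    and K: "prob_kernel K" and \<mu>: "copula_law (joint unif01 K) D"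
  shows "kernel_chain N Y unif01 K"
proof -
  have N: "prob_space N" and Y [measurable]: "\<And>i. Y i \<in> borel_measurable N" and markov: "markov_property N Y"
    and law: "\<And>i. distr N borel (Y i) = unif01"
    and cdf: "\<And>i x y. x \<in> {0..1} \<Longrightarrow> y \<in> {0..1} \<Longrightarrow> measure N {\<omega> \<in> space N. Y i \<omega> \<le> x \<and> Y (i + 1) \<omega> \<le> y} = D x y"
    using chain unfolding copula_markov_chain_def by auto
  interpret prob_space N by (rule N)
  show ?thesis
  proof (unfold_locales)
    fix i and A B :: "real set" assume [measurable]: "A \<in> sets borel" "B \<in> sets borel"
    let ?\<nu> = "distr N (borel \<Otimes>\<^sub>M borel) (\<lambda>\<omega>. (Y i \<omega>, Y (i + 1) \<omega>))"
    have vim: "(\<lambda>\<omega>. (Y i \<omega>, Y (i + 1) \<omega>)) -` (A \<times> B) \<inter> space N = Y i -` A \<inter> Y (i + 1) -` B \<inter> space N" for A B by auto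
    have "copula_law ?\<nu> D"
    proof (rule copula_law_of_marginals)
      show "?\<nu> \<in> space (prob_algebra (borel \<Otimes>\<^sub>M borel))"
        by (auto simp: space_prob_algebra intro!: prob_space_distr)
      show "distr ?\<nu> borel fst = unif01" "distr ?\<nu> borel snd = unif01"
        by (simp_all add: distr_distr comp_def law)
      fix x y :: real assume xy: "x \<in> {0..1}" "y \<in> {0..1}"
      have "measure ?\<nu> ({..x} \<times> {..y}) = measure N (Y i -` {..x} \<inter> Y (i + 1) -` {..y} \<inter> space N)"
        by (simp add: measure_distr vim)
      also have "Y i -` {..x} \<inter> Y (i + 1) -` {..y} \<inter> space N = {\<omega> \<in> space N. Y i \<omega> \<le> x \<and> Y (i + 1) \<omega> \<le> y}" by auto
      finally show "measure ?\<nu> ({..x} \<times> {..y}) = D x y" using cdf[OF xy] by simp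
    qed
    from copula_law_unique[OF this \<mu>] have "emeasure ?\<nu> (A \<times> B) = emeasure (joint unif01 K) (A \<times> B)" by simp
    then show "emeasure N (Y i -` A \<inter> Y (i + 1) -` B \<inter> space N) = (\<integral>\<^sup>+x\<in>A. emeasure (K x) B \<partial>unif01)"
      by (simp add: emeasure_distr vim emeasure_joint_Times[OF unif01_in_prob_algebra K])
  qed (fact | rule Y markov law unif01_in_prob_algebra K)+
qed

lemma copula_law_mix:
  assumes P: "prob_kernel P" and Q: "prob_kernel Q" and \<theta>: "0 \<le> \<theta>" "\<theta> \<le> 1"
    and C: "copula_law (joint unif01 P) C" and E: "copula_law (joint unif01 Q) E"
    and D: "\<And>x y. x \<in> {0..1} \<Longrightarrow> y \<in> {0..1} \<Longrightarrow> D x y = (1 - \<theta>) * C x y + \<theta> * E x y"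
  shows "copula_law (joint unif01 (mix_kernel \<theta> P Q)) D"
  unfolding copula_law_def
proof (intro conjI ballI)
  show "joint unif01 (mix_kernel \<theta> P Q) \<in> space (prob_algebra (borel \<Otimes>\<^sub>M borel))"
    by (intro joint_in_prob_algebra unif01_in_prob_algebra measurable_mix_kernel P Q)
  fix x :: real assume x: "x \<in> {0..1}"
  show "D x 1 = x" "D 1 x = x"
    using D[OF x, of 1] D[OF _ x, of 1] copula_lawD(3,4)[OF C x] copula_lawD(3,4)[OF E x] by (simp_all add: algebra_simps)
  fix y :: real assume y: "y \<in> {0..1}"
  show "measure (joint unif01 (mix_kernel \<theta> P Q)) ({..x} \<times> {..y}) = D x y"
    using measure_joint_mix_kernel[OF unif01_in_prob_algebra P Q \<theta>, of "{..x}" "{..y}"]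
    by (simp add: copula_lawD(2)[OF C x y] copula_lawD(2)[OF E x y] D[OF x y])
qed

lemma copula_law_Pi: "copula_law (joint unif01 (\<lambda>_. unif01)) Pi_copula"
proof -
  have K: "prob_kernel (\<lambda>_ :: real. unif01)" by (intro measurable_const unif01_in_prob_algebra)
  interpret U: prob_space unif01 using unif01_in_prob_algebra by (rule prob_algebraD)
  have "measure (joint unif01 (\<lambda>_. unif01)) ({..x} \<times> {..y}) = Pi_copula x y" if "x \<in> {0..1}" "y \<in> {0..1}" for x y
  proof -
    have "emeasure (joint unif01 (\<lambda>_. unif01)) ({..x} \<times> {..y}) = emeasure unif01 {..y} * emeasure unif01 {..x}"
      by (subst emeasure_joint_Times[OF unif01_in_prob_algebra K]) (auto simp: nn_integral_cmult_indicator)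
    also have "\<dots> = ennreal (x * y)"
      using that by (simp add: U.emeasure_eq_measure measure_unif01_atMost ennreal_mult[symmetric] mult.commute)
    finally show ?thesis using that by (simp add: measure_def Pi_copula_def)
  qed
  then show ?thesis
    by (simp add: copula_law_def joint_in_prob_algebra[OF unif01_in_prob_algebra K] Pi_copula_def)
qed

text \<open>M is the law of (U, U) with U uniform, so its kernel never moves.\<close>

lemma copula_law_M: "copula_law (joint unif01 (return borel)) M_copula"
proof -
  have K: "prob_kernel (return borel :: real \<Rightarrow> real measure)" by (rule measurable_return_prob_space)
  interpret U: prob_space unif01 using unif01_in_prob_algebra by (rule prob_algebraD)
  have "measure (joint unif01 (return borel)) ({..x} \<times> {..y}) = M_copula x y" if "x \<in> {0..1}" "y \<in> {0..1}" for x y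
  proof -
    have "emeasure (joint unif01 (return borel)) ({..x} \<times> {..y}) = (\<integral>\<^sup>+z\<in>{..x}. indicator {..y} z \<partial>unif01)"
      by (subst emeasure_joint_Times[OF unif01_in_prob_algebra K]) auto
    also have "\<dots> = (\<integral>\<^sup>+z. indicator {..min x y} z \<partial>unif01)"
      by (intro nn_integral_cong) (auto simp: indicator_def)
    also have "\<dots> = ennreal (min x y)"
      using that by (auto simp: U.emeasure_eq_measure measure_unif01_atMost min_def)
    finally show ?thesis using that by (simp add: measure_def M_copula_def)
  qed
  then show ?thesis
    by (simp add: copula_law_def joint_in_prob_algebra[OF unif01_in_prob_algebra K] M_copula_def)
qed

section \<open>Mixing of the chains of convex combinations\<close>

lemma (in kernel_chain) absolutely_regular_if_tv:
  assumes "(\<lambda>n. \<integral>z. tv (kpow K n (fst z)) (kpow K n (snd z)) \<partial>(L \<Otimes>\<^sub>M L)) \<longlonglongrightarrow> 0" and inv: "L \<bind> K = L"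
  shows "absolutely_regular N Y"
  unfolding absolutely_regular_def
proof (rule tendsto_sandwich[OF _ _ tendsto_const assms(1)])
  show "\<forall>\<^sub>F n in sequentially. 0 \<le> beta_mix N Y n"
    using order_trans[OF tv_le_beta_mix(2)[OF inv] tv_le_beta_mix(1)[OF inv]] by (intro always_eventually) blast
qed (intro always_eventually allI beta_mix_le)

lemma (in kernel_chain) tv_tendsto_0_if_absolutely_regular:
  assumes "absolutely_regular N Y" and inv: "L \<bind> K = L"
  shows "(\<lambda>n. \<integral>x. tv (kpow K n x) L \<partial>L) \<longlonglongrightarrow> 0"
  using assms(1) unfolding absolutely_regular_def
  by (rule tendsto_sandwich[OF _ _ tendsto_const, rotated 2])
    (use tv_le_beta_mix[OF inv] in \<open>auto intro!: always_eventually\<close>)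

lemma geometrically_ergodic_mix_Pi:
  assumes "copula C" and \<theta>: "0 < \<theta>" "\<theta> \<le> 1" and chain: "copula_markov_chain (C_tilde C \<theta>) N Y"
  shows "geometrically_ergodic N Y"
proof -
  obtain \<mu> where \<mu>: "copula_law \<mu> C" by (rule copula_imp_law[OF assms(1)])
  obtain P where P: "prob_kernel P" "joint unif01 P = \<mu>" by (rule copula_law_kernel[OF \<mu>])
  define K where "K = mix_kernel \<theta> P (\<lambda>_. unif01)"
  have U: "prob_kernel (\<lambda>_ :: real. unif01)" by (intro measurable_const unif01_in_prob_algebra)
  have K: "prob_kernel K" unfolding K_def by (intro measurable_mix_kernel P U)
  have "copula_law (joint unif01 K) (C_tilde C \<theta>)"
    unfolding K_def using \<theta> \<mu> P
    by (intro copula_law_mix[OF P(1) U _ _ _ copula_law_Pi]) (auto simp: C_tilde_def algebra_simps)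
  then interpret kernel_chain N Y unif01 K by (rule kernel_chainI[OF chain K])
  interpret U: prob_space unif01 using unif01_in_prob_algebra by (rule prob_algebraD)
  interpret UU: pair_prob_space unif01 unif01 ..
  \<comment> \<open>For \<theta> = 1 the contraction factor 1 - \<theta> is 0, whereas the rate has
    to be positive; 1/2 is an arbitrary floor.\<close>
  let ?r = "max (1 - \<theta>) (1 / 2)"
  have "beta_mix N Y n \<le> 1 * ?r ^ n" for n
  proof -
    note Kn = prob_kernel_kpow[OF K, of n]
    have "beta_mix N Y n \<le> (\<integral>z. tv (kpow K n (fst z)) (kpow K n (snd z)) \<partial>(unif01 \<Otimes>\<^sub>M unif01))"
      by (rule beta_mix_le)
    also have "\<dots> \<le> (\<integral>z. ?r ^ n \<partial>(unif01 \<Otimes>\<^sub>M unif01))"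
    proof (rule integral_mono)
      have "(\<lambda>z. tv (kpow K n (fst z)) (kpow K n (snd z))) \<in> borel_measurable (borel \<Otimes>\<^sub>M borel)"
        by (intro borel_measurable_tv measurable_compose[OF measurable_fst Kn] measurable_compose[OF measurable_snd Kn])
      then have m: "(\<lambda>z. tv (kpow K n (fst z)) (kpow K n (snd z))) \<in> borel_measurable (unif01 \<Otimes>\<^sub>M unif01)" by measurable
      show "integrable (unif01 \<Otimes>\<^sub>M unif01) (\<lambda>z. tv (kpow K n (fst z)) (kpow K n (snd z)))"
        by (rule integrable_bounded[OF UU.prob_space_axioms m, of 1])
          (simp add: abs_of_nonneg tv_nonneg tv_le_1 prob_kernelD[OF Kn])
      fix z :: "real \<times> real"
      have "tv (kpow K n (fst z)) (kpow K n (snd z)) \<le> (1 - \<theta>) ^ n"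
        unfolding K_def using \<theta> by (intro tv_kpow_mix_const_le unif01_in_prob_algebra P) auto
      also have "\<dots> \<le> ?r ^ n" using \<theta> by (intro power_mono) auto
      finally show "tv (kpow K n (fst z)) (kpow K n (snd z)) \<le> ?r ^ n" .
    qed simp
    finally show ?thesis by (simp add: UU.prob_space)
  qed
  moreover have "0 < ?r" "?r < 1" using \<theta> by auto
  ultimately show ?thesis unfolding geometrically_ergodic_def by blast
qed

text \<open>As long as \<open>C\<close> keeps positive weight, the copula E mixed in is arbitrary;
  this serves M as well as \<open>C_one C\<close>.\<close>

lemma absolutely_regular_mix:
  assumes \<theta>: "0 \<le> \<theta>" "\<theta> < 1" and \<mu>: "copula_law \<mu> C" and \<nu>: "copula_law \<nu> E"
    and X: "copula_markov_chain C M X" "absolutely_regular M X"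
    and Y: "copula_markov_chain D N Y"
    and D: "\<And>x y. x \<in> {0..1} \<Longrightarrow> y \<in> {0..1} \<Longrightarrow> D x y = (1 - \<theta>) * C x y + \<theta> * E x y"
  shows "absolutely_regular N Y"
proof -
  obtain P where P: "prob_kernel P" "joint unif01 P = \<mu>" "unif01 \<bind> P = unif01" by (rule copula_law_kernel[OF \<mu>])
  obtain Q where Q: "prob_kernel Q" "joint unif01 Q = \<nu>" by (rule copula_law_kernel[OF \<nu>])
  define K where "K = mix_kernel \<theta> P Q"
  have K: "prob_kernel K" unfolding K_def by (intro measurable_mix_kernel P Q)
  have law: "copula_law (joint unif01 K) D"
    unfolding K_def using \<theta> \<mu> \<nu> P Q D by (intro copula_law_mix[OF P(1) Q(1)]) auto
  have inv: "unif01 \<bind> K = unif01" by (rule joint_invariant[OF K law])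
  interpret X: kernel_chain M X unif01 P using \<mu> P by (intro kernel_chainI[OF X(1)]) auto
  interpret Y: kernel_chain N Y unif01 K by (rule kernel_chainI[OF Y K law])
  show ?thesis
    using X.tv_tendsto_0_if_absolutely_regular[OF X(2) P(3)]
    by (intro Y.absolutely_regular_if_tv inv, unfold K_def)
      (intro tv_kpow_mix_tendsto_0 unif01_in_prob_algebra P Q inv[unfolded K_def] \<theta>)
qed

section \<open>The perturbation by \<open>C_one\<close>\<close>

definition max_pair :: "(real \<times> real) \<times> (real \<times> real) \<Rightarrow> real \<times> real" where
  "max_pair = (\<lambda>(p, q). (max (fst p) (fst q), max (snd p) (snd q)))"

definition min_pair :: "(real \<times> real) \<times> (real \<times> real) \<Rightarrow> real \<times> real" where
  "min_pair = (\<lambda>(p, q). (min (fst p) (fst q), min (snd p) (snd q)))"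

text \<open>If \<open>(U, V)\<close> and \<open>(U', V')\<close> are independent with law \<open>C\<close>, then \<open>C_one C\<close> is the fair mixture of the
  laws of \<open>(max U U', max V V')\<close> and \<open>(min U U', min V V')\<close>.\<close>

definition order_law :: "(real \<times> real) measure \<Rightarrow> (real \<times> real) measure" where
  "order_law \<mu> = mix_measure (1 / 2) (distr (\<mu> \<Otimes>\<^sub>M \<mu>) (borel \<Otimes>\<^sub>M borel) max_pair)
     (distr (\<mu> \<Otimes>\<^sub>M \<mu>) (borel \<Otimes>\<^sub>M borel) min_pair)"

lemma measurable_max_pair [measurable]: "max_pair \<in> (borel \<Otimes>\<^sub>M borel) \<Otimes>\<^sub>M (borel \<Otimes>\<^sub>M borel) \<rightarrow>\<^sub>M borel \<Otimes>\<^sub>M borel"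
  and measurable_min_pair [measurable]: "min_pair \<in> (borel \<Otimes>\<^sub>M borel) \<Otimes>\<^sub>M (borel \<Otimes>\<^sub>M borel) \<rightarrow>\<^sub>M borel \<Otimes>\<^sub>M borel"
  unfolding max_pair_def min_pair_def by measurable

context
  fixes \<mu> :: "(real \<times> real) measure" and C :: "real \<Rightarrow> real \<Rightarrow> real"
  assumes \<mu>: "copula_law \<mu> C"
begin

lemma law_prob: "prob_space \<mu>" and law_sets [measurable_cong]: "sets \<mu> = sets (borel \<Otimes>\<^sub>M borel)"
  and law_space: "space \<mu> = UNIV"
  using prob_algebraD[OF copula_lawD(1)[OF \<mu>]] by (simp_all add: space_pair_measure)

interpretation prob_space \<mu> by (rule law_prob)
interpretation PP: pair_prob_space \<mu> \<mu> ..

lemma extreme_laws_in_prob_algebra: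
  "distr (\<mu> \<Otimes>\<^sub>M \<mu>) (borel \<Otimes>\<^sub>M borel) max_pair \<in> space (prob_algebra (borel \<Otimes>\<^sub>M borel))"
  "distr (\<mu> \<Otimes>\<^sub>M \<mu>) (borel \<Otimes>\<^sub>M borel) min_pair \<in> space (prob_algebra (borel \<Otimes>\<^sub>M borel))"
  by (auto simp: space_prob_algebra intro!: PP.prob_space_distr)

lemma measure_square:
  assumes "A \<in> sets (borel \<Otimes>\<^sub>M borel)"
  shows "PP.prob (A \<times> A) = (prob A)\<^sup>2"
  using assms law_sets
  by (simp add: measure_def emeasure_pair_measure_Times enn2real_mult power2_eq_square)

text \<open>The maximum of two independent points lies in a lower quadrant exactly when both points
  do, whence C^2. The minimum lies in it unless both first coordinates exceed x or both second ones
  exceed y, which inclusion-exclusion evaluates. The mean of the two polynomials is C + (x - C)(y -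
  C).\<close>

lemma copula_law_order_law: "copula_law (order_law \<mu>) (C_one C)"
  unfolding copula_law_def
proof (intro conjI ballI)
  show "order_law \<mu> \<in> space (prob_algebra (borel \<Otimes>\<^sub>M borel))"
    unfolding order_law_def by (rule mix_measure_in_prob_algebra[OF extreme_laws_in_prob_algebra])
  fix x :: real assume x: "x \<in> {0..1}"
  show "C_one C x 1 = x" "C_one C 1 x = x"
    using copula_lawD(3,4)[OF \<mu> x] by (simp_all add: C_one_def)
  fix y :: real assume y: "y \<in> {0..1}"
  have spPP: "space (\<mu> \<Otimes>\<^sub>M \<mu>) = UNIV" by (simp add: space_pair_measure law_space)
  let ?A = "{x<..} \<times> (UNIV :: real set)" and ?B = "(UNIV :: real set) \<times> {y<..}"
  have cdfs: "prob ({..x} \<times> {..y}) = C x y" "prob ({..x} \<times> UNIV) = x" "prob (UNIV \<times> {..y}) = y"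
  proof -
    show "prob ({..x} \<times> {..y}) = C x y" by (rule copula_lawD(2)[OF \<mu> x y])
    have "({..x} \<times> UNIV) \<inter> {..1} \<times> {..1} = {..x} \<times> {..1::real}" "(UNIV \<times> {..y}) \<inter> {..1} \<times> {..1} = {..1::real} \<times> {..y}"
      using x y by auto
    then show "prob ({..x} \<times> UNIV) = x" "prob (UNIV \<times> {..y}) = y"
      using copula_law_unit_square[OF \<mu>, of "{..x} \<times> UNIV"] copula_law_unit_square[OF \<mu>, of "UNIV \<times> {..y}"]
        copula_lawD(2)[OF \<mu>, of x 1] copula_lawD(2)[OF \<mu>, of 1 y] copula_lawD(3)[OF \<mu> x] copula_lawD(4)[OF \<mu> y] x y
      by simp_all
  qed
  have pA: "prob ?A = 1 - x" and pB: "prob ?B = 1 - y"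
  proof -
    have "?A = space \<mu> - {..x} \<times> UNIV" "?B = space \<mu> - UNIV \<times> {..y}" by (auto simp: law_space)
    then show "prob ?A = 1 - x" "prob ?B = 1 - y"
      using prob_compl[of "{..x} \<times> UNIV"] prob_compl[of "UNIV \<times> {..y}"] by (simp_all add: cdfs)
  qed
  have "{..x} \<times> {..y} = space \<mu> - (?A \<union> ?B)" by (auto simp: law_space)
  then have "C x y = 1 - prob (?A \<union> ?B)" using prob_compl[of "?A \<union> ?B"] by (simp add: cdfs(1)[symmetric])
  moreover have "prob (?A \<union> ?B) = prob ?A + prob ?B - prob (?A \<inter> ?B)"
    using measure_Un3[of ?A \<mu> ?B] by (simp add: fmeasurable_eq_sets)
  ultimately have pAB: "prob (?A \<inter> ?B) = 1 - x - y + C x y" by (simp add: pA pB)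
  have mx: "measure (distr (\<mu> \<Otimes>\<^sub>M \<mu>) (borel \<Otimes>\<^sub>M borel) max_pair) ({..x} \<times> {..y}) = (C x y)\<^sup>2"
  proof -
    have "max_pair -` ({..x} \<times> {..y}) \<inter> space (\<mu> \<Otimes>\<^sub>M \<mu>) = ({..x} \<times> {..y}) \<times> ({..x} \<times> {..y})"
      by (auto simp: max_pair_def spPP)
    then show ?thesis using measure_square[of "{..x} \<times> {..y}"] by (simp add: measure_distr cdfs)
  qed
  have mn: "measure (distr (\<mu> \<Otimes>\<^sub>M \<mu>) (borel \<Otimes>\<^sub>M borel) min_pair) ({..x} \<times> {..y}) =
    1 - ((1 - x)\<^sup>2 + (1 - y)\<^sup>2 - (1 - x - y + C x y)\<^sup>2)"
  proof -
    have "min_pair -` ({..x} \<times> {..y}) \<inter> space (\<mu> \<Otimes>\<^sub>M \<mu>) = space (\<mu> \<Otimes>\<^sub>M \<mu>) - (?A \<times> ?A \<union> ?B \<times> ?B)"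
      by (auto simp: min_pair_def spPP min_le_iff_disj)
    then have "measure (distr (\<mu> \<Otimes>\<^sub>M \<mu>) (borel \<Otimes>\<^sub>M borel) min_pair) ({..x} \<times> {..y}) = 1 - PP.prob (?A \<times> ?A \<union> ?B \<times> ?B)"
      using PP.prob_compl[of "?A \<times> ?A \<union> ?B \<times> ?B"] by (simp add: measure_distr)
    also have "PP.prob (?A \<times> ?A \<union> ?B \<times> ?B) = PP.prob (?A \<times> ?A) + PP.prob (?B \<times> ?B) - PP.prob ((?A \<times> ?A) \<inter> (?B \<times> ?B))"
      using measure_Un3[of "?A \<times> ?A" "\<mu> \<Otimes>\<^sub>M \<mu>" "?B \<times> ?B"] by (simp add: PP.fmeasurable_eq_sets)
    also have "(?A \<times> ?A) \<inter> (?B \<times> ?B) = (?A \<inter> ?B) \<times> (?A \<inter> ?B)" by auto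
    finally have eq: "measure (distr (\<mu> \<Otimes>\<^sub>M \<mu>) (borel \<Otimes>\<^sub>M borel) min_pair) ({..x} \<times> {..y}) =
      1 - (PP.prob (?A \<times> ?A) + PP.prob (?B \<times> ?B) - PP.prob ((?A \<inter> ?B) \<times> (?A \<inter> ?B)))" .
    have sq: "PP.prob (?A \<times> ?A) = (prob ?A)\<^sup>2" "PP.prob (?B \<times> ?B) = (prob ?B)\<^sup>2"
      "PP.prob ((?A \<inter> ?B) \<times> (?A \<inter> ?B)) = (prob (?A \<inter> ?B))\<^sup>2"
      by (rule measure_square, measurable)+
    show ?thesis unfolding eq sq pA pB pAB ..
  qed
  have "measure (order_law \<mu>) ({..x} \<times> {..y}) =
    (1 - 1 / 2) * (C x y)\<^sup>2 + 1 / 2 * (1 - ((1 - x)\<^sup>2 + (1 - y)\<^sup>2 - (1 - x - y + C x y)\<^sup>2))"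
    unfolding order_law_def mx[symmetric] mn[symmetric]
    by (intro measure_convex_combination[OF extreme_laws_in_prob_algebra] emeasure_mix_measure[OF extreme_laws_in_prob_algebra]) auto
  also have "\<dots> = C_one C x y"
    by (simp add: C_one_def power2_eq_square algebra_simps)
  finally show "measure (order_law \<mu>) ({..x} \<times> {..y}) = C_one C x y" .
qed

lemma emeasure_order_law:
  assumes "A \<in> sets (borel \<Otimes>\<^sub>M borel)"
  shows "emeasure (order_law \<mu>) A = ennreal (1 / 2) * emeasure (distr (\<mu> \<Otimes>\<^sub>M \<mu>) (borel \<Otimes>\<^sub>M borel) max_pair) A +
    ennreal (1 / 2) * emeasure (distr (\<mu> \<Otimes>\<^sub>M \<mu>) (borel \<Otimes>\<^sub>M borel) min_pair) A"
  unfolding order_law_def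
  by (subst emeasure_mix_measure[OF extreme_laws_in_prob_algebra]) (use assms in auto)

text \<open>Two independent points of a rectangle have their coordinatewise maximum in the rectangle.\<close>

lemma order_law_rectangle:
  assumes [measurable]: "A \<in> sets borel" "B \<in> sets borel" and "emeasure (order_law \<mu>) (A \<times> B) = 0"
  shows "emeasure \<mu> (A \<times> B) = 0"
proof -
  have "emeasure \<mu> (A \<times> B) * emeasure \<mu> (A \<times> B) = emeasure (\<mu> \<Otimes>\<^sub>M \<mu>) ((A \<times> B) \<times> (A \<times> B))"
    by (rule emeasure_pair_measure_Times[symmetric]) (simp_all add: law_sets)
  also have "\<dots> \<le> emeasure (\<mu> \<Otimes>\<^sub>M \<mu>) (max_pair -` (A \<times> B) \<inter> space (\<mu> \<Otimes>\<^sub>M \<mu>))"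
  proof (rule emeasure_mono)
    show "(A \<times> B) \<times> (A \<times> B) \<subseteq> max_pair -` (A \<times> B) \<inter> space (\<mu> \<Otimes>\<^sub>M \<mu>)"
      by (auto simp: max_pair_def max_def space_pair_measure law_space)
  qed measurable
  also have "\<dots> = emeasure (distr (\<mu> \<Otimes>\<^sub>M \<mu>) (borel \<Otimes>\<^sub>M borel) max_pair) (A \<times> B)"
    by (simp add: emeasure_distr)
  also have "\<dots> = 0" using assms(3) by (simp add: emeasure_order_law)
  finally show ?thesis by simp
qed

text \<open>When \<open>U > U'\<close> and \<open>V' > V\<close> the coordinatewise maximum is \<open>(U, V')\<close>, whose two coordinates are
  independent: this gives \<open>order_law \<mu>\<close> an absolutely continuous part.\<close>

lemma order_law_ac_part:
  obtains h :: "real \<times> real \<Rightarrow> ennreal" where "h \<in> borel_measurable (borel \<Otimes>\<^sub>M borel)"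
    "\<And>A B. A \<in> sets borel \<Longrightarrow> B \<in> sets borel \<Longrightarrow>
      (\<integral>\<^sup>+z\<in>A \<times> B. h z \<partial>(unif01 \<Otimes>\<^sub>M unif01)) \<le> 2 * emeasure (order_law \<mu>) (A \<times> B)"
    "emeasure \<mu> ({1/2<..} \<times> {..1/2}) * emeasure \<mu> ({..1/2} \<times> {1/2<..}) \<le> (\<integral>\<^sup>+z. h z \<partial>(unif01 \<Otimes>\<^sub>M unif01))"
proof -
  let ?UU = "unif01 \<Otimes>\<^sub>M unif01"
  define W where "W = {w :: (real \<times> real) \<times> (real \<times> real). fst (snd w) < fst (fst w) \<and> snd (fst w) < snd (snd w)}"
  \<comment> \<open>Without the restriction to W, f maps the product law to the uniform product law;
    restricting keeps the image below it, so a density exists.\<close>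
  define f where "f = (\<lambda>(p :: real \<times> real, q :: real \<times> real). (fst p, snd q))"
  have [measurable]: "W \<in> sets ((borel \<Otimes>\<^sub>M borel) \<Otimes>\<^sub>M (borel \<Otimes>\<^sub>M borel))"
  proof -
    have "{w \<in> space ((borel \<Otimes>\<^sub>M borel) \<Otimes>\<^sub>M (borel \<Otimes>\<^sub>M borel)). fst (snd w) < fst (fst w) \<and> snd (fst w) < snd (snd w)}
      \<in> sets ((borel \<Otimes>\<^sub>M borel) \<Otimes>\<^sub>M (borel \<Otimes>\<^sub>M borel :: (real \<times> real) measure))" by measurable
    then show ?thesis by (simp add: W_def space_pair_measure)
  qed
  have f_meas [measurable]: "f \<in> (borel \<Otimes>\<^sub>M borel) \<Otimes>\<^sub>M (borel \<Otimes>\<^sub>M borel) \<rightarrow>\<^sub>M borel \<Otimes>\<^sub>M borel"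
    unfolding f_def by measurable
  define \<Gamma> where "\<Gamma> = distr (density (\<mu> \<Otimes>\<^sub>M \<mu>) (indicator W)) (borel \<Otimes>\<^sub>M borel) f"
  have \<Gamma>: "emeasure \<Gamma> S = emeasure (\<mu> \<Otimes>\<^sub>M \<mu>) (W \<inter> f -` S)" if [measurable]: "S \<in> sets (borel \<Otimes>\<^sub>M borel)" for S
  proof -
    have spPP: "space (\<mu> \<Otimes>\<^sub>M \<mu>) = UNIV" by (simp add: space_pair_measure law_space)
    have fS: "f -` S \<in> sets (\<mu> \<Otimes>\<^sub>M \<mu>)"
      using measurable_sets[of f "\<mu> \<Otimes>\<^sub>M \<mu>" "borel \<Otimes>\<^sub>M borel" S] by (simp add: spPP)
    have "emeasure \<Gamma> S = (\<integral>\<^sup>+w. indicator W w * indicator (f -` S) w \<partial>(\<mu> \<Otimes>\<^sub>M \<mu>))"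
      unfolding \<Gamma>_def by (subst emeasure_distr) (simp_all add: spPP emeasure_density fS)
    also have "\<dots> = (\<integral>\<^sup>+w. indicator (W \<inter> f -` S) w \<partial>(\<mu> \<Otimes>\<^sub>M \<mu>))" by (simp add: indicator_inter_arith)
    finally show ?thesis using fS by simp
  qed
  have f_law: "distr (\<mu> \<Otimes>\<^sub>M \<mu>) (borel \<Otimes>\<^sub>M borel) f = ?UU"
  proof -
    have "sigma_finite_measure (distr \<mu> borel snd)"
      unfolding copula_law_marginals(2)[OF \<mu>]
      by (rule prob_space_imp_sigma_finite[OF prob_algebraD(1)[OF unif01_in_prob_algebra]])
    then show ?thesis
      using pair_measure_distr[of fst \<mu> borel snd \<mu> borel] copula_law_marginals[OF \<mu>]
      by (simp add: f_def)
  qed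
  interpret U: prob_space unif01 using unif01_in_prob_algebra by (rule prob_algebraD)
  interpret UU: pair_prob_space unif01 unif01 ..
  have sets_\<Gamma>: "sets \<Gamma> = sets ?UU" by (simp add: \<Gamma>_def cong: sets_pair_measure_cong)
  have sets_UU: "sets ?UU = sets (borel \<Otimes>\<^sub>M borel)" by (simp cong: sets_pair_measure_cong)
  have \<Gamma>_le: "emeasure \<Gamma> S \<le> emeasure ?UU S" if [measurable]: "S \<in> sets (borel \<Otimes>\<^sub>M borel)" for S
  proof -
    have spPP: "space (\<mu> \<Otimes>\<^sub>M \<mu>) = UNIV" by (simp add: space_pair_measure law_space)
    have fS: "f -` S \<in> sets (\<mu> \<Otimes>\<^sub>M \<mu>)"
      using measurable_sets[of f "\<mu> \<Otimes>\<^sub>M \<mu>" "borel \<Otimes>\<^sub>M borel" S] by (simp add: spPP)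
    have "emeasure (\<mu> \<Otimes>\<^sub>M \<mu>) (W \<inter> f -` S) \<le> emeasure (\<mu> \<Otimes>\<^sub>M \<mu>) (f -` S)" using fS by (intro emeasure_mono) auto
    also have "\<dots> = emeasure ?UU S" unfolding f_law[symmetric] by (simp add: emeasure_distr spPP)
    finally show ?thesis by (simp add: \<Gamma>)
  qed
  have "absolutely_continuous ?UU \<Gamma>"
    unfolding absolutely_continuous_def
  proof
    fix S assume "S \<in> null_sets ?UU"
    then have "S \<in> sets (borel \<Otimes>\<^sub>M borel)" "emeasure ?UU S = 0" by (auto simp: sets_UU)
    with \<Gamma>_le[of S] show "S \<in> null_sets \<Gamma>" by (simp add: null_sets_def sets_\<Gamma> sets_UU)
  qed
  from UU.Radon_Nikodym[OF this sets_\<Gamma>] obtain h where h: "h \<in> borel_measurable ?UU" "density ?UU h = \<Gamma>" by blast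
  have h': "h \<in> borel_measurable (borel \<Otimes>\<^sub>M borel)" using h(1) measurable_cong_sets[OF sets_UU refl] by blast
  have h_int: "(\<integral>\<^sup>+z\<in>S. h z \<partial>?UU) = emeasure (\<mu> \<Otimes>\<^sub>M \<mu>) (W \<inter> f -` S)" if "S \<in> sets (borel \<Otimes>\<^sub>M borel)" for S
    using that by (simp add: \<Gamma>[symmetric] h(2)[symmetric] emeasure_density h(1) sets_UU)
  show ?thesis
  proof (rule that[OF h'])
    fix A B :: "real set" assume [measurable]: "A \<in> sets borel" "B \<in> sets borel"
    have "(\<integral>\<^sup>+z\<in>A \<times> B. h z \<partial>?UU) = emeasure (\<mu> \<Otimes>\<^sub>M \<mu>) (W \<inter> f -` (A \<times> B))" by (rule h_int) simp
    also have "\<dots> \<le> emeasure (\<mu> \<Otimes>\<^sub>M \<mu>) (max_pair -` (A \<times> B) \<inter> space (\<mu> \<Otimes>\<^sub>M \<mu>))"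
    proof (rule emeasure_mono)
      show "W \<inter> f -` (A \<times> B) \<subseteq> max_pair -` (A \<times> B) \<inter> space (\<mu> \<Otimes>\<^sub>M \<mu>)"
        by (auto simp: W_def f_def max_pair_def max_def space_pair_measure law_space)
    qed measurable
    also have "\<dots> = emeasure (distr (\<mu> \<Otimes>\<^sub>M \<mu>) (borel \<Otimes>\<^sub>M borel) max_pair) (A \<times> B)"
      by (simp add: emeasure_distr)
    \<comment> \<open>The maximum carries weight 1/2 in \<open>order_law\<close>.\<close>
    also have "\<dots> = 2 * (ennreal (1 / 2) * emeasure (distr (\<mu> \<Otimes>\<^sub>M \<mu>) (borel \<Otimes>\<^sub>M borel) max_pair) (A \<times> B))"
    proof -
      have "(2 :: ennreal) * ennreal (1 / 2) = ennreal 2 * ennreal (1 / 2)" by simp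
      also have "\<dots> = 1" by (simp only: ennreal_mult[symmetric]) simp
      finally show ?thesis by (simp only: mult.assoc[symmetric] mult_1)
    qed
    also have "\<dots> \<le> 2 * emeasure (order_law \<mu>) (A \<times> B)"
      by (simp add: emeasure_order_law mult_left_mono)
    finally show "(\<integral>\<^sup>+z\<in>A \<times> B. h z \<partial>?UU) \<le> 2 * emeasure (order_law \<mu>) (A \<times> B)" .
  next
    \<comment> \<open>If the first point lies right of and below 1/2 and the second left of and
      above it, both inequalities of W hold; this reduces positivity to crossings of the
      median.\<close>
    have "emeasure \<mu> ({1/2<..} \<times> {..1/2}) * emeasure \<mu> ({..1/2} \<times> {1/2<..}) =
      emeasure (\<mu> \<Otimes>\<^sub>M \<mu>) (({1/2<..} \<times> {..1/2}) \<times> ({..1/2} \<times> {1/2<..}))"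
      by (rule emeasure_pair_measure_Times[symmetric]) (simp_all add: law_sets)
    also have "\<dots> \<le> emeasure (\<mu> \<Otimes>\<^sub>M \<mu>) (W \<inter> f -` UNIV)"
    proof (rule emeasure_mono)
      show "({1/2<..} \<times> {..1/2}) \<times> ({..1/2} \<times> {1/2<..}) \<subseteq> W \<inter> f -` UNIV" by (auto simp: W_def)
    qed simp
    also have "\<dots> = (\<integral>\<^sup>+z\<in>UNIV. h z \<partial>?UU)"
      by (rule h_int[symmetric]) (use sets.top[of "borel \<Otimes>\<^sub>M borel :: (real \<times> real) measure"] in \<open>simp add: space_pair_measure\<close>)
    finally show "emeasure \<mu> ({1/2<..} \<times> {..1/2}) * emeasure \<mu> ({..1/2} \<times> {1/2<..}) \<le> (\<integral>\<^sup>+z. h z \<partial>?UU)" by simp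
  qed
qed

text \<open>Otherwise a half-line of uniform measure 1/2 could never be left, against mixing. The
  statement on product chains is applied to a set that depends on the first coordinate only.\<close>

lemma mixing_crosses_half:
  assumes P: "prob_kernel P" "joint unif01 P = \<mu>" "unif01 \<bind> P = unif01"
    and mix: "(\<lambda>n. \<integral>x. tv (kpow P n x) unif01 \<partial>unif01) \<longlonglongrightarrow> 0"
  shows "emeasure \<mu> ({..1/2} \<times> {1/2<..}) \<noteq> 0" "emeasure \<mu> ({1/2<..} \<times> {..1/2}) \<noteq> 0"
proof -
  let ?UU = "unif01 \<Otimes>\<^sub>M unif01"
  interpret U: prob_space unif01 using unif01_in_prob_algebra by (rule prob_algebraD)
  interpret UU: pair_prob_space unif01 unif01 ..
  have half: "measure unif01 {..1/2} = 1/2" by (simp add: measure_unif01_atMost)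
  have half': "measure unif01 {1/2<..} = 1/2"
  proof -
    have "{1/2<..} = space unif01 - {..1/2}" by auto
    then show ?thesis using U.prob_compl[of "{..1/2}"] half by simp
  qed
  have key: "emeasure \<mu> (A \<times> - A) \<noteq> 0" if A [measurable]: "A \<in> sets borel" and A2: "measure unif01 (- A) = 1/2" for A
  proof
    assume "emeasure \<mu> (A \<times> - A) = 0"
    then have "(\<integral>\<^sup>+x\<in>A. emeasure (P x) (- A) \<partial>unif01) = 0"
      by (simp add: P(2)[symmetric] emeasure_joint_Times[OF unif01_in_prob_algebra P(1)])
    moreover have [measurable]: "(\<lambda>x. emeasure (P x) (- A)) \<in> borel_measurable borel"
      by (intro measurable_emeasure_kernel[OF measurable_prob_algebraD[OF P(1)]]) simp
    ultimately have ae: "AE x in unif01. emeasure (P x) (- A) * indicator A x = 0"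
      by (subst (asm) nn_integral_0_iff_AE) auto
    define S where "S = (- A) \<times> (UNIV :: real set)"
    have S [measurable]: "S \<in> sets (borel \<Otimes>\<^sub>M borel)" unfolding S_def by measurable
    have "AE z in ?UU. emeasure (P (fst z)) (- A) * indicator A (fst z) = 0"
    proof (rule UU.AE_pair_measure)
      show "AE x in unif01. AE y in unif01. emeasure (P (fst (x, y))) (- A) * indicator A (fst (x, y)) = 0"
        using ae by eventually_elim simp
    qed measurable
    then have "AE z in ?UU. z \<notin> S \<longrightarrow> emeasure (P (fst z) \<Otimes>\<^sub>M P (snd z)) S = 0"
    proof eventually_elim
      case (elim z)
      have "sigma_finite_measure (P (snd z))"
        using prob_algebraD(1)[OF prob_kernelD[OF P(1)]] by (rule prob_space_imp_sigma_finite)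
      then have "emeasure (P (fst z) \<Otimes>\<^sub>M P (snd z)) S = emeasure (P (fst z)) (- A) * emeasure (P (snd z)) UNIV"
        unfolding S_def by (rule sigma_finite_measure.emeasure_pair_measure_Times)
          (use A in \<open>simp_all add: prob_algebraD(2)[OF prob_kernelD[OF P(1)]]\<close>)
      with elim show ?case by (auto simp: S_def mem_Times_iff)
    qed
    from mixing_absorbing_trivial[OF unif01_in_prob_algebra P(1) P(3) mix S this]
    have "UU.prob S = 0 \<or> UU.prob S = 1" .
    moreover have "UU.prob S = measure unif01 (- A) * measure unif01 UNIV"
      unfolding S_def using A by (simp add: measure_def U.emeasure_pair_measure_Times enn2real_mult)
    ultimately show False using A2 U.prob_space by simp
  qed
  have "- {..1/2} = ({1/2<..} :: real set)" "- {1/2<..} = ({..1/2} :: real set)" by auto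
  then show "emeasure \<mu> ({..1/2} \<times> {1/2<..}) \<noteq> 0" "emeasure \<mu> ({1/2<..} \<times> {..1/2}) \<noteq> 0"
    using key[of "{..1/2}"] key[of "{1/2<..}"] half half' by auto
qed

end

section \<open>Nonsingularity from an absolutely continuous part\<close>

text \<open>Singularity of K x and K x' forces h(x, .) and h(x', .) to have disjoint supports, as
  each is the density of a measure dominated by twice the law. If almost all pairs were singular,
  integrating h(x, y) h(x', y) over x and x' would make the square of \<open>\<phi> y\<close> vanish
  for almost every y, so h would have integral 0.\<close>

lemma not_AE_tv_eq_1_if_ac_part:
  fixes L :: "'a::polish_space measure" and h :: "'a \<times> 'a \<Rightarrow> ennreal"
  assumes L: "L \<in> space (prob_algebra borel)" and K: "prob_kernel K"
    and h: "h \<in> borel_measurable (borel \<Otimes>\<^sub>M borel)"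
    and h_le: "\<And>A B. A \<in> sets borel \<Longrightarrow> B \<in> sets borel \<Longrightarrow>
      (\<integral>\<^sup>+z\<in>A \<times> B. h z \<partial>(L \<Otimes>\<^sub>M L)) \<le> 2 * emeasure (joint L K) (A \<times> B)"
    and h_pos: "(\<integral>\<^sup>+z. h z \<partial>(L \<Otimes>\<^sub>M L)) \<noteq> 0"
  shows "\<not> (AE z in L \<Otimes>\<^sub>M L. tv (K (fst z)) (K (snd z)) = 1)"
proof
  assume sing: "AE z in L \<Otimes>\<^sub>M L. tv (K (fst z)) (K (snd z)) = 1"
  interpret L: prob_space L by (rule prob_algebraD[OF L])
  interpret LL: pair_prob_space L L ..
  have s [measurable_cong]: "sets L = sets borel" by (rule prob_algebraD[OF L])
  have spL: "space L = UNIV" using prob_algebraD(3)[OF L] by simp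
  note Kx = prob_kernelD[OF K]
  note h [measurable]
  define H where "H x B = (\<integral>\<^sup>+y\<in>B. h (x, y) \<partial>L)" for x B
  have H_meas: "(\<lambda>x. H x B) \<in> borel_measurable borel" if [measurable]: "B \<in> sets borel" for B
  proof -
    have "(\<lambda>(x, y). h (x, y) * indicator B y) \<in> borel_measurable (borel \<Otimes>\<^sub>M L)" by simp
    then show ?thesis unfolding H_def by (rule L.borel_measurable_nn_integral)
  qed
  have K_meas: "(\<lambda>x. emeasure (K x) B) \<in> borel_measurable borel" if "B \<in> sets borel" for B
    by (rule measurable_emeasure_kernel[OF measurable_prob_algebraD[OF K] that])
  have HK: "AE x in L. H x B \<le> 2 * emeasure (K x) B" if B [measurable]: "B \<in> sets borel" for B
  proof (rule AE_le_if_set_nn_integral_le)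
    note H_meas[OF B, measurable] K_meas[OF B, measurable]
    have int_H: "(\<integral>\<^sup>+x\<in>A. H x B \<partial>L) = (\<integral>\<^sup>+z\<in>A \<times> B. h z \<partial>(L \<Otimes>\<^sub>M L))" if [measurable]: "A \<in> sets borel" for A
    proof -
      have "(\<integral>\<^sup>+z\<in>A \<times> B. h z \<partial>(L \<Otimes>\<^sub>M L)) = (\<integral>\<^sup>+x. \<integral>\<^sup>+y. h (x, y) * indicator (A \<times> B) (x, y) \<partial>L \<partial>L)"
        by (rule L.nn_integral_fst[symmetric]) measurable
      also have "\<dots> = (\<integral>\<^sup>+x\<in>A. H x B \<partial>L)"
      proof (rule nn_integral_cong)
        fix x
        have "(\<integral>\<^sup>+y. h (x, y) * indicator (A \<times> B) (x, y) \<partial>L) = (\<integral>\<^sup>+y. (h (x, y) * indicator B y) * indicator A x \<partial>L)"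
          by (intro nn_integral_cong) (auto simp: indicator_def)
        then show "(\<integral>\<^sup>+y. h (x, y) * indicator (A \<times> B) (x, y) \<partial>L) = H x B * indicator A x"
          by (simp add: H_def nn_integral_multc)
      qed
      finally show ?thesis ..
    qed
    show "(\<lambda>x. H x B) \<in> borel_measurable L" "(\<lambda>x. 2 * emeasure (K x) B) \<in> borel_measurable L" by measurable
    have JK: "2 * emeasure (joint L K) (A \<times> B) = (\<integral>\<^sup>+x\<in>A. 2 * emeasure (K x) B \<partial>L)" if [measurable]: "A \<in> sets borel" for A
      by (simp add: emeasure_joint_Times[OF L K] nn_integral_cmult[symmetric] mult.assoc)
    have "(\<integral>\<^sup>+x. H x B \<partial>L) = (\<integral>\<^sup>+x\<in>UNIV. H x B \<partial>L)" by simp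
    also have "\<dots> \<le> 2 * emeasure (joint L K) (UNIV \<times> B)" unfolding int_H[OF sets.top[of borel, unfolded space_borel]] by (rule h_le) auto
    also have "\<dots> < \<infinity>"
    proof -
      have "2 * emeasure (joint L K) (UNIV \<times> B) \<le> 2 * 1"
        using prob_space.emeasure_le_1[OF prob_algebraD(1)[OF joint_in_prob_algebra[OF L K]]] by (intro mult_left_mono) auto
      then show ?thesis by (rule le_less_trans) simp
    qed
    finally show "(\<integral>\<^sup>+x. H x B \<partial>L) \<noteq> \<infinity>" by simp
    fix A assume "A \<in> sets L"
    then have A: "A \<in> sets borel" by (simp add: s)
    show "(\<integral>\<^sup>+x\<in>A. H x B \<partial>L) \<le> (\<integral>\<^sup>+x\<in>A. 2 * emeasure (K x) B \<partial>L)"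
      unfolding int_H[OF A] JK[OF A, symmetric] by (rule h_le[OF A B])
  qed
  \<comment> \<open>Only countably many sets can be handled off one null set. Complements are listed
    too, since a nearly separating U is used on U for one point and off U for the other.\<close>
  define good where "good x \<longleftrightarrow> (\<forall>U\<in>basis_unions. H x U \<le> 2 * emeasure (K x) U \<and> H x (- U) \<le> 2 * emeasure (K x) (- U))" for x
  have good: "AE x in L. good x"
    unfolding good_def
    by (intro AE_ball_countable[THEN iffD2] countable_basis_unions ballI AE_conjI HK) (auto dest: sets_basis_unions)
  have disjoint: "AE y in L. h (x, y) = 0 \<or> h (x', y) = 0" if gx: "good x" "good x'" and tv1: "tv (K x) (K x') = 1" for x x'
  proof -
    have [measurable]: "(\<lambda>y. h (x, y)) \<in> borel_measurable borel" for x
      by (rule measurable_compose[OF measurable_Pair1' h]) simp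
    have "(\<integral>\<^sup>+y. min (h (x, y)) (h (x', y)) \<partial>L) \<le> ennreal (4 * e)" if "0 < e" for e
    proof -
      have "1 - e < tv (K x) (K x')" using tv1 that by simp
      then obtain U where U: "U \<in> basis_unions" and gt: "1 - e < \<bar>measure (K x) U - measure (K x') U\<bar>"
        unfolding tv_def by (subst (asm) less_cSUP_iff) (auto intro!: bdd_above_tv Kx empty_basis_unions)
      have [measurable]: "U \<in> sets borel" by (rule sets_basis_unions[OF U])
      \<comment> \<open>The law of x' has mass at most e on U and the law of x at most e off U, so
        the minimum is bounded by h(x', .) on U and by h(x, .) off U. The 4 is two such pieces, each
        with the factor 2 of the domination.\<close>
      have one: "(\<integral>\<^sup>+y. min (h (x, y)) (h (x', y)) \<partial>L) \<le> ennreal (4 * e)"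
        if g: "good x" "good x'" and gt: "1 - e < measure (K x) U - measure (K x') U" for x x'
      proof -
        have em: "emeasure (K x) A = ennreal (measure (K x) A)" for x A
          using prob_algebraD(1)[OF Kx] by (intro finite_measure.emeasure_eq_measure prob_space.finite_measure)
        have "measure (K x) U \<le> 1" using prob_algebraD(1)[OF Kx] by (rule prob_space.prob_le_1)
        moreover have "measure (K x) (- U) = 1 - measure (K x) U"
          using prob_space.prob_compl[OF prob_algebraD(1)[OF Kx], of U x] prob_algebraD(2,3)[OF Kx, of x]
          by (simp add: Compl_eq_Diff_UNIV)
        ultimately have small: "measure (K x') U \<le> e" "measure (K x) (- U) \<le> e"
          using gt measure_nonneg[of "K x'" U] by linarith+
        have "(\<integral>\<^sup>+y. min (h (x, y)) (h (x', y)) \<partial>L) \<le> (\<integral>\<^sup>+y. h (x', y) * indicator U y + h (x, y) * indicator (- U) y \<partial>L)"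
          by (intro nn_integral_mono) (auto simp: indicator_def)
        also have "\<dots> = H x' U + H x (- U)" unfolding H_def by (rule nn_integral_add) measurable
        also have "\<dots> \<le> 2 * emeasure (K x') U + 2 * emeasure (K x) (- U)"
          using g U by (intro add_mono) (auto simp: good_def)
        also have "\<dots> \<le> 2 * ennreal e + 2 * ennreal e"
          using small by (intro add_mono mult_left_mono) (auto simp: em intro: ennreal_leI)
        also have "\<dots> = ennreal (2 * e) + ennreal (2 * e)" using \<open>0 < e\<close> by (simp add: ennreal_mult)
        also have "\<dots> = ennreal (4 * e)" using \<open>0 < e\<close> by (subst ennreal_plus[symmetric]) auto
        finally show ?thesis .
      qed
      show ?thesis
      proof (cases "measure (K x') U \<le> measure (K x) U")
        case True
        then show ?thesis using one[OF gx] gt by simp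
      next
        case False
        then show ?thesis using one[OF gx(2,1)] gt by (simp add: min.commute)
      qed
    qed
    note min_le = this
    have "(\<integral>\<^sup>+y. min (h (x, y)) (h (x', y)) \<partial>L) \<le> 0"
    proof (rule ennreal_le_epsilon)
      fix e :: real assume "0 < e"
      then show "(\<integral>\<^sup>+y. min (h (x, y)) (h (x', y)) \<partial>L) \<le> 0 + ennreal e"
        using min_le[of "e / 4"] by simp
    qed
    then have "AE y in L. min (h (x, y)) (h (x', y)) = 0"
      by (subst nn_integral_0_iff_AE[symmetric]) auto
    then show ?thesis by eventually_elim (auto simp: min_def split: if_splits)
  qed
  define \<phi> where "\<phi> y = (\<integral>\<^sup>+x. h (x, y) \<partial>L)" for y
  have \<phi>_meas [measurable]: "\<phi> \<in> borel_measurable borel"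
  proof -
    have "(\<lambda>(y, x). h (x, y)) \<in> borel_measurable (borel \<Otimes>\<^sub>M L)" by measurable
    then show ?thesis unfolding \<phi>_def by (rule L.borel_measurable_nn_integral)
  qed
  have sec2 [measurable]: "(\<lambda>x. h (x, y)) \<in> borel_measurable borel" for y
    by (rule measurable_compose[OF measurable_Pair2' h]) simp
  have "AE x in L. AE x' in L. tv (K x) (K x') = 1"
    using LL.AE_pair[OF sing] by simp
  with good have "AE x in L. AE y in L. h (x, y) = 0 \<or> \<phi> y = 0"
  proof eventually_elim
    case (elim x)
    have [measurable]: "(\<lambda>y. h (x, y)) \<in> borel_measurable borel"
      by (rule measurable_compose[OF measurable_Pair1' h]) simp
    from elim(2) good have "AE x' in L. AE y in L. h (x, y) = 0 \<or> h (x', y) = 0"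
      by eventually_elim (rule disjoint[OF elim(1)])
    \<comment> \<open>With x fixed, y and x' are exchanged: wherever h(x, y) is not 0, almost all of
      the column above y vanishes, that is, \<open>\<phi> y\<close> = 0.\<close>
    then have "AE y in L. AE x' in L. h (x, y) = 0 \<or> h (x', y) = 0"
      by (subst LL.AE_commute[symmetric]) measurable
    then show ?case
    proof eventually_elim
      case (elim y)
      show ?case
      proof (cases "h (x, y) = 0")
        case False
        then have "AE x' in L. h (x', y) = 0" using elim by auto
        then have "\<phi> y = 0" unfolding \<phi>_def by (subst nn_integral_0_iff_AE) auto
        then show ?thesis ..
      qed simp
    qed
  qed
  then have "AE y in L. AE x in L. h (x, y) = 0 \<or> \<phi> y = 0"
    by (subst LL.AE_commute[symmetric]) measurable
  then have "AE y in L. \<phi> y = 0"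
  proof eventually_elim
    case (elim y)
    show ?case
    proof (rule ccontr)
      assume "\<phi> y \<noteq> 0"
      then have "AE x in L. h (x, y) = 0" using elim by auto
      then have "\<phi> y = 0" unfolding \<phi>_def by (subst nn_integral_0_iff_AE) auto
      with \<open>\<phi> y \<noteq> 0\<close> show False ..
    qed
  qed
  then have "(\<integral>\<^sup>+y. \<phi> y \<partial>L) = 0" by (subst nn_integral_0_iff_AE) auto
  moreover have "(\<integral>\<^sup>+y. \<phi> y \<partial>L) = (\<integral>\<^sup>+z. h z \<partial>(L \<Otimes>\<^sub>M L))"
    unfolding \<phi>_def by (rule LL.nn_integral_snd) measurable
  ultimately show False using h_pos by simp
qed

text \<open>At \<theta> = 1 no P-component is split off the kernel. The rectangle condition comes
  from coordinatewise maxima, and singularity is excluded at the first power, where crossings of the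
  median make the absolutely continuous part nonzero.\<close>

lemma absolutely_regular_C_one:
  assumes \<mu>: "copula_law \<mu> C"
    and X: "copula_markov_chain C M X" "absolutely_regular M X"
    and Y: "copula_markov_chain (C_one C) N Y"
  shows "absolutely_regular N Y"
proof -
  obtain P where P: "prob_kernel P" "joint unif01 P = \<mu>" "unif01 \<bind> P = unif01" by (rule copula_law_kernel[OF \<mu>])
  obtain K where K: "prob_kernel K" "joint unif01 K = order_law \<mu>" "unif01 \<bind> K = unif01"
    by (rule copula_law_kernel[OF copula_law_order_law[OF \<mu>]])
  interpret X: kernel_chain M X unif01 P using \<mu> P by (intro kernel_chainI[OF X(1)]) auto
  interpret Y: kernel_chain N Y unif01 K
    using copula_law_order_law[OF \<mu>] K by (intro kernel_chainI[OF Y]) auto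
  note mix = X.tv_tendsto_0_if_absolutely_regular[OF X(2) P(3)]
  obtain h :: "real \<times> real \<Rightarrow> ennreal" where h: "h \<in> borel_measurable (borel \<Otimes>\<^sub>M borel)"
    "\<And>A B. A \<in> sets borel \<Longrightarrow> B \<in> sets borel \<Longrightarrow>
      (\<integral>\<^sup>+z\<in>A \<times> B. h z \<partial>(unif01 \<Otimes>\<^sub>M unif01)) \<le> 2 * emeasure (order_law \<mu>) (A \<times> B)"
    and h_ge: "emeasure \<mu> ({1/2<..} \<times> {..1/2}) * emeasure \<mu> ({..1/2} \<times> {1/2<..}) \<le> (\<integral>\<^sup>+z. h z \<partial>(unif01 \<Otimes>\<^sub>M unif01))"
    by (rule order_law_ac_part[OF \<mu>]) blast
  have h_pos: "(\<integral>\<^sup>+z. h z \<partial>(unif01 \<Otimes>\<^sub>M unif01)) \<noteq> 0"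
    using mixing_crosses_half[OF \<mu> P mix] h_ge by auto
  have "\<not> (AE z in unif01 \<Otimes>\<^sub>M unif01. tv (K (fst z)) (K (snd z)) = 1)"
    by (rule not_AE_tv_eq_1_if_ac_part[OF unif01_in_prob_algebra K(1) h(1) _ h_pos]) (simp add: K(2) h(2))
  moreover have "kpow K (Suc 0) = K"
    using prob_algebraD(2)[OF prob_kernelD[OF K(1)]] by (auto simp: bind_return'')
  ultimately have nonsing: "\<not> (\<forall>n. AE z in unif01 \<Otimes>\<^sub>M unif01. tv (kpow K n (fst z)) (kpow K n (snd z)) = 1)"
    by metis
  show ?thesis
  proof (rule Y.absolutely_regular_if_tv[OF tv_kpow_tendsto_0[OF unif01_in_prob_algebra K(1,3) P(1,3) _ mix nonsing] K(3)])
    fix A B :: "real set" assume "A \<in> sets borel" "B \<in> sets borel" "emeasure (joint unif01 K) (A \<times> B) = 0"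
    then show "emeasure (joint unif01 P) (A \<times> B) = 0"
      using order_law_rectangle[OF \<mu>] by (simp add: K P)
  qed
qed

text \<open>The endpoints left out are genuine exceptions: at \<theta> = 0 \<open>C_tilde\<close>
  returns \<open>C\<close> itself, and at \<theta> = 1 \<open>C_hat\<close> returns M on the unit
  square, whose chain is almost surely constant in time. The chains of \<open>C\<close> and of the
  perturbation live on unrelated probability spaces; only the kernels obtained from the copulas link
  them.\<close>

theorem theorem2p1p2:
  fixes C :: "real \<Rightarrow> real \<Rightarrow> real" and \<theta> :: real
    and M :: "'a measure" and X :: "int \<Rightarrow> 'a \<Rightarrow> real"
    and N :: "'b measure" and Y :: "int \<Rightarrow> 'b \<Rightarrow> real"
  assumes "copula C" and "0 \<le> \<theta>" and "\<theta> \<le> 1"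
  shows "(0 < \<theta> \<longrightarrow> copula_markov_chain (C_tilde C \<theta>) N Y \<longrightarrow> geometrically_ergodic N Y)
    \<and> (\<theta> < 1 \<longrightarrow> copula_markov_chain C M X \<and> absolutely_regular M X \<longrightarrow>
         copula_markov_chain (C_hat C \<theta>) N Y \<longrightarrow> absolutely_regular N Y)
    \<and> (copula_markov_chain C M X \<and> absolutely_regular M X \<longrightarrow>
         copula_markov_chain (C_H C \<theta>) N Y \<longrightarrow> absolutely_regular N Y)"
proof (intro conjI impI)
  assume "0 < \<theta>" "copula_markov_chain (C_tilde C \<theta>) N Y"
  then show "geometrically_ergodic N Y" by (rule geometrically_ergodic_mix_Pi[OF assms(1) _ assms(3)])
next
  obtain \<mu> where \<mu>: "copula_law \<mu> C" by (rule copula_imp_law[OF assms(1)])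
  assume \<theta>: "\<theta> < 1" and X: "copula_markov_chain C M X \<and> absolutely_regular M X"
    and Y: "copula_markov_chain (C_hat C \<theta>) N Y"
  show "absolutely_regular N Y"
    by (rule absolutely_regular_mix[OF assms(2) \<theta> \<mu> copula_law_M conjunct1[OF X] conjunct2[OF X] Y])
      (simp add: C_hat_def algebra_simps)
next
  obtain \<mu> where \<mu>: "copula_law \<mu> C" by (rule copula_imp_law[OF assms(1)])
  assume X: "copula_markov_chain C M X \<and> absolutely_regular M X" and Y: "copula_markov_chain (C_H C \<theta>) N Y"
  show "absolutely_regular N Y"
  proof (cases "\<theta> < 1")
    case True
    show ?thesis
      by (rule absolutely_regular_mix[OF assms(2) True \<mu> copula_law_order_law[OF \<mu>] conjunct1[OF X] conjunct2[OF X] Y])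
        (simp add: C_H_def)
  next
    case False
    with assms(3) have "\<theta> = 1" by simp
    then have "C_H C \<theta> = C_one C" by (intro ext) (simp add: C_H_def)
    with Y have "copula_markov_chain (C_one C) N Y" by simp
    then show ?thesis by (rule absolutely_regular_C_one[OF \<mu> conjunct1[OF X] conjunct2[OF X]])
  qed
qed

end
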